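(* Restricted to ONE-ONE-LQ instances that admit at least one feasible, envy-free matching, MAXEFM (given $(G,k)$, decide whether $G$ has a feasible envy-free matching of size $k$) admits a polynomial kernel with respect to the combined parameter $(s,t)$. Restricted to ONE-ONE-LQ instances in which a stable matching is feasible, MAXRSM (given $(G,k)$, decide whether $G$ has a feasible relaxed stable matching of size $k$) admits a polynomial kernel with respect to the parameter $s$.
   Context: A ONE-ONE-LQ instance consists of a bipartite graph $G=(\mathcal{A}\cup\mathcal{B},E)$ of agents $\mathcal{A}$ and resources $\mathcal{B}$; every vertex has a strict preference order over its neighbours ($v\succ_u w$: $u$ prefers $v$ to $w$). Every resource has upper-quota $1$ and lower-quota $q^-(b)\in\{0,1\}$; $b$ is an LQ resource if $q^-(b)=1$. A matching $M\subseteq E$ has every vertex in at most one edge; $M(v)$ is the partner of $v$ or $\bot$ (least preferred) if unmatched. $M$ is feasible if every LQ resource is matched. $(a,b)\in E\setminus M$ is a blocking pair if $b\succ_a M(a)$ and $a\succ_b M(b)$; $M$ is stable if it has none (all stable matchings have the same size). $a$ envies a matched agent $a'$ with $M(a')=b$ if $(a,b)\in E$, $b\succ_a M(a)$, $a\succ_b a'$; $M$ is envy-free if there is no such pair. $M$ is relaxed stable if every agent in a blocking pair is matched and matched to an LQ resource. Parameters: $s$ = size of a stable matching; $t$ = maximum over pairs of agents of the number of non-LQ resources common to both agents' preference lists. A polynomial kernel is a polynomial-time algorithm mapping an instance $(G,k)$ to an equivalent instance $(G',k')$ whose size is bounded by a polynomial in the parameter. *)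

theory Defs
  imports
    "HOL-Computational_Algebra.Polynomial"
    "HOL-Library.Discrete_Functions"
begin

section \<open>Polynomial-time computation\<close>

text \<open>
  The model of computation is a random access machine in structured form: finitely many registers
  and finitely many one-dimensional arrays of natural numbers (indirect addressing), constants,
  addition, truncated subtraction, comparisons, branching and loops, every elementary command
  costing one step. There is deliberately no multiplication: with addition and subtraction only,
  \<open>T\<close> unit-cost steps lengthen the binary representation of a value by \<open>O(T)\<close> bits, so that
  polynomial time here coincides with polynomial time on Turing machines.
\<close>

datatype aexp =
    Const nat
  | Reg nat
  | Cell nat aexp
  | Plus aexp aexp
  | Minus aexp aexp

datatype bexp =
    Less aexp aexp
  | Equal aexp aexp
  | Neg bexp
  | Conj bexp bexp

datatype com =
    Skip
  | SetReg nat aexp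
  | SetCell nat aexp aexp
  | Seq com com
  | Cond bexp com com
  | Loop bexp com

record ram_state =
  reg :: "nat \<Rightarrow> nat"
  arr :: "nat \<Rightarrow> nat \<Rightarrow> nat"

fun aval :: "aexp \<Rightarrow> ram_state \<Rightarrow> nat" where
  "aval (Const n) \<sigma> = n"
| "aval (Reg x) \<sigma> = reg \<sigma> x"
| "aval (Cell A e) \<sigma> = arr \<sigma> A (aval e \<sigma>)"
| "aval (Plus e f) \<sigma> = aval e \<sigma> + aval f \<sigma>"
| "aval (Minus e f) \<sigma> = aval e \<sigma> - aval f \<sigma>"

fun bval :: "bexp \<Rightarrow> ram_state \<Rightarrow> bool" where
  "bval (Less e f) \<sigma> \<longleftrightarrow> aval e \<sigma> < aval f \<sigma>"
| "bval (Equal e f) \<sigma> \<longleftrightarrow> aval e \<sigma> = aval f \<sigma>"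
| "bval (Neg b) \<sigma> \<longleftrightarrow> \<not> bval b \<sigma>"
| "bval (Conj b c) \<sigma> \<longleftrightarrow> bval b \<sigma> \<and> bval c \<sigma>"

text \<open>\<open>exec c \<sigma> n \<tau>\<close>: started in \<open>\<sigma>\<close>, the program \<open>c\<close> halts after \<open>n\<close> steps in \<open>\<tau>\<close>.\<close>

inductive exec :: "com \<Rightarrow> ram_state \<Rightarrow> nat \<Rightarrow> ram_state \<Rightarrow> bool" where
  exec_Skip: "exec Skip \<sigma> 1 \<sigma>"
| exec_SetReg: "exec (SetReg x e) \<sigma> 1 (\<sigma>\<lparr>reg := (reg \<sigma>)(x := aval e \<sigma>)\<rparr>)"
| exec_SetCell: "exec (SetCell A e f) \<sigma> 1
    (\<sigma>\<lparr>arr := (arr \<sigma>)(A := (arr \<sigma> A)(aval e \<sigma> := aval f \<sigma>))\<rparr>)"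
| exec_Seq: "exec c \<sigma> m \<sigma>' \<Longrightarrow> exec d \<sigma>' n \<sigma>'' \<Longrightarrow> exec (Seq c d) \<sigma> (m + n) \<sigma>''"
| exec_CondTrue: "bval b \<sigma> \<Longrightarrow> exec c \<sigma> n \<sigma>' \<Longrightarrow> exec (Cond b c d) \<sigma> (n + 1) \<sigma>'"
| exec_CondFalse: "\<not> bval b \<sigma> \<Longrightarrow> exec d \<sigma> n \<sigma>' \<Longrightarrow> exec (Cond b c d) \<sigma> (n + 1) \<sigma>'"
| exec_LoopTrue: "bval b \<sigma> \<Longrightarrow> exec c \<sigma> m \<sigma>' \<Longrightarrow> exec (Loop b c) \<sigma>' n \<sigma>'' \<Longrightarrow>
    exec (Loop b c) \<sigma> (m + n + 1) \<sigma>''"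
| exec_LoopFalse: "\<not> bval b \<sigma> \<Longrightarrow> exec (Loop b c) \<sigma> 1 \<sigma>"

lemma exec_deterministic:
  "exec c \<sigma> n \<tau> \<Longrightarrow> exec c \<sigma> n' \<tau>' \<Longrightarrow> n' = n \<and> \<tau>' = \<tau>"
proof (induction arbitrary: n' \<tau>' rule: exec.induct)
  case (exec_Skip \<sigma>)
  then show ?case by (auto elim: exec.cases)
next
  case (exec_SetReg x e \<sigma>)
  then show ?case by (auto elim: exec.cases)
next
  case (exec_SetCell A e f \<sigma>)
  then show ?case by (auto elim: exec.cases)
next
  case (exec_Seq c \<sigma> m \<sigma>' d n \<sigma>'')
  from exec_Seq.prems show ?case
    by cases (use exec_Seq.IH in blast)
next
  case (exec_CondTrue b \<sigma> c n \<sigma>' d)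
  from exec_CondTrue.prems show ?case
    by cases (use exec_CondTrue in blast)+
next
  case (exec_CondFalse b \<sigma> d n \<sigma>' c)
  from exec_CondFalse.prems show ?case
    by cases (use exec_CondFalse in blast)+
next
  case (exec_LoopTrue b \<sigma> c m \<sigma>' n \<sigma>'')
  from exec_LoopTrue.prems show ?case
    by cases (use exec_LoopTrue in blast)+
next
  case (exec_LoopFalse b \<sigma> c)
  then show ?case by (auto elim: exec.cases)
qed

text \<open>
  Input and output words are held in array 0, their length in register 0; all other memory is
  initially zero. The letters of a word are natural numbers, and the size of a word is its length
  in bits when they are written in binary (\<open>floor_log x + 1\<close> is the number of binary digits of \<open>x\<close>).
\<close>

definition initial :: "nat list \<Rightarrow> ram_state" where
  "initial w = \<lparr>reg = (\<lambda>x. if x = 0 then length w else 0),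
     arr = (\<lambda>A i. if A = 0 \<and> i < length w then w ! i else 0)\<rparr>"

definition output_word :: "ram_state \<Rightarrow> nat list" where
  "output_word \<sigma> = map (arr \<sigma> 0) [0..<reg \<sigma> 0]"

definition word_size :: "nat list \<Rightarrow> nat" where
  "word_size w = (\<Sum>x\<leftarrow>w. floor_log x + 1)"

definition poly_time_on :: "('i \<Rightarrow> nat list) \<Rightarrow> 'i set \<Rightarrow> ('i \<Rightarrow> 'i) \<Rightarrow> bool" where
  "poly_time_on enc I f \<longleftrightarrow>
     (\<exists>(c :: com) (q :: nat poly). \<forall>x\<in>I. \<exists>n \<tau>.
        exec c (initial (enc x)) n \<tau> \<and> output_word \<tau> = enc (f x) \<and>
        n \<le> poly q (word_size (enc x)))"

text \<open>
  The problem with instance set \<open>I\<close> and set \<open>Y\<close> of yes-instances, parameterized by \<open>\<kappa>\<close>: as usual,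
  a kernelization maps instances of the (restricted) problem to instances of the same problem.
  A combined parameter \<open>(s, t)\<close> is represented by \<open>s + t\<close>: on natural numbers, being bounded by a
  polynomial in \<open>s\<close> and \<open>t\<close> is the same as being bounded by a polynomial in \<open>s + t\<close>.
\<close>

definition admits_poly_kernel ::
    "('i \<Rightarrow> nat list) \<Rightarrow> 'i set \<Rightarrow> 'i set \<Rightarrow> ('i \<Rightarrow> nat) \<Rightarrow> bool" where
  "admits_poly_kernel enc I Y \<kappa> \<longleftrightarrow>
     (\<exists>f. poly_time_on enc I f \<and>
          (\<forall>x\<in>I. f x \<in> I \<and> (f x \<in> Y \<longleftrightarrow> x \<in> Y)) \<and>
          (\<exists>p :: nat poly. \<forall>x\<in>I. word_size (enc (f x)) \<le> poly p (\<kappa> x)))"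


section \<open>Instances\<close>

text \<open>
  The agents are \<open>0, \<dots>, length (apref G) - 1\<close>, the resources \<open>0, \<dots>, length (bpref G) - 1\<close>. The
  preference list of a vertex enumerates its neighbours, the most preferred one first, so the
  lists determine the edges; \<open>lq G ! b\<close> states that the lower quota of \<open>b\<close> is 1.
\<close>

record lq_instance =
  apref :: "nat list list"
  bpref :: "nat list list"
  lq :: "bool list"

definition agents :: "lq_instance \<Rightarrow> nat set" where
  "agents G = {..<length (apref G)}"

definition resources :: "lq_instance \<Rightarrow> nat set" where
  "resources G = {..<length (bpref G)}"

definition is_lq :: "lq_instance \<Rightarrow> nat \<Rightarrow> bool" where
  "is_lq G b \<longleftrightarrow> b \<in> resources G \<and> lq G ! b"

definition edges :: "lq_instance \<Rightarrow> (nat \<times> nat) set" where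
  "edges G = {(a, b). a \<in> agents G \<and> b \<in> set (apref G ! a)}"

definition wf_instance :: "lq_instance \<Rightarrow> bool" where
  "wf_instance G \<longleftrightarrow>
     length (lq G) = length (bpref G) \<and>
     (\<forall>a\<in>agents G. distinct (apref G ! a) \<and> set (apref G ! a) \<subseteq> resources G) \<and>
     (\<forall>b\<in>resources G. distinct (bpref G ! b) \<and> set (bpref G ! b) \<subseteq> agents G) \<and>
     (\<forall>a\<in>agents G. \<forall>b\<in>resources G. b \<in> set (apref G ! a) \<longleftrightarrow> a \<in> set (bpref G ! b))"

definition precedes :: "nat list \<Rightarrow> nat \<Rightarrow> nat \<Rightarrow> bool" where
  "precedes xs v w \<longleftrightarrow> (\<exists>i j. i < j \<and> j < length xs \<and> xs ! i = v \<and> xs ! j = w)"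

text \<open>\<open>None\<close> stands for \<open>\<bottom>\<close>, being unmatched, which is worse than every neighbour.\<close>

fun precedes_opt :: "nat list \<Rightarrow> nat \<Rightarrow> nat option \<Rightarrow> bool" where
  "precedes_opt xs v None \<longleftrightarrow> v \<in> set xs"
| "precedes_opt xs v (Some w) \<longleftrightarrow> precedes xs v w"


section \<open>Matchings\<close>

definition matching :: "lq_instance \<Rightarrow> (nat \<times> nat) set \<Rightarrow> bool" where
  "matching G M \<longleftrightarrow> M \<subseteq> edges G \<and>
     (\<forall>a b b'. (a, b) \<in> M \<and> (a, b') \<in> M \<longrightarrow> b = b') \<and>
     (\<forall>a a' b. (a, b) \<in> M \<and> (a', b) \<in> M \<longrightarrow> a = a')"

definition apartner :: "(nat \<times> nat) set \<Rightarrow> nat \<Rightarrow> nat option" where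
  "apartner M a = (if \<exists>b. (a, b) \<in> M then Some (THE b. (a, b) \<in> M) else None)"

definition bpartner :: "(nat \<times> nat) set \<Rightarrow> nat \<Rightarrow> nat option" where
  "bpartner M b = (if \<exists>a. (a, b) \<in> M then Some (THE a. (a, b) \<in> M) else None)"

definition feasible :: "lq_instance \<Rightarrow> (nat \<times> nat) set \<Rightarrow> bool" where
  "feasible G M \<longleftrightarrow> (\<forall>b. is_lq G b \<longrightarrow> bpartner M b \<noteq> None)"

definition blocking_pair :: "lq_instance \<Rightarrow> (nat \<times> nat) set \<Rightarrow> nat \<Rightarrow> nat \<Rightarrow> bool" where
  "blocking_pair G M a b \<longleftrightarrow> (a, b) \<in> edges G - M \<and>
     precedes_opt (apref G ! a) b (apartner M a) \<and>
     precedes_opt (bpref G ! b) a (bpartner M b)"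

definition stable :: "lq_instance \<Rightarrow> (nat \<times> nat) set \<Rightarrow> bool" where
  "stable G M \<longleftrightarrow> matching G M \<and> (\<forall>a b. \<not> blocking_pair G M a b)"

definition envies :: "lq_instance \<Rightarrow> (nat \<times> nat) set \<Rightarrow> nat \<Rightarrow> nat \<Rightarrow> bool" where
  "envies G M a a' \<longleftrightarrow> (\<exists>b. apartner M a' = Some b \<and> (a, b) \<in> edges G \<and>
     precedes_opt (apref G ! a) b (apartner M a) \<and> precedes (bpref G ! b) a a')"

definition envy_free :: "lq_instance \<Rightarrow> (nat \<times> nat) set \<Rightarrow> bool" where
  "envy_free G M \<longleftrightarrow> matching G M \<and> (\<forall>a a'. \<not> envies G M a a')"

definition relaxed_stable :: "lq_instance \<Rightarrow> (nat \<times> nat) set \<Rightarrow> bool" where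
  "relaxed_stable G M \<longleftrightarrow> matching G M \<and>
     (\<forall>a b. blocking_pair G M a b \<longrightarrow> (\<exists>b'. apartner M a = Some b' \<and> is_lq G b'))"


section \<open>The parameters and the two problems\<close>

text \<open>All stable matchings have the same size.\<close>

definition stable_size :: "lq_instance \<Rightarrow> nat" where
  "stable_size G = (THE n. \<exists>M. stable G M \<and> card M = n)"

text \<open>The maximum is 0 if there are fewer than two agents.\<close>

definition max_common :: "lq_instance \<Rightarrow> nat" where
  "max_common G = Max (insert 0
     {card {b \<in> resources G. \<not> is_lq G b \<and> b \<in> set (apref G ! a) \<and> b \<in> set (apref G ! a')}
       | a a'. a \<in> agents G \<and> a' \<in> agents G \<and> a \<noteq> a'})"

definition encode_lists :: "nat list list \<Rightarrow> nat list" where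
  "encode_lists xss = concat (map (\<lambda>xs. length xs # xs) xss)"

definition encode :: "lq_instance \<times> nat \<Rightarrow> nat list" where
  "encode = (\<lambda>(G, k). [k, length (apref G), length (bpref G)] @ map of_bool (lq G) @
     encode_lists (apref G) @ encode_lists (bpref G))"

lemma encode_lists_inj:
  assumes "length xss = length yss" and "encode_lists xss @ us = encode_lists yss @ vs"
  shows "xss = yss \<and> us = vs"
  using assms by (induction xss yss rule: list_induct2) (auto simp: encode_lists_def)

lemma encode_inj: "inj_on encode {(G, k). wf_instance G}"
proof (rule inj_onI, clarify)
  fix G k H l
  assume wf: "wf_instance G" "wf_instance H" and eq: "encode (G, k) = encode (H, l)"
  from eq have k: "k = l" and la: "length (apref G) = length (apref H)"
    and lb: "length (bpref G) = length (bpref H)"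
    and rest: "map of_bool (lq G) @ encode_lists (apref G) @ encode_lists (bpref G) =
      (map of_bool (lq H) :: nat list) @ encode_lists (apref H) @ encode_lists (bpref H)"
    by (auto simp: encode_def)
  have "length (lq G) = length (lq H)"
    using wf lb by (simp add: wf_instance_def)
  with rest have m: "map of_bool (lq G) = (map of_bool (lq H) :: nat list)"
    and rest': "encode_lists (apref G) @ encode_lists (bpref G) =
      encode_lists (apref H) @ encode_lists (bpref H)"
    by auto
  have "inj (of_bool :: bool \<Rightarrow> nat)"
    by (simp add: inj_def)
  with m have q: "lq G = lq H"
    by (simp add: inj_map_eq_map)
  from encode_lists_inj[OF la rest'] have "apref G = apref H"
    and "encode_lists (bpref G) = encode_lists (bpref H)" by auto
  moreover from this(2) have "bpref G = bpref H"
    using encode_lists_inj[OF lb, of "[]" "[]"] by simp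
  ultimately show "G = H \<and> k = l"
    using q k by simp
qed

definition maxefm_yes :: "(lq_instance \<times> nat) set" where
  "maxefm_yes = {(G, k). \<exists>M. feasible G M \<and> envy_free G M \<and> card M = k}"

definition maxrsm_yes :: "(lq_instance \<times> nat) set" where
  "maxrsm_yes = {(G, k). \<exists>M. feasible G M \<and> relaxed_stable G M \<and> card M = k}"

definition efm_instances :: "(lq_instance \<times> nat) set" where
  "efm_instances = {(G, k). wf_instance G \<and> (\<exists>M. feasible G M \<and> envy_free G M)}"

definition stable_feasible_instances :: "(lq_instance \<times> nat) set" where
  "stable_feasible_instances = {(G, k). wf_instance G \<and> (\<exists>M. stable G M \<and> feasible G M)}"

end

theory Submission
  imports Defs
begin

text \<open>
  Let \<open>X\<close> consist of the LQ resources and the endpoints of a greedy maximal matching. Every edge meets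
  \<open>X\<close>, and \<open>|X| \<le> 6 s\<close>, since every matching has at most \<open>2 s\<close> edges. For every vertex of \<open>X\<close> keep its
  \<open>|X| + 1\<close> most preferred neighbours outside \<open>X\<close>. In any matching at most \<open>|X|\<close> vertices outside \<open>X\<close> are
  matched, so if a deleted vertex \<open>u\<close> is adjacent to \<open>v \<in> X\<close>, then \<open>v\<close> prefers some unmatched kept
  neighbour to \<open>u\<close>. Hence a relaxed stable matching cannot use \<open>u\<close>, and a blocking pair \<open>{u, v}\<close> yields
  one among kept vertices; the same holds for agents and envy.

  An unmatched resource causes no envy, so for envy-free matchings the resources are treated
  differently: outside \<open>X\<close> those with at least two neighbours are all kept (their number is bounded
  through \<open>t\<close>), and an agent matched to a deleted resource, of which it is the only neighbour, can
  move to a better kept one of the same kind.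
\<close>

section \<open>Running programs\<close>

text \<open>Two features of the problems shape the reduction. Both carry a promise, so the kernel
  must itself admit a feasible envy-free, respectively feasible stable, matching; the transfer of
  matchings to the kept vertices therefore has to preserve more than the answer. And the target
  \<open>k\<close> is a letter of the input that no parameter bounds. It is replaced by the minimum
  of \<open>k\<close> and one more than the number of kept agents, a size that no matching of the
  kernel attains. The cover comes from a greedy matching rather than a stable one, so that the
  machine only scans the agents' lists. Stable matchings occur in the analysis alone; since
  \<open>stable_size\<close> is a definite description, their existence and their equal size have to
  be proved before any bound in terms of it can be used. Polynomial time refers to a concrete
  machine, so the reduction is a program text verified with explicit step bounds. A flag
  \<open>efm\<close> in the text selects the problem; everything else is shared.\<close>

definition run :: "com \<Rightarrow> ram_state \<Rightarrow> (nat \<Rightarrow> ram_state \<Rightarrow> bool) \<Rightarrow> bool" where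
  "run c \<sigma> Q \<longleftrightarrow> (\<exists>n \<tau>. exec c \<sigma> n \<tau> \<and> Q n \<tau>)"


text \<open>Equivalences, not mere rules: loop-free code is executed symbolically by rewriting, the
  step count being threaded through the first argument of the postcondition.\<close>

lemma run_Skip: "run Skip \<sigma> Q \<longleftrightarrow> Q 1 \<sigma>"
  unfolding run_def by (subst exec.simps) auto

lemma run_SetReg:
  "run (SetReg x e) \<sigma> Q \<longleftrightarrow> Q 1 (\<sigma>\<lparr>reg := (reg \<sigma>)(x := aval e \<sigma>)\<rparr>)"
  unfolding run_def by (subst exec.simps) auto

lemma run_SetCell:
  "run (SetCell A e f) \<sigma> Q \<longleftrightarrow>
     Q 1 (\<sigma>\<lparr>arr := (arr \<sigma>)(A := (arr \<sigma> A)(aval e \<sigma> := aval f \<sigma>))\<rparr>)"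
  unfolding run_def by (subst exec.simps) auto

lemma run_Seq:
  "run (Seq c d) \<sigma> Q \<longleftrightarrow> run c \<sigma> (\<lambda>m \<tau>. run d \<tau> (\<lambda>n. Q (m + n)))"
  unfolding run_def by (subst exec.simps) (simp, blast)

lemma run_Cond:
  "run (Cond b c d) \<sigma> Q \<longleftrightarrow>
     (if bval b \<sigma> then run c \<sigma> (\<lambda>n. Q (n + 1)) else run d \<sigma> (\<lambda>n. Q (n + 1)))"
  unfolding run_def by (subst exec.simps) auto

lemmas run_simps = run_Skip run_SetReg run_SetCell run_Seq run_Cond

lemma run_mono: "run c \<sigma> Q \<Longrightarrow> (\<And>n \<tau>. Q n \<tau> \<Longrightarrow> Q' n \<tau>) \<Longrightarrow> run c \<sigma> Q'"
  unfolding run_def by blast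

lemma run_Seq_bounded:
  assumes "run c \<sigma> (\<lambda>n \<tau>. n \<le> s \<and> P \<tau>)"
    and "\<And>\<tau>. P \<tau> \<Longrightarrow> run d \<tau> (\<lambda>n \<tau>'. n \<le> t \<and> Q \<tau>')"
  shows "run (Seq c d) \<sigma> (\<lambda>n \<tau>. n \<le> s + t \<and> Q \<tau>)"
  unfolding run_Seq by (rule run_mono[OF assms(1)]) (force intro: run_mono[OF assms(2)])

text \<open>The bound \<open>e\<close> is evaluated anew before every round, so it must stay
  constant under the body.\<close>

definition For :: "nat \<Rightarrow> aexp \<Rightarrow> com \<Rightarrow> com" where
  "For r e c = Seq (SetReg r (Const 0))
     (Loop (Less (Reg r) e) (Seq c (SetReg r (Plus (Reg r) (Const 1)))))"

text \<open>The invariant speaks about the loop head, hence the body has to establish it after the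
  increment of \<open>r\<close>. A round costs the body plus one step each for the increment and the
  test, at most \<open>t + 1\<close> because the body takes fewer than \<open>t\<close> steps; the
  initial assignment and the failing test give the final 2.\<close>

lemma run_For:
  assumes init: "I 0 (\<sigma>\<lparr>reg := (reg \<sigma>)(r := 0)\<rparr>)"
    and guard: "\<And>i \<tau>. I i \<tau> \<Longrightarrow> i \<le> K \<Longrightarrow> reg \<tau> r = i \<and> aval e \<tau> = K"
    and body: "\<And>i \<tau>. i < K \<Longrightarrow> I i \<tau> \<Longrightarrow>
      run c \<tau> (\<lambda>n \<tau>'. n < t \<and> I (Suc i) (\<tau>'\<lparr>reg := (reg \<tau>')(r := Suc (reg \<tau>' r))\<rparr>))"
    and post: "\<And>n \<tau>. I K \<tau> \<Longrightarrow> n \<le> K * (t + 1) + 2 \<Longrightarrow> Q n \<tau>"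
  shows "run (For r e c) \<sigma> Q"
proof -
  let ?body = "Seq c (SetReg r (Plus (Reg r) (Const 1)))"
  have loop: "\<exists>n \<tau>'. exec (Loop (Less (Reg r) e) ?body) \<tau> n \<tau>' \<and> I K \<tau>' \<and> n \<le> d * (t + 1) + 1"
    if "I i \<tau>" "i + d = K" for i d \<tau>
    using that
  proof (induction d arbitrary: i \<tau>)
    case 0
    then have "\<not> bval (Less (Reg r) e) \<tau>"
      using guard[of i \<tau>] by simp
    then show ?case
      using 0 exec_LoopFalse by fastforce
  next
    case (Suc d)
    then have g: "bval (Less (Reg r) e) \<tau>"
      using guard[of i \<tau>] by simp
    from body[of i \<tau>] Suc.prems obtain n \<tau>' where e: "exec c \<tau> n \<tau>'" and n: "n < t"
      and I: "I (Suc i) (\<tau>'\<lparr>reg := (reg \<tau>')(r := Suc (reg \<tau>' r))\<rparr>)" (is "I _ ?\<tau>")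
      unfolding run_def by auto
    have s: "exec (SetReg r (Plus (Reg r) (Const 1))) \<tau>' 1 ?\<tau>"
      using exec_SetReg[of r "Plus (Reg r) (Const 1)" \<tau>'] by simp
    from Suc.IH[OF I] Suc.prems obtain l \<tau>'' where
      "exec (Loop (Less (Reg r) e) ?body) ?\<tau> l \<tau>''" "I K \<tau>''" "l \<le> d * (t + 1) + 1"
      by auto
    with exec_LoopTrue[OF g exec_Seq[OF e s]] n show ?case
      by (intro exI[of _ "n + 1 + l + 1"] exI[of _ \<tau>'']) auto
  qed
  from loop[OF init, of K] obtain n \<tau> where
    "exec (Loop (Less (Reg r) e) ?body) (\<sigma>\<lparr>reg := (reg \<sigma>)(r := 0)\<rparr>) n \<tau>"
    and n: "I K \<tau>" "n \<le> K * (t + 1) + 1"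
    by auto
  moreover have "Q (1 + n) \<tau>"
    by (rule post) (use n in auto)
  ultimately show ?thesis
    unfolding For_def run_Seq run_SetReg aval.simps unfolding run_def by blast
qed

section \<open>Stable matchings in bipartite graphs with preferences\<close>

text \<open>Graphs are bare relations here, so that they can be cut down to kept vertices or
  renumbered without touching preference lists.\<close>

definition rel_matching :: "('a \<times> 'b) set \<Rightarrow> ('a \<times> 'b) set \<Rightarrow> bool" where
  "rel_matching E M \<longleftrightarrow> M \<subseteq> E \<and>
     (\<forall>a b b'. (a, b) \<in> M \<and> (a, b') \<in> M \<longrightarrow> b = b') \<and>
     (\<forall>a a' b. (a, b) \<in> M \<and> (a', b) \<in> M \<longrightarrow> a = a')"

lemma rel_matching_subset: "rel_matching E M \<Longrightarrow> M \<subseteq> E"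
  by (simp add: rel_matching_def)

lemma rel_matching_fst: "rel_matching E M \<Longrightarrow> (a, b) \<in> M \<Longrightarrow> (a, b') \<in> M \<Longrightarrow> b = b'"
  unfolding rel_matching_def by blast

lemma rel_matching_snd: "rel_matching E M \<Longrightarrow> (a, b) \<in> M \<Longrightarrow> (a', b) \<in> M \<Longrightarrow> a = a'"
  unfolding rel_matching_def by blast

lemma inj_on_fst_matching: "rel_matching E M \<Longrightarrow> inj_on fst M"
  by (auto simp: inj_on_def dest: rel_matching_fst)

lemma inj_on_snd_matching: "rel_matching E M \<Longrightarrow> inj_on snd M"
  by (auto simp: inj_on_def dest: rel_matching_snd)

text \<open>
  \<open>P a b b'\<close>: agent \<open>a\<close> prefers \<open>b\<close> to \<open>b'\<close>; \<open>R b a a'\<close>: resource \<open>b\<close> prefers \<open>a\<close> to \<open>a'\<close>.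
\<close>

definition blocks ::
    "('a \<times> 'b) set \<Rightarrow> ('a \<Rightarrow> 'b \<Rightarrow> 'b \<Rightarrow> bool) \<Rightarrow> ('b \<Rightarrow> 'a \<Rightarrow> 'a \<Rightarrow> bool) \<Rightarrow>
     ('a \<times> 'b) set \<Rightarrow> 'a \<Rightarrow> 'b \<Rightarrow> bool" where
  "blocks E P R M a b \<longleftrightarrow> (a, b) \<in> E - M \<and>
     (\<forall>b'. (a, b') \<in> M \<longrightarrow> P a b b') \<and> (\<forall>a'. (a', b) \<in> M \<longrightarrow> R b a a')"

text \<open>With \<open>Q = {}\<close> this is stability, with \<open>Q\<close> the set of LQ resources it is relaxed stability.\<close>

definition stable_modulo ::
    "('a \<times> 'b) set \<Rightarrow> ('a \<Rightarrow> 'b \<Rightarrow> 'b \<Rightarrow> bool) \<Rightarrow> ('b \<Rightarrow> 'a \<Rightarrow> 'a \<Rightarrow> bool) \<Rightarrow>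
     'b set \<Rightarrow> ('a \<times> 'b) set \<Rightarrow> bool" where
  "stable_modulo E P R Q M \<longleftrightarrow> rel_matching E M \<and>
     (\<forall>a b. blocks E P R M a b \<longrightarrow> (\<exists>b'\<in>Q. (a, b') \<in> M))"

text \<open>For a matching, not preferring \<open>b\<close> to one's situation means having a
  partner \<open>b'\<close> with \<open>\<not> P a b b'\<close>; this avoids optional partners and
  makes every unmatched agent willing.\<close>

definition no_envy ::
    "('a \<times> 'b) set \<Rightarrow> ('a \<Rightarrow> 'b \<Rightarrow> 'b \<Rightarrow> bool) \<Rightarrow> ('b \<Rightarrow> 'a \<Rightarrow> 'a \<Rightarrow> bool) \<Rightarrow>
     ('a \<times> 'b) set \<Rightarrow> bool" where
  "no_envy E P R M \<longleftrightarrow> rel_matching E M \<and>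
     (\<forall>a a' b. (a', b) \<in> M \<longrightarrow> (a, b) \<in> E \<longrightarrow> R b a a' \<longrightarrow> (\<exists>b'. (a, b') \<in> M \<and> \<not> P a b b'))"

lemma stable_modulo_matching: "stable_modulo E P R Q M \<Longrightarrow> rel_matching E M"
  by (simp add: stable_modulo_def)

lemma stable_modulo_mono: "stable_modulo E P R {} M \<Longrightarrow> stable_modulo E P R Q M"
  unfolding stable_modulo_def by blast

lemma no_envy_matching: "no_envy E P R M \<Longrightarrow> rel_matching E M"
  by (simp add: no_envy_def)

lemma rel_matching_restrict: "rel_matching E M \<Longrightarrow> M \<subseteq> E' \<Longrightarrow> rel_matching E' M"
  by (simp add: rel_matching_def)

lemma stable_modulo_restrict:
  "stable_modulo E P R Q M \<Longrightarrow> E' \<subseteq> E \<Longrightarrow> M \<subseteq> E' \<Longrightarrow> stable_modulo E' P R Q M"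
  unfolding stable_modulo_def blocks_def using rel_matching_restrict[of E M E'] by blast

lemma finite_has_max_measure:
  fixes f :: "'c \<Rightarrow> nat"
  assumes "finite S" "S \<noteq> {}"
  shows "\<exists>x\<in>S. \<forall>y\<in>S. f y \<le> f x"
proof -
  have "Max (f ` S) \<in> f ` S"
    using assms by (intro Max_in) auto
  then obtain x where "x \<in> S" "f x = Max (f ` S)"
    by auto
  with assms show ?thesis
    by (metis Max_ge finite_imageI imageI)
qed

text \<open>The order axioms are guarded by edges because nothing is known about a preference list
  at an index outside the instance.\<close>

locale preference_graph =
  fixes E :: "('a \<times> 'b) set" and P :: "'a \<Rightarrow> 'b \<Rightarrow> 'b \<Rightarrow> bool" and R :: "'b \<Rightarrow> 'a \<Rightarrow> 'a \<Rightarrow> bool"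
  assumes finite_E: "finite E"
    and P_irrefl: "(a, b) \<in> E \<Longrightarrow> \<not> P a b b"
    and P_trans: "(a, b) \<in> E \<Longrightarrow> P a b c \<Longrightarrow> P a c d \<Longrightarrow> P a b d"
    and P_total: "(a, b) \<in> E \<Longrightarrow> (a, c) \<in> E \<Longrightarrow> b \<noteq> c \<Longrightarrow> P a b c \<or> P a c b"
    and R_irrefl: "(a, b) \<in> E \<Longrightarrow> \<not> R b a a"
    and R_trans: "(a, b) \<in> E \<Longrightarrow> R b a a' \<Longrightarrow> R b a' a'' \<Longrightarrow> R b a a''"
    and R_total: "(a, b) \<in> E \<Longrightarrow> (a', b) \<in> E \<Longrightarrow> a \<noteq> a' \<Longrightarrow> R b a a' \<or> R b a' a"
begin

lemma finite_nbrs: "finite {b. (a, b) \<in> E}" "finite {a. (a, b) \<in> E}"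
proof -
  have "{b. (a, b) \<in> E} \<subseteq> snd ` E" "{a. (a, b) \<in> E} \<subseteq> fst ` E"
    by force+
  with finite_E show "finite {b. (a, b) \<in> E}" "finite {a. (a, b) \<in> E}"
    by (auto intro: finite_subset)
qed

lemma finite_matching: "rel_matching E M \<Longrightarrow> finite M"
  using finite_E finite_subset rel_matching_subset by blast

text \<open>Take the agent with the most neighbours of \<open>b\<close> ranked below it: by
  transitivity and irreflexivity, an agent ranked above another has strictly more of them.\<close>

lemma most_preferred_agent:
  assumes "S \<subseteq> {a. (a, b) \<in> E}" "S \<noteq> {}"
  shows "\<exists>a\<in>S. \<forall>a'\<in>S. \<not> R b a' a"
proof -
  let ?f = "\<lambda>a. card {c. (c, b) \<in> E \<and> R b a c}"
  have "finite S"
    using assms finite_nbrs finite_subset by blast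
  from finite_has_max_measure[OF this assms(2), of ?f]
  obtain a where a: "a \<in> S" "\<forall>a'\<in>S. ?f a' \<le> ?f a"
    by blast
  have "\<not> R b a' a" if "a' \<in> S" for a'
  proof
    assume R: "R b a' a"
    have "{c. (c, b) \<in> E \<and> R b a c} \<subset> {c. (c, b) \<in> E \<and> R b a' c}"
    proof
      show "{c. (c, b) \<in> E \<and> R b a c} \<subseteq> {c. (c, b) \<in> E \<and> R b a' c}"
        using R R_trans[of a' b a] that assms(1) by blast
      have "a \<in> {c. (c, b) \<in> E \<and> R b a' c}" "a \<notin> {c. (c, b) \<in> E \<and> R b a c}"
        using a(1) R R_irrefl assms(1) by auto
      then show "{c. (c, b) \<in> E \<and> R b a c} \<noteq> {c. (c, b) \<in> E \<and> R b a' c}"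
        by blast
    qed
    then have "?f a < ?f a'"
      by (intro psubset_card_mono finite_subset[OF _ finite_nbrs(2)[of b]]) auto
    with a(2) that show False by (simp add: leD)
  qed
  with a(1) show ?thesis by blast
qed

text \<open>
  An envy-free matching that maximises the agents' total satisfaction is stable: a resource of a
  blocking pair is unmatched, and giving it its best blocking agent keeps the matching envy-free.
\<close>

lemma ex_stable: "\<exists>M. stable_modulo E P R {} M"
proof -
  \<comment> \<open>The successor makes even the worst partner count more than none, so an unmatched
    agent that receives a partner raises the sum.\<close>
  let ?w = "\<lambda>(a, b). Suc (card {c. (a, c) \<in> E \<and> P a b c})"
  let ?S = "{M. no_envy E P R M}"
  have "?S \<subseteq> Pow E"
    by (auto simp: no_envy_def rel_matching_def)
  then have fin: "finite ?S"
    using finite_E finite_subset by blast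
  have "{} \<in> ?S"
    by (simp add: no_envy_def rel_matching_def)
  then have "?S \<noteq> {}" by blast
  from finite_has_max_measure[OF fin this, of "sum ?w"]
  obtain M where M: "no_envy E P R M"
    and max: "\<forall>M'\<in>?S. sum ?w M' \<le> sum ?w M"
    by blast
  note mat = no_envy_matching[OF M]
  have "\<not> blocks E P R M a0 b" for a0 b
  proof
    assume blk0: "blocks E P R M a0 b"
    have "{a. blocks E P R M a b} \<subseteq> {a. (a, b) \<in> E}"
      by (auto simp: blocks_def)
    from most_preferred_agent[OF this] blk0 obtain a where blk: "blocks E P R M a b"
      and best: "\<forall>a'. blocks E P R M a' b \<longrightarrow> \<not> R b a' a"
      by blast
    have ab: "(a, b) \<in> E" "(a, b) \<notin> M" and Pb: "\<And>b'. (a, b') \<in> M \<Longrightarrow> P a b b'"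
      and Rb: "\<And>a'. (a', b) \<in> M \<Longrightarrow> R b a a'"
      using blk by (auto simp: blocks_def)
    \<comment> \<open>Otherwise \<open>a\<close> would envy the partner of \<open>b\<close>.\<close>
    have free: "(a', b) \<notin> M" for a'
      using M Rb[of a'] ab Pb unfolding no_envy_def by blast
    define M1 where "M1 = M - {(a, b') |b'. True}"
    define M' where "M' = insert (a, b) M1"
    have "rel_matching E M'"
      using mat ab free unfolding rel_matching_def M'_def M1_def by blast
    moreover have "\<exists>d. (c, d) \<in> M' \<and> \<not> P c b' d"
      if h: "(c', b') \<in> M'" "(c, b') \<in> E" "R b' c c'" for c c' b'
    proof (cases "(c', b') = (a, b)")
      case True
      \<comment> \<open>By the choice of \<open>a\<close>, an agent \<open>c\<close> that
        \<open>b\<close> ranks above \<open>a\<close> does not block with \<open>b\<close>. As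
        \<open>b\<close> is free, the reason must be a partner of \<open>c\<close> that is not worse
        for it than \<open>b\<close>, and \<open>c\<close> keeps this partner in
        \<open>M'\<close>.\<close>
      then have "\<not> blocks E P R M c b" "c \<noteq> a"
        using best h R_irrefl ab by auto
      then show ?thesis
        using True h free unfolding blocks_def M'_def M1_def by blast
    next
      case False
      then have m: "(c', b') \<in> M" using h by (auto simp: M'_def M1_def)
      then obtain d where d: "(c, d) \<in> M" "\<not> P c b' d"
        using M h unfolding no_envy_def by blast
      show ?thesis
      proof (cases "c = a")
        case True
        have "\<not> P a b' b"
        proof
          assume "P a b' b"
          then have "P a b' d"
            using P_trans[of a b' b d] Pb[of d] d h True by auto
          with d True show False by simp
        qed
        then show ?thesis using True by (auto simp: M'_def)
      next
        case False
        then show ?thesis using d by (auto simp: M'_def M1_def)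
      qed
    qed
    ultimately have "no_envy E P R M'"
      unfolding no_envy_def by blast
    with max have le: "sum ?w M' \<le> sum ?w M" by blast
    have finM: "finite M" "finite M1"
      using finite_matching[OF mat] by (auto simp: M1_def)
    have M'w: "sum ?w M' = ?w (a, b) + sum ?w M1"
      unfolding M'_def using finM by (intro sum.insert) (auto simp: M1_def)
    show False
    proof (cases "\<exists>b'. (a, b') \<in> M")
      case False
      then have "M1 = M" by (auto simp: M1_def)
      with M'w le show False by auto
    next
      case True
      then obtain b' where b': "(a, b') \<in> M" ..
      then have "M = insert (a, b') M1"
        using rel_matching_fst[OF mat b'] unfolding M1_def by blast
      then have "sum ?w M = sum ?w (insert (a, b') M1)" by simp
      also have "\<dots> = ?w (a, b') + sum ?w M1"
        using finM by (intro sum.insert) (auto simp: M1_def)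
      finally have Mw: "sum ?w M = ?w (a, b') + sum ?w M1" .
      have "b' \<in> {c. (a, c) \<in> E \<and> P a b c}" "b' \<notin> {c. (a, c) \<in> E \<and> P a b' c}"
        using b' Pb P_irrefl rel_matching_subset[OF mat] by auto
      moreover have "{c. (a, c) \<in> E \<and> P a b' c} \<subseteq> {c. (a, c) \<in> E \<and> P a b c}"
        using P_trans[OF ab(1) Pb[OF b']] by blast
      ultimately have "{c. (a, c) \<in> E \<and> P a b' c} \<subset> {c. (a, c) \<in> E \<and> P a b c}"
        by blast
      then have "?w (a, b') < ?w (a, b)"
        by (simp, intro psubset_card_mono finite_subset[OF _ finite_nbrs(1)[of a]]) auto
      with M'w Mw le show False by simp
    qed
  qed
  with mat show ?thesis
    unfolding stable_modulo_def by blast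
qed

text \<open>
  Rural hospitals theorem: \<open>M\<close> maps the agents preferring \<open>M\<close> injectively into the resources
  preferring \<open>N\<close>, and \<open>N\<close> maps these injectively back; hence both maps are bijections, and every
  agent preferring \<open>M\<close> is matched in \<open>N\<close>.
\<close>

lemma stable_matched_agents_subset:
  assumes M: "stable_modulo E P R {} M" and N: "stable_modulo E P R {} N"
  shows "fst ` M \<subseteq> fst ` N"
proof -
  note mM = stable_modulo_matching[OF M] and mN = stable_modulo_matching[OF N]
  have EM: "M \<subseteq> E" and EN: "N \<subseteq> E"
    using mM mN rel_matching_subset by blast+
  \<comment> \<open>Vertices unmatched in the other matching satisfy the universal conditions
    vacuously; this is how agents matched by \<open>M\<close> alone enter the bijection.\<close>
  define M' where "M' = {(a, b) \<in> M. \<forall>b'. (a, b') \<in> N \<longrightarrow> P a b b'}"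
  define N' where "N' = {(a, b) \<in> N. \<forall>a'. (a', b) \<in> M \<longrightarrow> R b a a'}"
  have fin: "finite M'" "finite N'"
    using finite_matching[OF mM] finite_matching[OF mN] by (auto simp: M'_def N'_def intro: finite_subset)
  have 1: "snd ` M' \<subseteq> snd ` N'"
  proof
    fix b assume "b \<in> snd ` M'"
    then obtain a where ab: "(a, b) \<in> M" "\<And>b'. (a, b') \<in> N \<Longrightarrow> P a b b'"
      by (auto simp: M'_def)
    then have nN: "(a, b) \<notin> N" and E: "(a, b) \<in> E"
      using P_irrefl EM by blast+
    from N have "\<not> blocks E P R N a b"
      unfolding stable_modulo_def by blast
    with ab nN E obtain a' where a': "(a', b) \<in> N" "\<not> R b a a'"
      unfolding blocks_def by blast
    then have "R b a' a"
      using R_total[of a b a'] nN E EN by blast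
    with a' ab have "(a', b) \<in> N'"
      using rel_matching_snd[OF mM] unfolding N'_def by blast
    then show "b \<in> snd ` N'" by force
  qed
  have 2: "fst ` N' \<subseteq> fst ` M'"
  proof
    fix a assume "a \<in> fst ` N'"
    then obtain b where ab: "(a, b) \<in> N" "\<And>a'. (a', b) \<in> M \<Longrightarrow> R b a a'"
      by (auto simp: N'_def)
    then have nM: "(a, b) \<notin> M" and E: "(a, b) \<in> E"
      using R_irrefl EN by blast+
    from M have "\<not> blocks E P R M a b"
      unfolding stable_modulo_def by blast
    with ab nM E obtain b' where b': "(a, b') \<in> M" "\<not> P a b b'"
      unfolding blocks_def by blast
    then have "P a b' b"
      using P_total[of a b b'] nM E EM by blast
    with b' ab have "(a, b') \<in> M'"
      using rel_matching_fst[OF mN] unfolding M'_def by blast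
    then show "a \<in> fst ` M'" by force
  qed
  have inj: "inj_on fst M'" "inj_on snd M'" "inj_on fst N'" "inj_on snd N'"
    using inj_on_fst_matching[OF mM] inj_on_fst_matching[OF mN]
      inj_on_snd_matching[OF mM] inj_on_snd_matching[OF mN]
    by (auto simp: M'_def N'_def intro: inj_on_subset)
  have "card (fst ` M') = card M'"
    using inj by (simp add: card_image)
  also have "\<dots> = card (snd ` M')"
    using inj by (simp add: card_image)
  also have "\<dots> \<le> card (snd ` N')"
    using 1 fin by (intro card_mono) auto
  also have "\<dots> = card (fst ` N')"
    using inj by (simp add: card_image)
  finally have eq: "fst ` N' = fst ` M'"
    using 2 fin by (intro card_seteq) auto
  show ?thesis
  proof
    fix a assume "a \<in> fst ` M"
    then obtain b where ab: "(a, b) \<in> M" by auto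
    show "a \<in> fst ` N"
    proof (rule ccontr)
      assume no: "a \<notin> fst ` N"
      then have "(a, b) \<in> M'"
        using ab by (force simp: M'_def)
      then have "a \<in> fst ` N'"
        using eq by force
      with no show False by (auto simp: N'_def)
    qed
  qed
qed

lemma stable_card_eq:
  assumes M: "stable_modulo E P R {} M" and N: "stable_modulo E P R {} N"
  shows "card M = card N"
proof -
  have "fst ` M = fst ` N"
    using stable_matched_agents_subset[OF M N] stable_matched_agents_subset[OF N M] by simp
  then show ?thesis
    using inj_on_fst_matching[OF stable_modulo_matching[OF M]]
      inj_on_fst_matching[OF stable_modulo_matching[OF N]] by (metis card_image)
qed

text \<open>A stable matching is maximal, so every edge of \<open>N\<close> contains one of the
  \<open>2 * card M\<close> endpoints of \<open>M\<close>, and each endpoint lies on at most one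
  edge of \<open>N\<close>.\<close>

lemma matching_card_le_double_stable:
  assumes M: "stable_modulo E P R {} M" and N: "rel_matching E N"
  shows "card N \<le> 2 * card M"
proof -
  note mM = stable_modulo_matching[OF M]
  have finM: "finite M" and finN: "finite N"
    using finite_matching mM N by auto
  let ?A = "{e \<in> N. fst e \<in> fst ` M}" and ?B = "{e \<in> N. snd e \<in> snd ` M}"
  have "N \<subseteq> ?A \<union> ?B"
  proof
    fix e assume e: "e \<in> N"
    obtain a b where ab: "e = (a, b)" by (cases e)
    have "\<not> blocks E P R M a b" "(a, b) \<in> E"
      using M e ab rel_matching_subset[OF N] by (auto simp: stable_modulo_def)
    then show "e \<in> ?A \<union> ?B"
      using e ab unfolding blocks_def by force
  qed
  then have "card N \<le> card (?A \<union> ?B)"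
    using finN by (intro card_mono) auto
  also have "\<dots> \<le> card ?A + card ?B"
    by (rule card_Un_le)
  also have "card ?A \<le> card (fst ` M)"
    using finM inj_on_subset[OF inj_on_fst_matching[OF N]]
    by (intro card_inj_on_le[of fst]) auto
  also have "card (fst ` M) \<le> card M"
    using finM by (rule card_image_le)
  also have "card ?B \<le> card (snd ` M)"
    using finM inj_on_subset[OF inj_on_snd_matching[OF N]]
    by (intro card_inj_on_le[of snd]) auto
  also have "card (snd ` M) \<le> card M"
    using finM by (rule card_image_le)
  finally show ?thesis by simp
qed

end

section \<open>Restriction to kept vertices\<close>

text \<open>Pigeonhole: the partners of the members of \<open>S\<close> are distinct and all lie in
  \<open>X\<close>.\<close>

lemma ex_unmatched_fst:
  assumes M: "rel_matching E M" and "finite X" "card X < card S"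
    and nb: "\<And>a b. a \<in> S \<Longrightarrow> (a, b) \<in> E \<Longrightarrow> b \<in> X"
  shows "\<exists>a\<in>S. \<forall>b. (a, b) \<notin> M"
proof (rule ccontr)
  assume neg: "\<not> ?thesis"
  let ?N = "{e \<in> M. fst e \<in> S}"
  have "S \<subseteq> fst ` ?N"
    using neg by force
  moreover have N: "inj_on snd ?N" "snd ` ?N \<subseteq> X"
    using inj_on_subset[OF inj_on_snd_matching[OF M]] nb rel_matching_subset[OF M] by auto
  then have "finite ?N"
    using \<open>finite X\<close> by (meson finite_imageD finite_subset)
  ultimately have "card S \<le> card ?N"
    using card_mono[of "fst ` ?N" S] card_image_le[of ?N fst] by simp
  also have "\<dots> \<le> card X"
    using N \<open>finite X\<close> by (rule card_inj_on_le)
  finally show False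
    using assms by simp
qed

lemma ex_unmatched_snd:
  assumes M: "rel_matching E M" and "finite X" "card X < card S"
    and nb: "\<And>a b. b \<in> S \<Longrightarrow> (a, b) \<in> E \<Longrightarrow> a \<in> X"
  shows "\<exists>b\<in>S. \<forall>a. (a, b) \<notin> M"
proof -
  have "rel_matching (E\<inverse>) (M\<inverse>)"
    using M unfolding rel_matching_def by blast
  from ex_unmatched_fst[OF this assms(2,3)] nb show ?thesis by blast
qed

text \<open>\<open>XA\<close> and \<open>XB\<close> form the cover, \<open>KA\<close> and
  \<open>KB\<close> are the kept vertices, \<open>Q\<close> the LQ resources. The candidates counted
  in the last assumption lie outside the cover, so that all their neighbours are in
  \<open>XB\<close>. Deleted resources are left to the two extensions, because the two problems
  treat them differently.\<close>

locale reduced_graph = preference_graph +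
  fixes XA KA :: "'a set" and XB KB Q :: "'b set" and C :: nat
  assumes cover: "(a, b) \<in> E \<Longrightarrow> a \<in> XA \<or> b \<in> XB"
    and finite_X: "finite XA" "finite XB"
    and X_kept: "XA \<subseteq> KA" "XB \<subseteq> KB"
    and Q_subset: "Q \<subseteq> XB"
    and less_C: "card XA < C" "card XB < C"
    and agents_kept: "b \<in> XB \<Longrightarrow> (a, b) \<in> E \<Longrightarrow> a \<notin> KA \<Longrightarrow>
      C \<le> card {a' \<in> KA - XA. (a', b) \<in> E \<and> R b a' a}"
begin

text \<open>A deleted agent is outside the cover, which forces \<open>b\<close> into
  \<open>XB\<close>; of the \<open>C\<close> candidates at most \<open>card XB < C\<close> can be
  matched. \<open>M\<close> may be any matching of the whole graph, so the lemma serves restriction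
  and extension alike.\<close>

lemma better_unmatched_agent:
  assumes "rel_matching E M" "(a, b) \<in> E" "a \<notin> KA"
  obtains a' where "a' \<in> KA" "(a', b) \<in> E" "R b a' a" "b \<in> KB" "\<And>b'. (a', b') \<notin> M"
proof -
  have b: "b \<in> XB"
    using cover assms X_kept by blast
  with agents_kept[OF b assms(2,3)] less_C
  have "card XB < card {a' \<in> KA - XA. (a', b) \<in> E \<and> R b a' a}" by linarith
  from ex_unmatched_fst[OF assms(1) finite_X(2) this] cover b X_kept that show thesis
    by blast
qed

lemma envy_free_agents_kept:
  assumes "no_envy E P R M" "(a, b) \<in> M"
  shows "a \<in> KA"
proof (rule ccontr)
  assume a: "a \<notin> KA"
  note M = no_envy_matching[OF assms(1)]
  have "(a, b) \<in> E"
    using M assms(2) rel_matching_subset by blast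
  from better_unmatched_agent[OF M this a] obtain a' where
    "(a', b) \<in> E" "R b a' a" "\<And>b'. (a', b') \<notin> M" by metis
  with assms show False
    unfolding no_envy_def by blast
qed

text \<open>If a deleted agent envied somebody at \<open>b\<close>, the unmatched kept agent that
  \<open>b\<close> ranks above it would envy the same agent inside the restricted graph.\<close>

lemma no_envy_extend:
  assumes M: "no_envy (E \<inter> KA \<times> KB) P R M"
  shows "no_envy E P R M"
proof -
  have mat: "rel_matching E M"
    using no_envy_matching[OF M] by (auto simp: rel_matching_def)
  have "\<exists>b'. (a, b') \<in> M \<and> \<not> P a b b'" if h: "(a', b) \<in> M" "(a, b) \<in> E" "R b a a'" for a a' b
  proof (cases "a \<in> KA")
    case True
    then show ?thesis
      using M h no_envy_matching[OF M] rel_matching_subset unfolding no_envy_def by blast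
  next
    case False
    from better_unmatched_agent[OF mat h(2) this] obtain a'' where
      a'': "a'' \<in> KA" "(a'', b) \<in> E" "R b a'' a" "b \<in> KB" "\<And>b'. (a'', b') \<notin> M" by metis
    then have "R b a'' a'"
      using R_trans[of a'' b a a'] h by blast
    then have False
      using M h a'' unfolding no_envy_def by blast
    then show ?thesis ..
  qed
  with mat show ?thesis
    unfolding no_envy_def by blast
qed

end

locale reduced_graph_rsm = reduced_graph +
  assumes resources_kept: "a \<in> XA \<Longrightarrow> (a, b) \<in> E \<Longrightarrow> b \<notin> KB \<Longrightarrow>
      C \<le> card {b' \<in> KB - XB. (a, b') \<in> E \<and> P a b' b}"
begin

lemma better_unmatched_resource:
  assumes "rel_matching E M" "(a, b) \<in> E" "b \<notin> KB"
  obtains b' where "b' \<in> KB" "(a, b') \<in> E" "P a b' b" "a \<in> KA" "\<And>a'. (a', b') \<notin> M"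
proof -
  have a: "a \<in> XA"
    using cover assms X_kept by blast
  with resources_kept[OF a assms(2,3)] less_C
  have "card XA < card {b' \<in> KB - XB. (a, b') \<in> E \<and> P a b' b}" by linarith
  from ex_unmatched_snd[OF assms(1) finite_X(1) this] cover a X_kept that show thesis
    by blast
qed

text \<open>A deleted agent's partner blocks with an unmatched agent, which nothing can excuse. If
  the partner \<open>b\<close> of \<open>a\<close> is deleted, then \<open>a\<close> blocks with a
  better unmatched resource and would have to be matched to a member of \<open>Q\<close>; but its
  partner is \<open>b\<close>, and all of \<open>Q\<close> is kept.\<close>

lemma stable_modulo_kept:
  assumes "stable_modulo E P R Q M"
  shows "M \<subseteq> KA \<times> KB"
proof
  note M = stable_modulo_matching[OF assms]
  fix e assume e: "e \<in> M"
  obtain a b where ab: "e = (a, b)" by (cases e)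
  then have E: "(a, b) \<in> E"
    using e M rel_matching_subset by blast
  have "a \<in> KA"
  proof (rule ccontr)
    assume "a \<notin> KA"
    from better_unmatched_agent[OF M E this] obtain a' where
      a': "(a', b) \<in> E" "R b a' a" "\<And>b'. (a', b') \<notin> M" by metis
    then have "blocks E P R M a' b"
      using rel_matching_snd[OF M] e ab unfolding blocks_def by blast
    with assms a'(3) show False
      unfolding stable_modulo_def by blast
  qed
  moreover have "b \<in> KB"
  proof (rule ccontr)
    assume b: "b \<notin> KB"
    from better_unmatched_resource[OF M E this] obtain b' where
      b': "(a, b') \<in> E" "P a b' b" "\<And>a'. (a', b') \<notin> M" by metis
    then have "blocks E P R M a b'"
      using rel_matching_fst[OF M] e ab unfolding blocks_def by blast
    with assms obtain b'' where "b'' \<in> Q" "(a, b'') \<in> M"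
      unfolding stable_modulo_def by blast
    with b show False
      using rel_matching_fst[OF M] e ab Q_subset X_kept by blast
  qed
  ultimately show "e \<in> KA \<times> KB" using ab by simp
qed

text \<open>Replacing a deleted agent of a blocking pair yields a blocking pair with an unmatched
  agent, a contradiction. Replacing a deleted resource leaves the agent unchanged, so the LQ partner
  that excuses the new pair also excuses the old one.\<close>

lemma stable_modulo_extend:
  assumes S: "stable_modulo (E \<inter> KA \<times> KB) P R Q M"
  shows "stable_modulo E P R Q M"
proof -
  let ?E = "E \<inter> KA \<times> KB"
  have M: "rel_matching E M"
    using stable_modulo_matching[OF S] by (auto simp: rel_matching_def)
  have "\<exists>b'\<in>Q. (a, b') \<in> M" if B: "blocks E P R M a b" for a b
  proof -
    have E: "(a, b) \<in> E" and P: "\<And>b'. (a, b') \<in> M \<Longrightarrow> P a b b'"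
      and R: "\<And>a'. (a', b) \<in> M \<Longrightarrow> R b a a'"
      using B by (auto simp: blocks_def)
    consider "a \<notin> KA" | "b \<notin> KB" | "(a, b) \<in> KA \<times> KB" by blast
    then show ?thesis
    proof cases
      case 1
      from better_unmatched_agent[OF M E this] obtain a' where
        a': "a' \<in> KA" "(a', b) \<in> E" "R b a' a" "b \<in> KB" "\<And>b'. (a', b') \<notin> M" by metis
      then have "blocks ?E P R M a' b"
        using R R_trans[of a' b a] unfolding blocks_def by blast
      with S a'(5) show ?thesis
        unfolding stable_modulo_def by blast
    next
      case 2
      from better_unmatched_resource[OF M E this] obtain b' where
        b': "b' \<in> KB" "(a, b') \<in> E" "P a b' b" "a \<in> KA" "\<And>a'. (a', b') \<notin> M" by metis
      then have "blocks ?E P R M a b'"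
        using P P_trans[of a b' b] unfolding blocks_def by blast
      with S show ?thesis
        unfolding stable_modulo_def by blast
    next
      case 3
      then have "blocks ?E P R M a b"
        using B unfolding blocks_def by blast
      with S show ?thesis
        unfolding stable_modulo_def by blast
    qed
  qed
  with M show ?thesis
    unfolding stable_modulo_def by blast
qed

lemma stable_modulo_reduced_iff:
  "stable_modulo (E \<inter> KA \<times> KB) P R Q M \<longleftrightarrow> stable_modulo E P R Q M"
  using stable_modulo_extend stable_modulo_kept[of M]
    stable_modulo_restrict[of E P R Q M "E \<inter> KA \<times> KB"]
    rel_matching_subset[OF stable_modulo_matching[of E P R Q M]] by blast

text \<open>Needed for the promise. The locale fixes \<open>Q\<close>, so confinement to the kept
  vertices is borrowed from relaxed stability, which stability implies.\<close>

lemma stable_reduced: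
  assumes "stable_modulo E P R {} M"
  shows "stable_modulo (E \<inter> KA \<times> KB) P R {} M"
  using stable_modulo_restrict[OF assms, of "E \<inter> KA \<times> KB"]
    stable_modulo_kept[OF stable_modulo_mono[OF assms]]
    rel_matching_subset[OF stable_modulo_matching[OF assms]] by blast

end

text \<open>A single better resource suffices here, in place of \<open>C\<close> of them: having no
  neighbour besides \<open>a\<close>, it can be occupied by no one else.\<close>

locale reduced_graph_efm = reduced_graph +
  assumes private_resources: "a \<in> XA \<Longrightarrow> (a, b) \<in> E \<Longrightarrow> b \<notin> KB \<Longrightarrow>
      (\<forall>a'. (a', b) \<in> E \<longrightarrow> a' = a) \<and>
      (\<exists>b'\<in>KB - XB. (a, b') \<in> E \<and> P a b' b \<and> (\<forall>a'. (a', b') \<in> E \<longrightarrow> a' = a))"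
begin

text \<open>
  An agent matched to a deleted resource moves to a better one that is adjacent to no other agent;
  nobody else can envy it there.
\<close>

lemma no_envy_reduce:
  assumes M: "no_envy E P R M" and QM: "Q \<subseteq> snd ` M"
  shows "\<exists>M'. no_envy (E \<inter> KA \<times> KB) P R M' \<and> Q \<subseteq> snd ` M' \<and> card M' = card M"
proof -
  let ?E = "E \<inter> KA \<times> KB"
  note mat = no_envy_matching[OF M]
  have ME: "M \<subseteq> E" using mat by (rule rel_matching_subset)
  have "\<exists>c. b \<in> KB \<and> c = b \<or> b \<notin> KB \<and> c \<in> KB \<and> (a, c) \<in> E \<and> P a c b \<and> (\<forall>a'. (a', c) \<in> E \<longrightarrow> a' = a)"
    if "(a, b) \<in> M" for a b
    using private_resources[of a b] cover[of a b] X_kept that ME by blast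
  then obtain g where g: "\<And>a b. (a, b) \<in> M \<Longrightarrow> b \<in> KB \<and> g a b = b \<or>
      b \<notin> KB \<and> g a b \<in> KB \<and> (a, g a b) \<in> E \<and> P a (g a b) b \<and> (\<forall>a'. (a', g a b) \<in> E \<longrightarrow> a' = a)"
    by metis
  define M' where "M' = {(a, g a b) |a b. (a, b) \<in> M}"
  have M'E: "M' \<subseteq> ?E"
  proof
    fix e assume "e \<in> M'"
    then obtain a b where ab: "(a, b) \<in> M" "e = (a, g a b)"
      by (auto simp: M'_def)
    then show "e \<in> ?E"
      using g[OF ab(1)] ME envy_free_agents_kept[OF M ab(1)] by auto
  qed
  \<comment> \<open>A common target of two agents has two neighbours, so neither agent has
    moved.\<close>
  have snd: "a = a'" if "(a, b) \<in> M" "(a', b') \<in> M" "g a b = g a' b'" for a a' b b'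
  proof (rule ccontr)
    assume ne: "a \<noteq> a'"
    have "(a, g a b) \<in> E" "(a', g a' b') \<in> E"
      using M'E that unfolding M'_def by blast+
    then have "b \<in> KB" "b' \<in> KB"
      using g[OF that(1)] g[OF that(2)] that(3) ne by metis+
    then have "b = b'"
      using g[OF that(1)] g[OF that(2)] that(3) by metis
    with ne show False
      using rel_matching_snd[OF mat] that by blast
  qed
  have "rel_matching ?E M'"
    unfolding rel_matching_def
  proof (intro conjI allI impI)
    show "b = b'" if "(a, b) \<in> M' \<and> (a, b') \<in> M'" for a b b'
      using that rel_matching_fst[OF mat] unfolding M'_def by blast
    show "a = a'" if "(a, b) \<in> M' \<and> (a', b) \<in> M'" for a a' b
      using that snd unfolding M'_def by blast
  qed (rule M'E)
  moreover have "\<exists>d. (a, d) \<in> M' \<and> \<not> P a b d"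
    if h: "(a', b) \<in> M'" "(a, b) \<in> ?E" "R b a a'" for a a' b
  proof -
    obtain b0 where b0: "(a', b0) \<in> M" "b = g a' b0"
      using h by (auto simp: M'_def)
    \<comment> \<open>Only an agent that stayed in place can be envied, since the new resource of a
      moved one has no other neighbour.\<close>
    have "b0 = b"
    proof (rule ccontr)
      assume "b0 \<noteq> b"
      then have "a = a'"
        using g[OF b0(1)] b0(2) h(2) by auto
      then show False
        using h R_irrefl by auto
    qed
    then have "(a', b) \<in> M" "(a, b) \<in> E"
      using b0 h by auto
    with M h(3) obtain d where d: "(a, d) \<in> M" "\<not> P a b d"
      unfolding no_envy_def by meson
    \<comment> \<open>Moving only improves the position of \<open>a\<close>: preferring
      \<open>b\<close> to the new partner would imply preferring it to the old one.\<close>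
    have "\<not> P a b (g a d)"
      using g[OF d(1)] d P_trans[of a b "g a d" d] h by auto
    with d show ?thesis
      unfolding M'_def by blast
  qed
  ultimately have "no_envy ?E P R M'"
    unfolding no_envy_def by blast
  moreover have "Q \<subseteq> snd ` M'"
  proof
    fix b assume b: "b \<in> Q"
    with QM obtain a where ab: "(a, b) \<in> M" by auto
    have "b \<in> KB" using b Q_subset X_kept by blast
    with g[OF ab] have "g a b = b" by blast
    moreover have "(a, g a b) \<in> M'"
      unfolding M'_def using ab by blast
    ultimately have "(a, b) \<in> M'" by simp
    then show "b \<in> snd ` M'" by force
  qed
  moreover have "card M' = card M"
  proof -
    have "M' = (\<lambda>(a, b). (a, g a b)) ` M"
      by (auto simp: M'_def)
    moreover have "inj_on (\<lambda>(a, b). (a, g a b)) M"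
      using rel_matching_fst[OF mat] by (auto simp: inj_on_def)
    ultimately show ?thesis by (simp add: card_image)
  qed
  ultimately show ?thesis by blast
qed

end

section \<open>Transport of matchings along renumberings\<close>

lemma rel_matching_map:
  assumes "inj_on f A" "inj_on g B" "E \<subseteq> A \<times> B" "M \<subseteq> A \<times> B"
  shows "rel_matching (map_prod f g ` E) (map_prod f g ` M) \<longleftrightarrow> rel_matching E M"
proof -
  have inj: "inj_on (map_prod f g) (A \<times> B)"
    using assms(1,2) by (rule map_prod_inj_on)
  have "map_prod f g ` M \<subseteq> map_prod f g ` E \<longleftrightarrow> M \<subseteq> E"
  proof (intro iffI subsetI)
    fix e assume "map_prod f g ` M \<subseteq> map_prod f g ` E" "e \<in> M"
    then have "map_prod f g e \<in> map_prod f g ` E" "e \<in> A \<times> B"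
      using assms(4) by blast+
    then show "e \<in> E"
      by (simp only: inj_on_image_mem_iff[OF inj _ assms(3)])
  qed (metis image_mono subsetD)
  moreover have "(\<forall>a b b'. (a, b) \<in> map_prod f g ` M \<and> (a, b') \<in> map_prod f g ` M \<longrightarrow> b = b') \<longleftrightarrow>
      (\<forall>a b b'. (a, b) \<in> M \<and> (a, b') \<in> M \<longrightarrow> b = b')"
    (is "?l \<longleftrightarrow> ?r")
  proof
    assume l: ?l
    show ?r
    proof clarify
      fix a b b' assume h: "(a, b) \<in> M" "(a, b') \<in> M"
      then have "g b = g b'" using l by (metis map_prod_imageI)
      then show "b = b'" using h assms by (auto dest: inj_onD)
    qed
  next
    assume r: ?r
    show ?l
    proof clarsimp
      fix a b a' b' assume h: "(a, b) \<in> M" "(a', b') \<in> M" "f a = f a'"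
      then have "a = a'" using assms by (auto dest: inj_onD)
      then show "g b = g b'" using h r by blast
    qed
  qed
  moreover have "(\<forall>a a' b. (a, b) \<in> map_prod f g ` M \<and> (a', b) \<in> map_prod f g ` M \<longrightarrow> a = a') \<longleftrightarrow>
      (\<forall>a a' b. (a, b) \<in> M \<and> (a', b) \<in> M \<longrightarrow> a = a')"
    (is "?l \<longleftrightarrow> ?r")
  proof
    assume l: ?l
    show ?r
    proof clarify
      fix a a' b assume h: "(a, b) \<in> M" "(a', b) \<in> M"
      then have "f a = f a'" using l by (metis map_prod_imageI)
      then show "a = a'" using h assms by (auto dest: inj_onD)
    qed
  next
    assume r: ?r
    show ?l
    proof clarsimp
      fix a b a' b' assume h: "(a, b) \<in> M" "(a', b') \<in> M" "g b = g b'"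
      then have "b = b'" using assms by (auto dest: inj_onD)
      then show "f a = f a'" using h r by blast
    qed
  qed
  ultimately show ?thesis
    unfolding rel_matching_def by (simp only:)
qed

text \<open>The new preferences need to agree with the old ones on images of \<open>A\<close> and
  \<open>B\<close> only; lists of a subinstance say nothing about deleted vertices.\<close>

locale relabelling =
  fixes f :: "'a \<Rightarrow> 'c" and g :: "'b \<Rightarrow> 'd" and A :: "'a set" and B :: "'b set"
    and E :: "('a \<times> 'b) set" and P P' R R'
  assumes inj_f: "inj_on f A" and inj_g: "inj_on g B" and E_subset: "E \<subseteq> A \<times> B"
    and P_eq: "a \<in> A \<Longrightarrow> b \<in> B \<Longrightarrow> b' \<in> B \<Longrightarrow> P' (f a) (g b) (g b') \<longleftrightarrow> P a b b'"
    and R_eq: "b \<in> B \<Longrightarrow> a \<in> A \<Longrightarrow> a' \<in> A \<Longrightarrow> R' (g b) (f a) (f a') \<longleftrightarrow> R b a a'"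
begin

lemma mem_image_iff: "S \<subseteq> A \<times> B \<Longrightarrow> a \<in> A \<Longrightarrow> b \<in> B \<Longrightarrow>
    (f a, g b) \<in> map_prod f g ` S \<longleftrightarrow> (a, b) \<in> S"
  using inj_f inj_g by (force dest: inj_onD)

lemma blocks_map:
  assumes M: "M \<subseteq> A \<times> B" and ab: "a \<in> A" "b \<in> B"
  shows "blocks (map_prod f g ` E) P' R' (map_prod f g ` M) (f a) (g b) \<longleftrightarrow> blocks E P R M a b"
proof -
  have "(\<forall>y. (f a, y) \<in> map_prod f g ` M \<longrightarrow> P' (f a) (g b) y) \<longleftrightarrow> (\<forall>b'. (a, b') \<in> M \<longrightarrow> P a b b')"
    (is "?l \<longleftrightarrow> ?r")
  proof
    show ?r if ?l
      using that M P_eq[OF ab] by (metis map_prod_imageI mem_Sigma_iff subsetD)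
    show ?l if ?r
    proof clarsimp
      fix a' b' assume h: "f a = f a'" "(a', b') \<in> M"
      then have "a = a'" using M ab inj_f by (auto dest: inj_onD)
      then show "P' (f a') (g b) (g b')"
        using h that M ab P_eq by auto
    qed
  qed
  moreover have "(\<forall>x. (x, g b) \<in> map_prod f g ` M \<longrightarrow> R' (g b) (f a) x) \<longleftrightarrow> (\<forall>a'. (a', b) \<in> M \<longrightarrow> R b a a')"
    (is "?l \<longleftrightarrow> ?r")
  proof
    show ?r if ?l
      using that M R_eq[OF ab(2,1)] by (metis map_prod_imageI mem_Sigma_iff subsetD)
    show ?l if ?r
    proof clarsimp
      fix a' b' assume h: "g b = g b'" "(a', b') \<in> M"
      then have "b = b'" using M ab inj_g by (auto dest: inj_onD)
      then show "R' (g b') (f a) (f a')"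
        using h that M ab R_eq by auto
    qed
  qed
  moreover have "(f a, g b) \<in> map_prod f g ` E - map_prod f g ` M \<longleftrightarrow> (a, b) \<in> E - M"
    using mem_image_iff[OF E_subset ab] mem_image_iff[OF M ab] by simp
  ultimately show ?thesis
    unfolding blocks_def by simp
qed

lemma stable_modulo_map:
  assumes M: "M \<subseteq> A \<times> B" and Q: "Q \<subseteq> B"
  shows "stable_modulo (map_prod f g ` E) P' R' (g ` Q) (map_prod f g ` M) \<longleftrightarrow>
    stable_modulo E P R Q M" (is "?l \<longleftrightarrow> ?r")
proof -
  have ex: "(\<exists>y\<in>g ` Q. (f a, y) \<in> map_prod f g ` M) \<longleftrightarrow> (\<exists>b\<in>Q. (a, b) \<in> M)" if "a \<in> A" for a
  proof -
    have "(\<exists>y\<in>g ` Q. (f a, y) \<in> map_prod f g ` M) \<longleftrightarrow> (\<exists>b\<in>Q. (f a, g b) \<in> map_prod f g ` M)"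
      by (rule bex_simps)
    also have "\<dots> \<longleftrightarrow> (\<exists>b\<in>Q. (a, b) \<in> M)"
      using Q by (intro bex_cong refl mem_image_iff[OF M that]) blast
    finally show ?thesis .
  qed
  have dom: "\<exists>a\<in>A. \<exists>b\<in>B. x = f a \<and> y = g b"
    if "blocks (map_prod f g ` E) P' R' (map_prod f g ` M) x y" for x y
    using that E_subset unfolding blocks_def by auto
  have dom': "a \<in> A \<and> b \<in> B" if "blocks E P R M a b" for a b
    using that E_subset unfolding blocks_def by auto
  have "(\<forall>x y. blocks (map_prod f g ` E) P' R' (map_prod f g ` M) x y \<longrightarrow>
      (\<exists>b'\<in>g ` Q. (x, b') \<in> map_prod f g ` M)) \<longleftrightarrow>
    (\<forall>a b. blocks E P R M a b \<longrightarrow> (\<exists>b'\<in>Q. (a, b') \<in> M))" (is "?L \<longleftrightarrow> ?R")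
  proof
    assume L: ?L
    show ?R
    proof (intro allI impI)
      fix a b assume b: "blocks E P R M a b"
      then have "a \<in> A" "b \<in> B" using dom' by auto
      with b L show "\<exists>b'\<in>Q. (a, b') \<in> M"
        using blocks_map[OF M, of a b] ex[of a] by blast
    qed
  next
    assume R: ?R
    show ?L
    proof (intro allI impI)
      fix x y assume b: "blocks (map_prod f g ` E) P' R' (map_prod f g ` M) x y"
      then obtain a b where "a \<in> A" "b \<in> B" "x = f a" "y = g b" using dom by blast
      with b R show "\<exists>b'\<in>g ` Q. (x, b') \<in> map_prod f g ` M"
        using blocks_map[OF M, of a b] ex[of a] by blast
    qed
  qed
  then show ?thesis
    unfolding stable_modulo_def rel_matching_map[OF inj_f inj_g E_subset M] by simp
qed

lemma no_envy_map:
  assumes M: "M \<subseteq> A \<times> B"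
  shows "no_envy (map_prod f g ` E) P' R' (map_prod f g ` M) \<longleftrightarrow> no_envy E P R M"
proof -
  have ex: "(\<exists>z. (f a, z) \<in> map_prod f g ` M \<and> \<not> P' (f a) (g b) z) \<longleftrightarrow>
      (\<exists>b'. (a, b') \<in> M \<and> \<not> P a b b')" if "a \<in> A" "b \<in> B" for a b
  proof
    assume "\<exists>z. (f a, z) \<in> map_prod f g ` M \<and> \<not> P' (f a) (g b) z"
    then obtain a' b' where h: "(a', b') \<in> M" "f a = f a'" "\<not> P' (f a) (g b) (g b')" by auto
    then have "a = a'" using M that inj_f by (auto dest: inj_onD)
    then show "\<exists>b'. (a, b') \<in> M \<and> \<not> P a b b'"
      using h that M P_eq by blast
  next
    assume "\<exists>b'. (a, b') \<in> M \<and> \<not> P a b b'"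
    then show "\<exists>z. (f a, z) \<in> map_prod f g ` M \<and> \<not> P' (f a) (g b) z"
      using P_eq[OF that] M by (metis map_prod_imageI mem_Sigma_iff subsetD)
  qed
  have "(\<forall>x x' y. (x', y) \<in> map_prod f g ` M \<longrightarrow> (x, y) \<in> map_prod f g ` E \<longrightarrow> R' y x x' \<longrightarrow>
        (\<exists>z. (x, z) \<in> map_prod f g ` M \<and> \<not> P' x y z)) \<longleftrightarrow>
    (\<forall>a a' b. (a', b) \<in> M \<longrightarrow> (a, b) \<in> E \<longrightarrow> R b a a' \<longrightarrow> (\<exists>b'. (a, b') \<in> M \<and> \<not> P a b b'))"
    (is "?l \<longleftrightarrow> ?r")
  proof
    assume l: ?l
    show ?r
    proof (intro allI impI)
      fix a a' b assume h: "(a', b) \<in> M" "(a, b) \<in> E" "R b a a'"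
      then have m: "a \<in> A" "a' \<in> A" "b \<in> B" using M E_subset by auto
      have "\<exists>z. (f a, z) \<in> map_prod f g ` M \<and> \<not> P' (f a) (g b) z"
        using l h R_eq[of b a a'] m by (metis map_prod_imageI)
      then show "\<exists>b'. (a, b') \<in> M \<and> \<not> P a b b'" using ex m by simp
    qed
  next
    assume r: ?r
    show ?l
    proof (intro allI impI)
      fix x x' y
      assume h: "(x', y) \<in> map_prod f g ` M" "(x, y) \<in> map_prod f g ` E" "R' y x x'"
      then obtain a a' b b' where m: "(a', b) \<in> M" "(a, b') \<in> E" "x = f a" "x' = f a'" "y = g b" "y = g b'"
        by auto
      then have bb: "b' = b" using M E_subset inj_g by (auto dest: inj_onD)
      have "R b a a'" using R_eq[of b a a'] M E_subset m h by auto
      with r m bb have "\<exists>b'. (a, b') \<in> M \<and> \<not> P a b b'" by blast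
      moreover have "a \<in> A" "b \<in> B"
        using m M E_subset by auto
      ultimately show "\<exists>z. (x, z) \<in> map_prod f g ` M \<and> \<not> P' x y z"
        unfolding m(3,5) by (simp only: ex)
    qed
  qed
  then show ?thesis
    unfolding no_envy_def rel_matching_map[OF inj_f inj_g E_subset M] by simp
qed

end

section \<open>Subinstances\<close>

lemma precedes_Nil [simp]: "\<not> precedes [] v w"
  by (simp add: precedes_def)

lemma precedes_Cons [simp]: "precedes (x # xs) v w \<longleftrightarrow> x = v \<and> w \<in> set xs \<or> precedes xs v w"
proof
  assume "precedes (x # xs) v w"
  then obtain i j where "i < j" "j < length (x # xs)" "(x # xs) ! i = v" "(x # xs) ! j = w"
    unfolding precedes_def by blast
  then show "x = v \<and> w \<in> set xs \<or> precedes xs v w"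
    unfolding precedes_def by (cases i; cases j) auto
next
  assume "x = v \<and> w \<in> set xs \<or> precedes xs v w"
  then show "precedes (x # xs) v w"
  proof
    assume "x = v \<and> w \<in> set xs"
    then obtain j where "j < length xs" "xs ! j = w" "x = v"
      by (auto simp: in_set_conv_nth)
    then show ?thesis
      unfolding precedes_def by (intro exI[of _ 0] exI[of _ "Suc j"]) auto
  next
    assume "precedes xs v w"
    then obtain i j where "i < j" "j < length xs" "xs ! i = v" "xs ! j = w"
      unfolding precedes_def by blast
    then show ?thesis
      unfolding precedes_def by (intro exI[of _ "Suc i"] exI[of _ "Suc j"]) auto
  qed
qed

lemma precedes_mem: "precedes xs v w \<Longrightarrow> v \<in> set xs \<and> w \<in> set xs"
  by (induction xs) auto

lemma precedes_irrefl: "distinct xs \<Longrightarrow> \<not> precedes xs v v"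
  by (induction xs) auto

lemma precedes_trans: "distinct xs \<Longrightarrow> precedes xs u v \<Longrightarrow> precedes xs v w \<Longrightarrow> precedes xs u w"
  by (induction xs) (auto dest: precedes_mem)

lemma precedes_total:
  "v \<in> set xs \<Longrightarrow> w \<in> set xs \<Longrightarrow> v \<noteq> w \<Longrightarrow> precedes xs v w \<or> precedes xs w v"
  by (induction xs) auto

lemma precedes_map_filter:
  assumes "inj_on f K" "v \<in> K" "w \<in> K"
  shows "precedes (map f (filter (\<lambda>x. x \<in> K) xs)) (f v) (f w) \<longleftrightarrow> precedes xs v w"
  using assms by (induction xs) (auto dest: inj_onD)

text \<open>On \<open>K\<close> this is the order-preserving renumbering onto an initial segment. It
  is also used at points outside \<open>K\<close>: at an upper end it yields the number of members
  below.\<close>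

definition rank :: "nat set \<Rightarrow> nat \<Rightarrow> nat" where
  "rank K x = card {y \<in> K. y < x}"

lemma rank_Suc: "rank K (Suc x) = rank K x + of_bool (x \<in> K)"
proof -
  have "{y \<in> K. y < Suc x} = (if x \<in> K then insert x {y \<in> K. y < x} else {y \<in> K. y < x})"
    by (auto simp: less_Suc_eq)
  then show ?thesis
    by (simp add: rank_def)
qed

lemma rank_0 [simp]: "rank K 0 = 0"
  by (simp add: rank_def)

lemma length_filter_upt: "length (filter (\<lambda>x. x \<in> K) [0..<n]) = rank K n"
  by (induction n) (auto simp: rank_Suc)

lemma rank_mono: "x \<le> y \<Longrightarrow> rank K x \<le> rank K y"
  unfolding rank_def by (intro card_mono) auto

lemma rank_strict_mono: "x \<in> K \<Longrightarrow> x < y \<Longrightarrow> rank K x < rank K y"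
  using rank_mono[of "Suc x" y K] by (simp add: rank_Suc)

lemma inj_on_rank: "inj_on (rank K) K"
  by (rule inj_onI) (metis nat_neq_iff rank_strict_mono)

lemma rank_eq_card: "K \<subseteq> {..<n} \<Longrightarrow> rank K n = card K"
  unfolding rank_def by (rule arg_cong[of _ _ card]) auto

lemma rank_image: "K \<subseteq> {..<n} \<Longrightarrow> rank K ` K = {..<rank K n}"
proof (rule card_seteq)
  assume K: "K \<subseteq> {..<n}"
  then show "rank K ` K \<subseteq> {..<rank K n}"
    by (auto intro: rank_strict_mono)
  show "card {..<rank K n} \<le> card (rank K ` K)"
    using rank_eq_card[OF K] by (simp add: card_image inj_on_rank)
qed simp

lemma nth_filter_upt_rank: "x \<in> K \<Longrightarrow> x < n \<Longrightarrow> filter (\<lambda>x. x \<in> K) [0..<n] ! rank K x = x"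
proof (induction n)
  case (Suc n)
  show ?case
  proof (cases "x < n")
    case True
    then have "rank K x < length (filter (\<lambda>x. x \<in> K) [0..<n])"
      using Suc.prems rank_strict_mono by (simp add: length_filter_upt)
    then show ?thesis
      using Suc True by (simp add: nth_append)
  next
    case False
    then have "x = n" using Suc.prems by simp
    then show ?thesis
      using Suc.prems by (simp add: nth_append length_filter_upt)
  qed
qed simp

definition sub_lists :: "nat \<Rightarrow> nat set \<Rightarrow> nat set \<Rightarrow> nat list list \<Rightarrow> nat list list" where
  "sub_lists n K L xss =
     map (\<lambda>a. map (rank L) (filter (\<lambda>b. b \<in> L) (xss ! a))) (filter (\<lambda>a. a \<in> K) [0..<n])"

definition sub_instance :: "lq_instance \<Rightarrow> nat set \<Rightarrow> nat set \<Rightarrow> lq_instance" where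
  "sub_instance G KA KB = \<lparr>
     apref = sub_lists (length (apref G)) KA KB (apref G),
     bpref = sub_lists (length (bpref G)) KB KA (bpref G),
     lq = map (\<lambda>b. lq G ! b) (filter (\<lambda>b. b \<in> KB) [0..<length (bpref G)])\<rparr>"

lemma length_sub_lists: "length (sub_lists n K L xss) = rank K n"
  by (simp add: sub_lists_def length_filter_upt)

lemma nth_sub_lists:
  assumes "x \<in> K" "x < n"
  shows "sub_lists n K L xss ! rank K x = map (rank L) (filter (\<lambda>b. b \<in> L) (xss ! x))"
  using assms rank_strict_mono[of x K n]
  by (simp add: sub_lists_def length_filter_upt nth_filter_upt_rank)

section \<open>Instances as preference graphs\<close>

abbreviation prefA :: "lq_instance \<Rightarrow> nat \<Rightarrow> nat \<Rightarrow> nat \<Rightarrow> bool" where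
  "prefA G \<equiv> \<lambda>a. precedes (apref G ! a)"

abbreviation prefB :: "lq_instance \<Rightarrow> nat \<Rightarrow> nat \<Rightarrow> nat \<Rightarrow> bool" where
  "prefB G \<equiv> \<lambda>b. precedes (bpref G ! b)"

abbreviation lq_set :: "lq_instance \<Rightarrow> nat set" where
  "lq_set G \<equiv> {b. is_lq G b}"

lemma edges_wf:
  assumes "wf_instance G" "(a, b) \<in> edges G"
  shows "a \<in> agents G" "b \<in> resources G" "b \<in> set (apref G ! a)" "a \<in> set (bpref G ! b)"
  using assms unfolding wf_instance_def edges_def by blast+

lemma preference_graph_instance:
  assumes wf: "wf_instance G"
  shows "preference_graph (edges G) (prefA G) (prefB G)"
proof
  have "edges G \<subseteq> agents G \<times> resources G"
    using edges_wf[OF wf] by auto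
  then show "finite (edges G)"
    by (rule finite_subset) (simp add: agents_def resources_def)
next
  fix a b assume E: "(a, b) \<in> edges G"
  then have d: "distinct (apref G ! a)" "distinct (bpref G ! b)"
    using wf edges_wf[OF wf E] unfolding wf_instance_def by blast+
  then show "\<not> prefA G a b b" "\<not> prefB G b a a"
    by (auto dest: precedes_irrefl)
  show "prefA G a b d" if "prefA G a b c" "prefA G a c d" for c d
    using d that precedes_trans by blast
  show "prefB G b a d" if "prefB G b a c" "prefB G b c d" for c d
    using d that precedes_trans by blast
  show "prefA G a b c \<or> prefA G a c b" if "(a, c) \<in> edges G" "b \<noteq> c" for c
    using precedes_total edges_wf[OF wf E] edges_wf[OF wf that(1)] that(2) by blast
  show "prefB G b a c \<or> prefB G b c a" if "(c, b) \<in> edges G" "a \<noteq> c" for c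
    using precedes_total edges_wf[OF wf E] edges_wf[OF wf that(1)] that(2) by blast
qed

lemma matching_iff: "matching G M \<longleftrightarrow> rel_matching (edges G) M"
  by (simp add: matching_def rel_matching_def)

lemma apartner_Some: "rel_matching E M \<Longrightarrow> apartner M a = Some b \<longleftrightarrow> (a, b) \<in> M"
  unfolding apartner_def by (auto intro: theI dest: rel_matching_fst intro!: the_equality)

lemma apartner_None: "apartner M a = None \<longleftrightarrow> (\<forall>b. (a, b) \<notin> M)"
  by (simp add: apartner_def)

lemma bpartner_Some: "rel_matching E M \<Longrightarrow> bpartner M b = Some a \<longleftrightarrow> (a, b) \<in> M"
  unfolding bpartner_def by (auto intro: theI dest: rel_matching_snd intro!: the_equality)

lemma bpartner_None: "bpartner M b = None \<longleftrightarrow> (\<forall>a. (a, b) \<notin> M)"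
  by (simp add: bpartner_def)

lemma precedes_opt_apartner:
  assumes "rel_matching (edges G) M" "(a, b) \<in> edges G"
  shows "precedes_opt (apref G ! a) b (apartner M a) \<longleftrightarrow> (\<forall>b'. (a, b') \<in> M \<longrightarrow> prefA G a b b')"
proof (cases "apartner M a")
  case None
  then have "\<forall>b'. (a, b') \<notin> M" by (simp add: apartner_None)
  with None assms(2) show ?thesis by (simp add: edges_def)
next
  case (Some b')
  then have "(a, b') \<in> M"
    using apartner_Some[OF assms(1)] by simp
  then have "(a, c) \<in> M \<longleftrightarrow> c = b'" for c
    using rel_matching_fst[OF assms(1)] by blast
  with Some show ?thesis by simp
qed

lemma precedes_opt_bpartner:
  assumes "wf_instance G" "rel_matching (edges G) M" "(a, b) \<in> edges G"
  shows "precedes_opt (bpref G ! b) a (bpartner M b) \<longleftrightarrow> (\<forall>a'. (a', b) \<in> M \<longrightarrow> prefB G b a a')"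
proof (cases "bpartner M b")
  case None
  then have "\<forall>a'. (a', b) \<notin> M" by (simp add: bpartner_None)
  with None edges_wf[OF assms(1,3)] show ?thesis by simp
next
  case (Some a')
  then have "(a', b) \<in> M"
    using bpartner_Some[OF assms(2)] by simp
  then have "(c, b) \<in> M \<longleftrightarrow> c = a'" for c
    using rel_matching_snd[OF assms(2)] by blast
  with Some show ?thesis by simp
qed

lemma blocking_pair_iff:
  assumes "wf_instance G" "rel_matching (edges G) M"
  shows "blocking_pair G M a b \<longleftrightarrow> blocks (edges G) (prefA G) (prefB G) M a b"
  using precedes_opt_apartner[OF assms(2)] precedes_opt_bpartner[OF assms]
  unfolding blocking_pair_def blocks_def by blast

lemma stable_iff:
  "wf_instance G \<Longrightarrow> stable G M \<longleftrightarrow> stable_modulo (edges G) (prefA G) (prefB G) {} M"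
  unfolding stable_def stable_modulo_def matching_iff using blocking_pair_iff by auto

lemma relaxed_stable_iff:
  assumes wf: "wf_instance G"
  shows "relaxed_stable G M \<longleftrightarrow> stable_modulo (edges G) (prefA G) (prefB G) (lq_set G) M"
proof (cases "rel_matching (edges G) M")
  case True
  then show ?thesis
    by (auto simp: relaxed_stable_def stable_modulo_def matching_iff Bex_def conj_commute
      blocking_pair_iff[OF wf True] apartner_Some[OF True])
qed (simp add: relaxed_stable_def stable_modulo_def matching_iff)

lemma envy_free_iff: "envy_free G M \<longleftrightarrow> no_envy (edges G) (prefA G) (prefB G) M"
proof -
  have "(\<forall>a a'. \<not> envies G M a a') \<longleftrightarrow>
    (\<forall>a a' b. (a', b) \<in> M \<longrightarrow> (a, b) \<in> edges G \<longrightarrow> prefB G b a a' \<longrightarrow>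
      (\<exists>b'. (a, b') \<in> M \<and> \<not> prefA G a b b'))" if "rel_matching (edges G) M"
    unfolding envies_def apartner_Some[OF that]
    using precedes_opt_apartner[OF that] by blast
  then show ?thesis
    unfolding envy_free_def no_envy_def matching_iff by blast
qed

lemma feasible_iff: "feasible G M \<longleftrightarrow> lq_set G \<subseteq> snd ` M"
  unfolding feasible_def bpartner_None by force

text \<open>The definite description denotes because all stable matchings have the same
  size.\<close>

lemma stable_size_eq:
  assumes wf: "wf_instance G" and M: "stable G M"
  shows "stable_size G = card M"
proof -
  interpret preference_graph "edges G" "prefA G" "prefB G"
    using wf by (rule preference_graph_instance)
  show ?thesis
    unfolding stable_size_def
    using stable_card_eq M unfolding stable_iff[OF wf] by blast
qed

lemma ex_stable_instance:
  assumes wf: "wf_instance G"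
  shows "\<exists>M. stable G M"
proof -
  interpret preference_graph "edges G" "prefA G" "prefB G"
    using wf by (rule preference_graph_instance)
  show ?thesis
    using ex_stable unfolding stable_iff[OF wf] .
qed

lemma matching_card_le:
  assumes wf: "wf_instance G" and N: "matching G N"
  shows "card N \<le> 2 * stable_size G"
proof -
  interpret preference_graph "edges G" "prefA G" "prefB G"
    using wf by (rule preference_graph_instance)
  obtain M where "stable G M"
    using ex_stable_instance[OF wf] ..
  then show ?thesis
    using matching_card_le_double_stable[of M N] N
    by (simp add: stable_size_eq[OF wf] stable_iff[OF wf] matching_iff)
qed

section \<open>The subinstance induced by the kept vertices\<close>

locale induced =
  fixes G :: lq_instance and KA KB :: "nat set"
  assumes wf: "wf_instance G" and KA: "KA \<subseteq> agents G" and KB: "KB \<subseteq> resources G"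
begin

abbreviation G' :: lq_instance where
  "G' \<equiv> sub_instance G KA KB"

abbreviation h :: "nat \<times> nat \<Rightarrow> nat \<times> nat" where
  "h \<equiv> map_prod (rank KA) (rank KB)"

lemma len: "length (apref G') = rank KA (length (apref G))"
  "length (bpref G') = rank KB (length (bpref G))" "length (lq G') = rank KB (length (bpref G))"
  by (simp_all add: sub_instance_def length_sub_lists length_filter_upt)

lemma agents_sub: "agents G' = rank KA ` KA"
  using KA rank_image[of KA "length (apref G)"] by (simp add: agents_def len)

lemma resources_sub: "resources G' = rank KB ` KB"
  using KB rank_image[of KB "length (bpref G)"] by (simp add: resources_def len)

lemma apref_sub: "a \<in> KA \<Longrightarrow> apref G' ! rank KA a = map (rank KB) (filter (\<lambda>b. b \<in> KB) (apref G ! a))"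
  using KA by (auto simp: sub_instance_def nth_sub_lists agents_def)

lemma bpref_sub: "b \<in> KB \<Longrightarrow> bpref G' ! rank KB b = map (rank KA) (filter (\<lambda>a. a \<in> KA) (bpref G ! b))"
  using KB by (auto simp: sub_instance_def nth_sub_lists resources_def)

lemma mem_rank_iff: "x \<in> K \<Longrightarrow> rank K x \<in> set (map (rank K) (filter (\<lambda>b. b \<in> K) xs)) \<longleftrightarrow> x \<in> set xs"
  using inj_on_rank[of K] by (auto dest: inj_onD)

lemma wf_sub: "wf_instance G'"
  unfolding wf_instance_def
proof (intro conjI ballI)
  show "length (lq G') = length (bpref G')" by (simp add: len)
next
  fix x assume "x \<in> agents G'"
  then obtain a where a: "x = rank KA a" "a \<in> KA" by (auto simp: agents_sub)
  then have "distinct (apref G ! a)"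
    using wf KA unfolding wf_instance_def by blast
  then show "distinct (apref G' ! x)"
    using a by (auto simp: apref_sub distinct_map intro: inj_on_subset[OF inj_on_rank])
  show "set (apref G' ! x) \<subseteq> resources G'"
    using a by (auto simp: apref_sub resources_sub)
next
  fix x assume "x \<in> resources G'"
  then obtain b where b: "x = rank KB b" "b \<in> KB" by (auto simp: resources_sub)
  then have "distinct (bpref G ! b)"
    using wf KB unfolding wf_instance_def by blast
  then show "distinct (bpref G' ! x)"
    using b by (auto simp: bpref_sub distinct_map intro: inj_on_subset[OF inj_on_rank])
  show "set (bpref G' ! x) \<subseteq> agents G'"
    using b by (auto simp: bpref_sub agents_sub)
next
  fix x y assume "x \<in> agents G'" "y \<in> resources G'"
  then obtain a b where ab: "x = rank KA a" "a \<in> KA" "y = rank KB b" "b \<in> KB"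
    by (auto simp: agents_sub resources_sub)
  then have "b \<in> set (apref G ! a) \<longleftrightarrow> a \<in> set (bpref G ! b)"
    using wf KA KB unfolding wf_instance_def by blast
  then show "y \<in> set (apref G' ! x) \<longleftrightarrow> x \<in> set (bpref G' ! y)"
    unfolding ab(1,3) apref_sub[OF ab(2)] bpref_sub[OF ab(4)] mem_rank_iff[OF ab(2)] mem_rank_iff[OF ab(4)] .
qed

lemma edges_sub: "edges G' = h ` (edges G \<inter> KA \<times> KB)"
proof -
  have "edges G' = {(rank KA a, rank KB b) |a b. a \<in> KA \<and> b \<in> KB \<and> b \<in> set (apref G ! a)}"
    unfolding edges_def agents_sub by (auto simp: apref_sub) (use apref_sub in fastforce)
  then show ?thesis
    using KA by (force simp: edges_def)
qed

lemma lq_sub: "lq_set G' = rank KB ` (lq_set G \<inter> KB)"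
proof -
  have "lq G' ! rank KB b = lq G ! b" if "b \<in> KB" for b
  proof -
    have "rank KB b < rank KB (length (bpref G))"
      using that KB by (auto simp: resources_def intro: rank_strict_mono)
    then show ?thesis
      using that KB nth_filter_upt_rank[of b KB "length (bpref G)"]
      by (auto simp: sub_instance_def length_filter_upt resources_def)
  qed
  then show ?thesis
    using KB unfolding is_lq_def resources_sub by auto
qed

sublocale relabelling "rank KA" "rank KB" KA KB "edges G \<inter> KA \<times> KB"
    "prefA G" "prefA G'" "prefB G" "prefB G'"
proof
  show "prefA G' (rank KA a) (rank KB b) (rank KB b') \<longleftrightarrow> prefA G a b b'"
    if "a \<in> KA" "b \<in> KB" "b' \<in> KB" for a b b'
    using that inj_on_rank by (simp add: apref_sub precedes_map_filter)
  show "prefB G' (rank KB b) (rank KA a) (rank KA a') \<longleftrightarrow> prefB G b a a'"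
    if "b \<in> KB" "a \<in> KA" "a' \<in> KA" for a a' b
    using that inj_on_rank by (simp add: bpref_sub precedes_map_filter)
qed (auto intro: inj_on_rank)

lemma matching_sub_preimage:
  assumes "matching G' M'"
  obtains M where "M' = h ` M" "M \<subseteq> edges G \<inter> KA \<times> KB"
  using assms unfolding matching_def edges_sub by (metis subset_imageE)

lemma card_map: "M \<subseteq> KA \<times> KB \<Longrightarrow> card (h ` M) = card M"
  by (intro card_image inj_on_subset[OF map_prod_inj_on]) (auto intro: inj_on_rank)

text \<open>Deleting an LQ resource would silently drop its quota; hence the assumption that all of
  them are kept.\<close>

lemma feasible_sub:
  assumes "M \<subseteq> KA \<times> KB" "lq_set G \<subseteq> KB"
  shows "feasible G' (h ` M) \<longleftrightarrow> feasible G M"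
proof -
  have "snd ` h ` M = rank KB ` snd ` M" by force
  moreover have "rank KB ` lq_set G \<subseteq> rank KB ` snd ` M \<longleftrightarrow> lq_set G \<subseteq> snd ` M"
  proof (intro iffI subsetI)
    fix b assume b: "rank KB ` lq_set G \<subseteq> rank KB ` snd ` M" "b \<in> lq_set G"
    then have "rank KB b \<in> rank KB ` snd ` M" by blast
    moreover have "snd ` M \<subseteq> KB" "b \<in> KB" using assms b by auto
    ultimately show "b \<in> snd ` M"
      using inj_on_image_mem_iff[OF inj_on_rank] by blast
  qed blast
  ultimately show ?thesis
    using assms(2) unfolding feasible_iff lq_sub by (simp add: Int_absorb2)
qed

lemma relaxed_stable_sub:
  assumes "M \<subseteq> KA \<times> KB" "lq_set G \<subseteq> KB"
  shows "relaxed_stable G' (h ` M) \<longleftrightarrow>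
    stable_modulo (edges G \<inter> KA \<times> KB) (prefA G) (prefB G) (lq_set G) M"
  using stable_modulo_map[OF assms] assms(2)
  unfolding relaxed_stable_iff[OF wf_sub] edges_sub lq_sub by (simp add: Int_absorb2)

lemma stable_sub:
  assumes "M \<subseteq> KA \<times> KB"
  shows "stable G' (h ` M) \<longleftrightarrow> stable_modulo (edges G \<inter> KA \<times> KB) (prefA G) (prefB G) {} M"
  using stable_modulo_map[OF assms, of "{}"]
  unfolding stable_iff[OF wf_sub] edges_sub by simp

lemma envy_free_sub:
  assumes "M \<subseteq> KA \<times> KB"
  shows "envy_free G' (h ` M) \<longleftrightarrow> no_envy (edges G \<inter> KA \<times> KB) (prefA G) (prefB G) M"
  using no_envy_map[OF assms] unfolding envy_free_iff edges_sub .

end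

text \<open>The first claim is the promise for the subinstance, the second the equivalence of the
  answers, for every target size \<open>k\<close>.\<close>

lemma rsm_kernel_correct:
  assumes "induced G KA KB"
    and "reduced_graph_rsm (edges G) (prefA G) (prefB G) XA KA XB KB (lq_set G) C"
  shows "stable G M \<Longrightarrow> feasible G M \<Longrightarrow>
      \<exists>M'. stable (sub_instance G KA KB) M' \<and> feasible (sub_instance G KA KB) M'"
    and "(sub_instance G KA KB, k) \<in> maxrsm_yes \<longleftrightarrow> (G, k) \<in> maxrsm_yes"
proof -
  interpret induced G KA KB by fact
  interpret reduced_graph_rsm "edges G" "prefA G" "prefB G" XA KA XB KB "lq_set G" C by fact
  have lq: "lq_set G \<subseteq> KB"
    using Q_subset X_kept by blast
  show "\<exists>M'. stable G' M' \<and> feasible G' M'" if "stable G M" "feasible G M"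
  proof -
    have s: "stable_modulo (edges G \<inter> KA \<times> KB) (prefA G) (prefB G) {} M"
      using that stable_reduced unfolding stable_iff[OF wf] by blast
    then have "M \<subseteq> KA \<times> KB"
      using rel_matching_subset stable_modulo_matching by blast
    with s that lq show ?thesis
      using stable_sub feasible_sub by blast
  qed
  show "(G', k) \<in> maxrsm_yes \<longleftrightarrow> (G, k) \<in> maxrsm_yes"
  proof
    assume "(G', k) \<in> maxrsm_yes"
    then obtain M' where M': "feasible G' M'" "relaxed_stable G' M'" "card M' = k"
      by (auto simp: maxrsm_yes_def)
    then have "matching G' M'" by (simp add: relaxed_stable_def)
    then obtain M where M: "M' = h ` M" "M \<subseteq> edges G \<inter> KA \<times> KB"
      by (rule matching_sub_preimage)
    then have K: "M \<subseteq> KA \<times> KB" by blast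
    have "feasible G M" "relaxed_stable G M" "card M = k"
      using M' unfolding M(1) feasible_sub[OF K lq] relaxed_stable_sub[OF K lq] card_map[OF K]
        stable_modulo_reduced_iff relaxed_stable_iff[OF wf] by auto
    then show "(G, k) \<in> maxrsm_yes"
      by (auto simp: maxrsm_yes_def)
  next
    assume "(G, k) \<in> maxrsm_yes"
    then obtain M where M: "feasible G M" "relaxed_stable G M" "card M = k"
      by (auto simp: maxrsm_yes_def)
    then have s: "stable_modulo (edges G) (prefA G) (prefB G) (lq_set G) M"
      unfolding relaxed_stable_iff[OF wf] by blast
    then have K: "M \<subseteq> KA \<times> KB" by (rule stable_modulo_kept)
    have "feasible G' (h ` M)" "relaxed_stable G' (h ` M)" "card (h ` M) = k"
      using M s unfolding feasible_sub[OF K lq] relaxed_stable_sub[OF K lq] card_map[OF K]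
        stable_modulo_reduced_iff by auto
    then show "(G', k) \<in> maxrsm_yes"
      by (auto simp: maxrsm_yes_def)
  qed
qed

lemma efm_kernel_correct:
  assumes "induced G KA KB"
    and "reduced_graph_efm (edges G) (prefA G) (prefB G) XA KA XB KB (lq_set G) C"
  shows "(\<exists>M. feasible G M \<and> envy_free G M) \<Longrightarrow>
      \<exists>M'. feasible (sub_instance G KA KB) M' \<and> envy_free (sub_instance G KA KB) M'"
    and "(sub_instance G KA KB, k) \<in> maxefm_yes \<longleftrightarrow> (G, k) \<in> maxefm_yes"
proof -
  interpret induced G KA KB by fact
  interpret reduced_graph_efm "edges G" "prefA G" "prefB G" XA KA XB KB "lq_set G" C by fact
  have lq: "lq_set G \<subseteq> KB"
    using Q_subset X_kept by blast
  \<comment> \<open>Keeping the size as well lets one statement yield both the promise and the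
    forward direction of the equivalence.\<close>
  have red: "\<exists>M'. feasible G' M' \<and> envy_free G' M' \<and> card M' = card M"
    if M: "feasible G M" "envy_free G M" for M
  proof -
    obtain N where N: "no_envy (edges G \<inter> KA \<times> KB) (prefA G) (prefB G) N"
      "lq_set G \<subseteq> snd ` N" "card N = card M"
      using no_envy_reduce[of M] M unfolding feasible_iff envy_free_iff by blast
    then have K: "N \<subseteq> KA \<times> KB"
      using rel_matching_subset[OF no_envy_matching] by blast
    have "feasible G' (h ` N)" "envy_free G' (h ` N)" "card (h ` N) = card M"
      using N unfolding feasible_sub[OF K lq] envy_free_sub[OF K] card_map[OF K] feasible_iff[of G] by auto
    then show ?thesis by blast
  qed
  then show "(\<exists>M. feasible G M \<and> envy_free G M) \<Longrightarrow> \<exists>M'. feasible G' M' \<and> envy_free G' M'"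
    by blast
  show "(G', k) \<in> maxefm_yes \<longleftrightarrow> (G, k) \<in> maxefm_yes"
  proof
    assume "(G', k) \<in> maxefm_yes"
    then obtain M' where M': "feasible G' M'" "envy_free G' M'" "card M' = k"
      by (auto simp: maxefm_yes_def)
    then have "matching G' M'" by (simp add: envy_free_def)
    then obtain M where M: "M' = h ` M" "M \<subseteq> edges G \<inter> KA \<times> KB"
      by (rule matching_sub_preimage)
    then have K: "M \<subseteq> KA \<times> KB" by blast
    have "feasible G M" "envy_free G M" "card M = k"
      using M' no_envy_extend unfolding M(1) feasible_sub[OF K lq] envy_free_sub[OF K] card_map[OF K]
        envy_free_iff[of G] by auto
    then show "(G, k) \<in> maxefm_yes"
      by (auto simp: maxefm_yes_def)
  next
    assume "(G, k) \<in> maxefm_yes"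
    then show "(G', k) \<in> maxefm_yes"
      using red unfolding maxefm_yes_def by blast
  qed
qed

section \<open>The kept vertices\<close>

lemma precedes_append: "x \<in> set us \<Longrightarrow> y \<in> set vs \<Longrightarrow> precedes (us @ vs) x y"
  by (induction us) auto

lemma precedes_filter: "precedes (filter p xs) v w \<Longrightarrow> precedes xs v w"
  by (induction xs) (auto split: if_splits)

lemma precedes_map_iff: "inj f \<Longrightarrow> precedes (map f xs) (f v) (f w) \<longleftrightarrow> precedes xs v w"
  by (induction xs) (auto simp: inj_eq)

text \<open>A qualifying element that is cut off comes after \<open>C\<close> qualifying ones,
  because \<open>take\<close> keeps a prefix.\<close>

lemma take_filter_precedes:
  assumes "distinct xs" "y \<in> set xs" "p y" "y \<notin> set (take C (filter p xs))"
  shows "card (set (take C (filter p xs))) = C"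
    and "x \<in> set (take C (filter p xs)) \<Longrightarrow> x \<in> set xs \<and> p x \<and> precedes xs x y"
proof -
  let ?ys = "filter p xs"
  have "y \<in> set ?ys" using assms by simp
  then have y: "y \<in> set (drop C ?ys)"
    using assms(4) by (metis UnE append_take_drop_id set_append)
  then have "C \<le> length ?ys"
    by (metis drop_all empty_iff linorder_le_cases list.set(1))
  then show "card (set (take C ?ys)) = C"
    using assms(1) by (simp add: distinct_card)
  assume x: "x \<in> set (take C ?ys)"
  then have "precedes ?ys x y"
    using precedes_append[OF x y] by simp
  moreover have "x \<in> set ?ys"
    using x in_set_takeD by fast
  ultimately show "x \<in> set xs \<and> p x \<and> precedes xs x y"
    using precedes_filter by auto
qed

text \<open>
  Agent \<open>a\<close> is the vertex \<open>a\<close> and resource \<open>b\<close> is the vertex \<open>length (apref G) + b\<close>.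
\<close>

definition num_agents :: "lq_instance \<Rightarrow> nat" where "num_agents G = length (apref G)"
definition num_vertices :: "lq_instance \<Rightarrow> nat" where "num_vertices G = length (apref G) + length (bpref G)"

definition vlist :: "lq_instance \<Rightarrow> nat \<Rightarrow> nat list" where
  "vlist G v = (if v < num_agents G then map ((+) (num_agents G)) (apref G ! v) else bpref G ! (v - num_agents G))"

text \<open>
  For envy-freeness, resources outside the cover with at least two neighbours are always kept: two
  of their neighbours are agents of the cover, so there are at most quadratically many in the size
  of the cover times \<open>max_common G\<close>.
\<close>

definition special :: "lq_instance \<Rightarrow> bool \<Rightarrow> nat \<Rightarrow> bool" where
  "special G efm u \<longleftrightarrow> efm \<and> num_agents G \<le> u \<and> 1 < length (vlist G u)"

text \<open>Special neighbours are marked beyond the quota \<open>C\<close>. If they consumed it, an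
  agent might be left without a kept private resource to move to.\<close>

definition mark :: "lq_instance \<Rightarrow> bool \<Rightarrow> nat set \<Rightarrow> nat \<Rightarrow> nat list \<Rightarrow> nat set" where
  "mark G efm X C xs = {u \<in> set xs. u \<notin> X \<and> special G efm u} \<union>
     set (take C (filter (\<lambda>u. u \<notin> X \<and> \<not> special G efm u) xs))"

definition kept :: "lq_instance \<Rightarrow> bool \<Rightarrow> nat set \<Rightarrow> nat set" where
  "kept G efm X = X \<union> (\<Union>v\<in>X. mark G efm X (card X + 1) (vlist G v))"

definition agents_of :: "lq_instance \<Rightarrow> nat set \<Rightarrow> nat set" where
  "agents_of G K = {a. a < num_agents G \<and> a \<in> K}"

definition resources_of :: "lq_instance \<Rightarrow> nat set \<Rightarrow> nat set" where
  "resources_of G K = {b. num_agents G + b \<in> K}"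

text \<open>A specification that leaves open which matching the greedy scan finds. \<open>M\<close>
  itself need not be maximal: edges at LQ resources are covered anyway.\<close>

definition matching_cover :: "lq_instance \<Rightarrow> nat set \<Rightarrow> bool" where
  "matching_cover G X \<longleftrightarrow> (\<forall>(a, b)\<in>edges G. a \<in> X \<or> num_agents G + b \<in> X) \<and>
     (\<exists>M. matching G M \<and>
       X = (+) (num_agents G) ` lq_set G \<union> fst ` M \<union> (+) (num_agents G) ` snd ` M)"

lemma mark_subset: "mark G efm X C xs \<subseteq> set xs - X"
  unfolding mark_def using set_take_subset by fastforce

locale cover =
  fixes G :: lq_instance and efm :: bool and X :: "nat set"
  assumes wf: "wf_instance G" and mc: "matching_cover G X"
begin

abbreviation "n \<equiv> num_agents G"
abbreviation "C \<equiv> card X + 1"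
abbreviation "K \<equiv> kept G efm X"

lemma edge_bounds: "(a, b) \<in> edges G \<Longrightarrow> a < n \<and> b < length (bpref G)"
  using edges_wf[OF wf] by (auto simp: agents_def resources_def num_agents_def)

lemma cover_edge: "(a, b) \<in> edges G \<Longrightarrow> a \<in> X \<or> n + b \<in> X"
  using mc by (auto simp: matching_cover_def)

lemma lq_in_X: "is_lq G b \<Longrightarrow> n + b \<in> X"
  using mc by (auto simp: matching_cover_def)

lemma X_bound: "X \<subseteq> {..<num_vertices G}"
proof -
  obtain M where M: "matching G M" "X = (+) n ` lq_set G \<union> fst ` M \<union> (+) n ` snd ` M"
    using mc by (auto simp: matching_cover_def)
  have "lq_set G \<subseteq> {..<length (bpref G)}"
    by (auto simp: is_lq_def resources_def)
  moreover have "M \<subseteq> edges G" using M by (simp add: matching_def)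
  ultimately show ?thesis
    using M(2) edge_bounds unfolding num_vertices_def num_agents_def by fastforce
qed

lemma finite_X: "finite X"
  using X_bound finite_subset by blast

lemma vlist_agent: "(a, b) \<in> edges G \<longleftrightarrow> a < n \<and> n + b \<in> set (vlist G a)"
  by (auto simp: edges_def vlist_def agents_def num_agents_def)

lemma vlist_resource: "b < length (bpref G) \<Longrightarrow> a \<in> set (vlist G (n + b)) \<longleftrightarrow> (a, b) \<in> edges G"
  using wf edges_wf[OF wf, of a b]
  unfolding wf_instance_def edges_def vlist_def resources_def by auto blast+

lemma vlist_wf:
  assumes "v < num_vertices G"
  shows "distinct (vlist G v)" "set (vlist G v) \<subseteq> {..<num_vertices G}"
    "v < n \<Longrightarrow> u \<in> set (vlist G v) \<Longrightarrow> n \<le> u" "n \<le> v \<Longrightarrow> u \<in> set (vlist G v) \<Longrightarrow> u < n"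
proof -
  consider "v < n" | b where "v = n + b" "b < length (bpref G)"
    using assms unfolding num_vertices_def num_agents_def by (metis add_less_cancel_left le_add_diff_inverse linorder_not_less)
  then have "distinct (vlist G v) \<and> set (vlist G v) \<subseteq> {..<num_vertices G} \<and>
    (v < n \<longrightarrow> (\<forall>u\<in>set (vlist G v). n \<le> u)) \<and> (n \<le> v \<longrightarrow> (\<forall>u\<in>set (vlist G v). u < n))"
  proof cases
    case 1
    then have "v \<in> agents G" by (simp add: agents_def num_agents_def)
    then have "distinct (apref G ! v)" "set (apref G ! v) \<subseteq> {..<length (bpref G)}"
      using wf unfolding wf_instance_def resources_def by blast+
    moreover have "vlist G v = map ((+) n) (apref G ! v)"
      using 1 by (simp add: vlist_def)
    ultimately show ?thesis
      using 1 by (auto simp: distinct_map num_vertices_def num_agents_def)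
  next
    case 2
    then have "b \<in> resources G" by (simp add: resources_def)
    then have "distinct (bpref G ! b)" "set (bpref G ! b) \<subseteq> {..<n}"
      using wf unfolding wf_instance_def agents_def num_agents_def by blast+
    moreover have "vlist G v = bpref G ! b"
      using 2 by (simp add: vlist_def)
    ultimately show ?thesis
      using 2 by (auto simp: num_vertices_def num_agents_def)
  qed
  then show "distinct (vlist G v)" "set (vlist G v) \<subseteq> {..<num_vertices G}"
    "v < n \<Longrightarrow> u \<in> set (vlist G v) \<Longrightarrow> n \<le> u" "n \<le> v \<Longrightarrow> u \<in> set (vlist G v) \<Longrightarrow> u < n"
    by blast+
qed

lemma K_bound: "K \<subseteq> {..<num_vertices G}"
  using X_bound vlist_wf(2) mark_subset[of G efm X C] unfolding kept_def by fastforce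

lemma mark_kept: "v \<in> X \<Longrightarrow> mark G efm X C (vlist G v) \<subseteq> K - X"
  using mark_subset[of G efm X C "vlist G v"] unfolding kept_def by blast

lemma not_kept:
  assumes "v \<in> X" "u \<in> set (vlist G v)" "u \<notin> K"
  defines "T \<equiv> set (take C (filter (\<lambda>u. u \<notin> X \<and> \<not> special G efm u) (vlist G v)))"
  shows "card T = C" "\<not> special G efm u"
    and "x \<in> T \<Longrightarrow> x \<in> set (vlist G v) \<and> x \<in> K - X \<and> \<not> special G efm x \<and> precedes (vlist G v) x u"
proof -
  have "u \<notin> X" "u \<notin> mark G efm X C (vlist G v)"
    using assms unfolding kept_def by blast+
  then have u: "\<not> special G efm u" "u \<notin> T"
    using assms(2) by (auto simp: mark_def T_def)
  have d: "distinct (vlist G v)"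
    using assms(1) X_bound vlist_wf(1) by blast
  note * = take_filter_precedes[OF d assms(2), of "\<lambda>u. u \<notin> X \<and> \<not> special G efm u" C]
  show "card T = C" "\<not> special G efm u"
    using *(1) u \<open>u \<notin> X\<close> by (auto simp: T_def)
  assume x: "x \<in> T"
  then have "x \<in> mark G efm X C (vlist G v)"
    by (simp add: T_def mark_def)
  then show "x \<in> set (vlist G v) \<and> x \<in> K - X \<and> \<not> special G efm x \<and> precedes (vlist G v) x u"
    using *(2)[of x] u \<open>u \<notin> X\<close> x mark_kept[OF assms(1)] by (auto simp: T_def)
qed

text \<open>The threshold \<open>card X + 1\<close> exceeds both sides of the cover. For a resource
  in the cover, the \<open>C\<close> entries marked in its list before a dropped agent are the
  required candidates.\<close>

lemma reduced: "reduced_graph (edges G) (prefA G) (prefB G) (agents_of G X) (agents_of G K)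
  (resources_of G X) (resources_of G K) (lq_set G) C"
proof (intro reduced_graph.intro reduced_graph_axioms.intro)
  show "preference_graph (edges G) (prefA G) (prefB G)"
    using wf by (rule preference_graph_instance)
  show "a \<in> agents_of G X \<or> b \<in> resources_of G X" if "(a, b) \<in> edges G" for a b
    using cover_edge[OF that] edge_bounds[OF that] by (auto simp: agents_of_def resources_of_def)
  have inj: "inj_on ((+) n) (resources_of G X)" "(+) n ` resources_of G X \<subseteq> X"
    by (auto simp: resources_of_def)
  show "finite (agents_of G X)"
    using finite_X by (auto simp: agents_of_def)
  show "finite (resources_of G X)"
    using inj finite_X by (meson finite_imageD finite_subset)
  show "agents_of G X \<subseteq> agents_of G K" "resources_of G X \<subseteq> resources_of G K"
    by (auto simp: agents_of_def resources_of_def kept_def)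
  show "lq_set G \<subseteq> resources_of G X"
    using lq_in_X by (auto simp: resources_of_def)
  have "card (agents_of G X) \<le> card X"
    using finite_X by (intro card_mono) (auto simp: agents_of_def)
  then show "card (agents_of G X) < C" by simp
  have "card (resources_of G X) \<le> card X"
    using inj finite_X by (rule card_inj_on_le)
  then show "card (resources_of G X) < C" by simp
  show "C \<le> card {a' \<in> agents_of G K - agents_of G X. (a', b) \<in> edges G \<and> prefB G b a' a}"
    if h: "b \<in> resources_of G X" "(a, b) \<in> edges G" "a \<notin> agents_of G K" for a b
  proof -
    have b: "n + b \<in> X" and bl: "b < length (bpref G)" and a: "a \<notin> K"
      using h edge_bounds[OF h(2)] by (auto simp: resources_of_def agents_of_def)
    have av: "a \<in> set (vlist G (n + b))"
      using vlist_resource[OF bl] h(2) by simp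
    define T where "T = set (take C (filter (\<lambda>u. u \<notin> X \<and> \<not> special G efm u) (vlist G (n + b))))"
    have "T \<subseteq> {a' \<in> agents_of G K - agents_of G X. (a', b) \<in> edges G \<and> prefB G b a' a}"
    proof
      fix x assume "x \<in> T"
      then have x: "x \<in> set (vlist G (n + b))" "x \<in> K - X" "precedes (vlist G (n + b)) x a"
        using not_kept(3)[OF b av a, of x] by (auto simp: T_def)
      then have "(x, b) \<in> edges G" "prefB G b x a"
        using vlist_resource[OF bl] by (auto simp: vlist_def)
      with x edge_bounds[of x b]
      show "x \<in> {a' \<in> agents_of G K - agents_of G X. (a', b) \<in> edges G \<and> prefB G b a' a}"
        by (auto simp: agents_of_def)
    qed
    then have "card T \<le> card {a' \<in> agents_of G K - agents_of G X. (a', b) \<in> edges G \<and> prefB G b a' a}"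
      by (intro card_mono) (auto simp: agents_of_def)
    then show ?thesis
      using not_kept(1)[OF b av a] by (simp add: T_def)
  qed
qed

text \<open>Common to both problems: relaxed stability uses the number of elements of
  \<open>T\<close>, envy-freeness only that \<open>T\<close> is nonempty and contains no special
  resource.\<close>

lemma resource_not_kept:
  assumes h: "a \<in> agents_of G X" "(a, b) \<in> edges G" "b \<notin> resources_of G K"
  obtains T where "card T = C" "\<not> special G efm (n + b)"
    and "T \<subseteq> {b' \<in> resources_of G K - resources_of G X. (a, b') \<in> edges G \<and> prefA G a b' b \<and>
           \<not> special G efm (n + b')}"
proof -
  have a: "a \<in> X" and b: "n + b \<notin> K" and an: "a < n"
    using h by (auto simp: resources_of_def agents_of_def)
  have bv: "n + b \<in> set (vlist G a)"
    using vlist_agent h(2) by simp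
  define T where "T = set (take C (filter (\<lambda>u. u \<notin> X \<and> \<not> special G efm u) (vlist G a)))"
  define T' where "T' = {b'. n + b' \<in> T}"
  have x: "n \<le> x \<and> x \<in> set (vlist G a) \<and> x \<in> K - X \<and> \<not> special G efm x \<and> precedes (vlist G a) x (n + b)"
    if "x \<in> T" for x
    using not_kept(3)[OF a bv b, of x] that vlist_wf(3)[of a x] an
    by (auto simp: T_def num_vertices_def num_agents_def)
  have "T = (+) n ` T'"
  proof (intro equalityI subsetI)
    fix x assume "x \<in> T"
    then show "x \<in> (+) n ` T'"
      using x[of x] by (intro image_eqI[of _ _ "x - n"]) (auto simp: T'_def)
  qed (auto simp: T'_def)
  then have "card T' = C"
    using not_kept(1)[OF a bv b] card_image[of "(+) n" T'] by (simp add: T_def)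
  moreover have "T' \<subseteq> {b' \<in> resources_of G K - resources_of G X. (a, b') \<in> edges G \<and> prefA G a b' b \<and>
           \<not> special G efm (n + b')}"
  proof
    fix b' assume "b' \<in> T'"
    then have h: "n + b' \<in> set (vlist G a)" "n + b' \<in> K - X" "\<not> special G efm (n + b')"
        "precedes (vlist G a) (n + b') (n + b)"
      using x[of "n + b'"] by (auto simp: T'_def)
    have "prefA G a b' b"
      using h(4) an precedes_map_iff[of "(+) n" "apref G ! a" b' b] by (simp add: vlist_def)
    with h an show "b' \<in> {b' \<in> resources_of G K - resources_of G X. (a, b') \<in> edges G \<and> prefA G a b' b \<and>
           \<not> special G efm (n + b')}"
      using vlist_agent by (auto simp: resources_of_def)
  qed
  ultimately show thesis
    using that not_kept(2)[OF a bv b] by blast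
qed

lemma finite_resources_of: "finite (resources_of G K)"
proof -
  have "(+) n ` resources_of G K \<subseteq> {..<num_vertices G}"
    using K_bound by (auto simp: resources_of_def)
  then have "finite ((+) n ` resources_of G K)"
    using finite_subset by blast
  then show ?thesis
    by (rule finite_imageD) simp
qed

lemma reduced_rsm:
  assumes "\<not> efm"
  shows "reduced_graph_rsm (edges G) (prefA G) (prefB G) (agents_of G X) (agents_of G K)
    (resources_of G X) (resources_of G K) (lq_set G) C"
proof (intro reduced_graph_rsm.intro reduced reduced_graph_rsm_axioms.intro)
  fix a b assume h: "a \<in> agents_of G X" "(a, b) \<in> edges G" "b \<notin> resources_of G K"
  let ?S = "{b' \<in> resources_of G K - resources_of G X. (a, b') \<in> edges G \<and> prefA G a b' b}"
  obtain T where "card T = C" "T \<subseteq> ?S"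
    by (rule resource_not_kept[OF h]) blast
  then show "C \<le> card ?S"
    using card_mono[of ?S T] finite_resources_of by simp
qed

lemma private_resource:
  assumes "efm" "\<not> special G efm (n + b)" "(a, b) \<in> edges G" "(a', b) \<in> edges G"
  shows "a' = a"
proof -
  have "length (bpref G ! b) \<le> 1" "a \<in> set (bpref G ! b)" "a' \<in> set (bpref G ! b)"
    using assms edges_wf[OF wf] by (auto simp: special_def vlist_def)
  then show ?thesis
    by (cases "bpref G ! b") auto
qed

lemma reduced_efm:
  assumes "efm"
  shows "reduced_graph_efm (edges G) (prefA G) (prefB G) (agents_of G X) (agents_of G K)
    (resources_of G X) (resources_of G K) (lq_set G) C"
proof (intro reduced_graph_efm.intro reduced reduced_graph_efm_axioms.intro)
  fix a b assume h: "a \<in> agents_of G X" "(a, b) \<in> edges G" "b \<notin> resources_of G K"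
  obtain T where T: "card T = C" "\<not> special G efm (n + b)"
    "T \<subseteq> {b' \<in> resources_of G K - resources_of G X. (a, b') \<in> edges G \<and> prefA G a b' b \<and>
           \<not> special G efm (n + b')}"
    using resource_not_kept[OF h] by blast
  then have "T \<noteq> {}" by auto
  then obtain b' where b': "b' \<in> T" by blast
  then have "\<forall>a'. (a', b') \<in> edges G \<longrightarrow> a' = a"
    using T(3) private_resource[OF assms, of b' a] by blast
  moreover have "\<forall>a'. (a', b) \<in> edges G \<longrightarrow> a' = a"
    using T(2) private_resource[OF assms, of b a] h(2) by blast
  ultimately show "(\<forall>a'. (a', b) \<in> edges G \<longrightarrow> a' = a) \<and>
    (\<exists>b'\<in>resources_of G K - resources_of G X. (a, b') \<in> edges G \<and> prefA G a b' b \<and>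
      (\<forall>a'. (a', b') \<in> edges G \<longrightarrow> a' = a))"
    using b' T(3) by blast
qed

lemma sub_kept: "induced G (agents_of G K) (resources_of G K)"
proof
  show "agents_of G K \<subseteq> agents G"
    by (auto simp: agents_of_def agents_def num_agents_def)
  show "resources_of G K \<subseteq> resources G"
    using K_bound by (auto simp: resources_of_def resources_def num_agents_def num_vertices_def)
qed (rule wf)

section \<open>Sizes of the cover and of the kept set\<close>

lemma card_common_le:
  assumes "a < n" "a' < n" "a \<noteq> a'"
  shows "card {b \<in> resources G. \<not> is_lq G b \<and> b \<in> set (apref G ! a) \<and> b \<in> set (apref G ! a')}
    \<le> max_common G"
proof -
  let ?f = "\<lambda>a a'. card {b \<in> resources G. \<not> is_lq G b \<and> b \<in> set (apref G ! a) \<and> b \<in> set (apref G ! a')}"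
  let ?S = "{?f a a' |a a'. a \<in> agents G \<and> a' \<in> agents G \<and> a \<noteq> a'}"
  have "?f a a' \<le> card (resources G)" for a a'
    by (rule card_mono) (auto simp: resources_def)
  then have "?S \<subseteq> {..card (resources G)}" by auto
  then have "finite ?S"
    by (rule finite_subset) simp
  moreover have "a \<in> agents G" "a' \<in> agents G"
    using assms by (auto simp: agents_def num_agents_def)
  then have "?f a a' \<in> ?S"
    using assms(3) by blast
  ultimately show ?thesis
    unfolding max_common_def by (intro Max_ge) auto
qed

text \<open>A resource \<open>v\<close> has only agents as neighbours, and these are never special.
  For an agent \<open>v\<close>, a special \<open>u\<close> outside the cover has a second
  neighbour, which must be in the cover; charge \<open>u\<close> to it. Being outside the cover,
  \<open>u\<close> is no LQ resource and counts in \<open>max_common G\<close>.\<close>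

lemma card_special_le:
  assumes v: "v \<in> X"
  shows "card {u \<in> set (vlist G v). u \<notin> X \<and> special G efm u} \<le> card X * max_common G"
proof (cases "v < n")
  case False
  have "{u \<in> set (vlist G v). u \<notin> X \<and> special G efm u} = {}"
    using vlist_wf(4)[of v] v X_bound False by (fastforce simp: special_def)
  then show ?thesis by (simp only: card.empty)
next
  case True
  let ?c = "\<lambda>a'. {b \<in> resources G. \<not> is_lq G b \<and> b \<in> set (apref G ! v) \<and> b \<in> set (apref G ! a')}"
  let ?Y = "{a' \<in> X. a' < n \<and> a' \<noteq> v}"
  have sub: "{u \<in> set (vlist G v). u \<notin> X \<and> special G efm u} \<subseteq> (\<Union>a'\<in>?Y. (+) n ` ?c a')"
  proof
    fix u assume "u \<in> {u \<in> set (vlist G v). u \<notin> X \<and> special G efm u}"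
    then have u: "u \<in> set (vlist G v)" "u \<notin> X" "special G efm u" by auto
    then obtain b where b: "u = n + b"
      unfolding special_def using le_Suc_ex by blast
    have E: "(v, b) \<in> edges G"
      using vlist_agent True u b by simp
    have bl: "b < length (bpref G)"
      using edge_bounds[OF E] by simp
    have "distinct (vlist G u)" "1 < length (vlist G u)"
      using u b bl vlist_wf(1)[of u] by (auto simp: special_def num_vertices_def num_agents_def)
    then have "\<not> set (vlist G u) \<subseteq> {v}"
      using card_mono[of "{v}" "set (vlist G u)"] by (auto simp: distinct_card)
    then obtain a' where a': "a' \<in> set (vlist G u)" "a' \<noteq> v" by blast
    then have E': "(a', b) \<in> edges G"
      using vlist_resource[OF bl] b by simp
    have "a' \<in> X"
      using cover_edge[OF E'] u b by blast
    moreover have "b \<in> ?c a'"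
      using E E' u b lq_in_X edge_bounds[OF E] by (auto simp: edges_def resources_def)
    ultimately show "u \<in> (\<Union>a'\<in>?Y. (+) n ` ?c a')"
      using a' b edge_bounds[OF E'] by blast
  qed
  have finY: "finite ?Y" using finite_X by simp
  have fin: "finite ((+) n ` ?c a')" for a'
    by (simp add: resources_def)
  have "card {u \<in> set (vlist G v). u \<notin> X \<and> special G efm u} \<le> card (\<Union>a'\<in>?Y. (+) n ` ?c a')"
    using sub finY fin by (intro card_mono) auto
  also have "\<dots> \<le> (\<Sum>a'\<in>?Y. card ((+) n ` ?c a'))"
    using finY by (rule card_UN_le)
  also have "\<dots> \<le> (\<Sum>a'\<in>?Y. max_common G)"
  proof (rule sum_mono)
    fix a' assume a': "a' \<in> ?Y"
    have "card ((+) n ` ?c a') \<le> card (?c a')"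
      by (intro card_image_le) (simp add: resources_def)
    also have "\<dots> \<le> max_common G"
      using card_common_le[of v a'] True a' by auto
    finally show "card ((+) n ` ?c a') \<le> max_common G" .
  qed
  also have "\<dots> \<le> card X * max_common G"
    using finite_X by (auto intro!: mult_le_mono1 card_mono)
  finally show ?thesis .
qed

text \<open>For relaxed stability nothing is special, so \<open>t = 0\<close> is admissible and the
  bound depends on the cover alone.\<close>

lemma card_kept_le:
  assumes "efm \<longrightarrow> max_common G \<le> t"
  shows "card K \<le> card X + card X * (card X * t + card X + 1)"
proof -
  have "card (mark G efm X C (vlist G v)) \<le> card X * t + C" if v: "v \<in> X" for v
  proof -
    let ?S = "{u \<in> set (vlist G v). u \<notin> X \<and> special G efm u}"
    have "card ?S \<le> card X * t"
    proof (cases efm)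
      case True
      then show ?thesis
        using card_special_le[OF v] assms by (meson le_trans mult_le_mono2)
    qed (simp add: special_def)
    moreover have "card (set (take C (filter (\<lambda>u. u \<notin> X \<and> \<not> special G efm u) (vlist G v)))) \<le> C"
      by (rule order_trans[OF card_length]) simp
    ultimately show ?thesis
      unfolding mark_def by (intro order_trans[OF card_Un_le] add_mono)
  qed
  then have "(\<Sum>v\<in>X. card (mark G efm X C (vlist G v))) \<le> card X * (card X * t + C)"
    using sum_bounded_above[of X "\<lambda>v. card (mark G efm X C (vlist G v))" "card X * t + C"] by simp
  moreover have "card K \<le> card X + (\<Sum>v\<in>X. card (mark G efm X C (vlist G v)))"
    unfolding kept_def
    by (rule order_trans[OF card_Un_le add_left_mono[OF card_UN_le[OF finite_X]]])
  ultimately show ?thesis by simp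
qed

text \<open>The factor 6: a feasible matching shows that there are at most
  \<open>2 * stable_size G\<close> LQ resources, and the matching inside the cover contributes at
  most as many agents and as many resources again.\<close>

lemma card_X_le:
  assumes "matching G M" "feasible G M"
  shows "card X \<le> 6 * stable_size G"
proof -
  obtain N where N: "matching G N" "X = (+) n ` lq_set G \<union> fst ` N \<union> (+) n ` snd ` N"
    using mc by (auto simp: matching_cover_def)
  interpret preference_graph "edges G" "prefA G" "prefB G"
    using wf by (rule preference_graph_instance)
  have fin: "finite M" "finite N"
    using assms N finite_matching matching_iff by blast+
  have lq: "lq_set G \<subseteq> snd ` M"
    using assms by (simp add: feasible_iff)
  have "card ((+) n ` lq_set G) \<le> card (lq_set G)"
    using lq fin by (intro card_image_le) (auto intro: finite_subset)
  also have "\<dots> \<le> card (snd ` M)"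
    using lq fin by (intro card_mono) auto
  also have "\<dots> \<le> card M"
    using fin by (intro card_image_le)
  also have "\<dots> \<le> 2 * stable_size G"
    using matching_card_le[OF wf assms(1)] .
  finally have 1: "card ((+) n ` lq_set G) \<le> 2 * stable_size G" .
  have 2: "card (fst ` N) \<le> card N" "card ((+) n ` snd ` N) \<le> card N"
    using fin by (auto simp: image_image intro: card_image_le)
  have 3: "card N \<le> 2 * stable_size G"
    using matching_card_le[OF wf N(1)] .
  have "card X \<le> card ((+) n ` lq_set G) + card (fst ` N) + card ((+) n ` snd ` N)"
    unfolding N(2) by (intro order_trans[OF card_Un_le] add_right_mono card_Un_le)
  with 1 2 3 show ?thesis by linarith
qed

end

section \<open>The program\<close>

lemma encode_lists_append: "encode_lists (xss @ yss) = encode_lists xss @ encode_lists yss"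
  by (simp add: encode_lists_def)

lemma encode_lists_snoc: "encode_lists (xss @ [xs]) = encode_lists xss @ length xs # xs"
  by (simp add: encode_lists_def)

lemma encode_lists_split:
  "v < length xss \<Longrightarrow> encode_lists xss =
     encode_lists (take v xss) @ (length (xss ! v) # xss ! v) @ encode_lists (drop (Suc v) xss)"
  by (subst id_take_nth_drop[of v xss]) (auto simp: encode_lists_def)

lemma length_encode_lists_ge: "length xss \<le> length (encode_lists xss)"
  by (induction xss) (auto simp: encode_lists_def)

text \<open>
  Array 1 holds the position of each vertex' list in the input, arrays 2 and 3 the indicator
  functions of the cover and of the kept vertices, array 4 the ranks with respect to the kept
  vertices, array 5 the output. Register 1 is the number of agents, 2 the number of vertices, 3 the
  current vertex, 4 the index into its list, 5 the neighbour found there, 6 the marking threshold,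
  7 a counter, 8 the length of the output, 9 the position of the length field being written.
\<close>

definition load_neighbour :: com where
  "load_neighbour =
     Seq (SetReg 5 (Cell 0 (Plus (Plus (Cell 1 (Reg 3)) (Const 1)) (Reg 4))))
       (Cond (Less (Reg 3) (Reg 1)) (SetReg 5 (Plus (Reg 1) (Reg 5))) Skip)"

definition for_neighbours :: "com \<Rightarrow> com" where
  "for_neighbours c = For 4 (Cell 0 (Cell 1 (Reg 3))) (Seq load_neighbour c)"

text \<open>Register 5 serves here as the reading position. The first list follows three header
  letters and one quota letter per resource; each list occupies one letter more than its
  length.\<close>

definition parse_prog :: com where
  "parse_prog =
     Seq (SetReg 1 (Cell 0 (Const 1)))
    (Seq (SetReg 2 (Plus (Reg 1) (Cell 0 (Const 2))))
    (Seq (SetReg 5 (Plus (Const 3) (Cell 0 (Const 2))))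
      (For 3 (Reg 2) (Seq (SetCell 1 (Reg 3) (Reg 5))
        (SetReg 5 (Plus (Plus (Reg 5) (Cell 0 (Reg 5))) (Const 1)))))))"

definition lq_prog :: com where
  "lq_prog = For 3 (Reg 2)
     (Cond (Conj (Neg (Less (Reg 3) (Reg 1)))
         (Equal (Cell 0 (Plus (Const 3) (Minus (Reg 3) (Reg 1)))) (Const 1)))
       (SetCell 2 (Reg 3) (Const 1)) Skip)"

text \<open>Array 2 already contains the LQ resources, so an edge at one of them is never
  taken.\<close>

definition matching_prog :: com where
  "matching_prog = For 3 (Reg 1) (for_neighbours
     (Cond (Conj (Equal (Cell 2 (Reg 3)) (Const 0)) (Equal (Cell 2 (Reg 5)) (Const 0)))
       (Seq (SetCell 2 (Reg 3) (Const 1)) (SetCell 2 (Reg 5) (Const 1))) Skip))"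

text \<open>Starting the count at 1 makes register 6 the threshold; array 3 starts out as a copy of
  the cover, all of which is kept.\<close>

definition count_prog :: com where
  "count_prog = Seq (SetReg 6 (Const 1)) (For 3 (Reg 2)
     (Seq (SetCell 3 (Reg 3) (Cell 2 (Reg 3))) (SetReg 6 (Plus (Reg 6) (Cell 2 (Reg 3))))))"

text \<open>The comparison of two constants builds the flag into the program text. The number of
  neighbours of the vertex in register 5 is read off the length field of its list.\<close>

definition mark_prog :: "bool \<Rightarrow> com" where
  "mark_prog efm = For 3 (Reg 2) (Cond (Equal (Cell 2 (Reg 3)) (Const 1))
     (Seq (SetReg 7 (Const 0)) (for_neighbours
       (Cond (Equal (Cell 2 (Reg 5)) (Const 0))
         (Cond (Conj (Equal (Const (of_bool efm)) (Const 1))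
             (Conj (Neg (Less (Reg 5) (Reg 1))) (Less (Const 1) (Cell 0 (Cell 1 (Reg 5))))))
           (SetCell 3 (Reg 5) (Const 1))
           (Cond (Less (Reg 7) (Reg 6))
             (Seq (SetCell 3 (Reg 5) (Const 1)) (SetReg 7 (Plus (Reg 7) (Const 1)))) Skip))
         Skip))) Skip)"

text \<open>One round more than there are vertices, so that the rank at the upper end, the number of
  kept vertices, is stored too.\<close>

definition rank_prog :: com where
  "rank_prog = Seq (SetReg 7 (Const 0)) (For 3 (Plus (Reg 2) (Const 1))
     (Seq (SetCell 4 (Reg 3) (Reg 7)) (SetReg 7 (Plus (Reg 7) (Cell 3 (Reg 3))))))"

definition emit :: "aexp \<Rightarrow> com" where
  "emit e = Seq (SetCell 5 (Reg 8) e) (SetReg 8 (Plus (Reg 8) (Const 1)))"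

text \<open>\<open>Cell 4 (Reg 1)\<close> is the number of kept agents. A target above it is
  unattainable in the subinstance and is lowered to the least unattainable value.\<close>

definition header_prog :: com where
  "header_prog = Seq (SetReg 8 (Const 0))
    (Seq (Cond (Less (Cell 4 (Reg 1)) (Cell 0 (Const 0)))
        (emit (Plus (Cell 4 (Reg 1)) (Const 1))) (emit (Cell 0 (Const 0))))
    (Seq (emit (Cell 4 (Reg 1)))
      (emit (Minus (Cell 4 (Reg 2)) (Cell 4 (Reg 1))))))"

definition emit_lq_prog :: com where
  "emit_lq_prog = For 3 (Reg 2)
     (Cond (Conj (Neg (Less (Reg 3) (Reg 1))) (Equal (Cell 3 (Reg 3)) (Const 1)))
       (emit (Cell 0 (Plus (Const 3) (Minus (Reg 3) (Reg 1))))) Skip)"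

text \<open>The length of a filtered list is known only after the scan: a placeholder is written at
  the position saved in register 9 and overwritten at the end.\<close>

definition emit_lists_prog :: com where
  "emit_lists_prog = For 3 (Reg 2) (Cond (Equal (Cell 3 (Reg 3)) (Const 1))
    (Seq (SetReg 9 (Reg 8))
    (Seq (emit (Const 0))
    (Seq (for_neighbours (Cond (Equal (Cell 3 (Reg 5)) (Const 1))
        (Cond (Less (Reg 3) (Reg 1)) (emit (Minus (Cell 4 (Reg 5)) (Cell 4 (Reg 1))))
          (emit (Cell 4 (Reg 5)))) Skip))
      (SetCell 5 (Reg 9) (Minus (Minus (Reg 8) (Reg 9)) (Const 1)))))) Skip)"

text \<open>Array 0 is read until the output is complete, which is why the output is assembled in
  array 5. Old letters beyond the new length in register 0 do no harm.\<close>

definition copy_prog :: com where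
  "copy_prog = Seq (For 3 (Reg 8) (SetCell 0 (Reg 3) (Cell 5 (Reg 3)))) (SetReg 0 (Reg 8))"

definition kernel_prog :: "bool \<Rightarrow> com" where
  "kernel_prog efm = Seq parse_prog (Seq lq_prog (Seq matching_prog (Seq count_prog
     (Seq (mark_prog efm) (Seq rank_prog (Seq header_prog (Seq emit_lq_prog
     (Seq emit_lists_prog copy_prog))))))))"

section \<open>Memory predicates\<close>

definition ind :: "nat set \<Rightarrow> nat \<Rightarrow> nat" where
  "ind S v = of_bool (v \<in> S)"

lemma ind_upd: "(ind S)(v := Suc 0) = ind (insert v S)"
  by (auto simp: ind_def fun_eq_iff)

lemma ind_eq_iff: "ind S v = 0 \<longleftrightarrow> v \<notin> S" "ind S v = Suc 0 \<longleftrightarrow> v \<in> S"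
  by (auto simp: ind_def)

lemma ind_empty: "(\<lambda>_. 0) = ind {}"
  by (auto simp: ind_def)

text \<open>Later phases rely on their arrays being blank, which earlier phases must therefore
  preserve.\<close>

definition zero_from :: "nat \<Rightarrow> ram_state \<Rightarrow> bool" where
  "zero_from l \<sigma> \<longleftrightarrow> (\<forall>A\<ge>l. arr \<sigma> A = (\<lambda>_. 0))"

definition holds :: "(nat \<Rightarrow> nat) \<Rightarrow> nat list \<Rightarrow> bool" where
  "holds f xs \<longleftrightarrow> (\<forall>i<length xs. f i = xs ! i)"

lemma holds_Nil: "holds f []"
  by (simp add: holds_def)

lemma holds_snoc: "holds f xs \<Longrightarrow> holds (f(length xs := x)) (xs @ [x])"
  by (auto simp: holds_def nth_append less_Suc_eq)

lemma holds_patch: "holds f (xs @ y # ys) \<Longrightarrow> holds (f(length xs := z)) (xs @ z # ys)"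
  by (auto simp: holds_def nth_append nth_Cons split: nat.splits)

locale program_input =
  fixes G :: lq_instance and k :: nat and efm :: bool
  assumes wf: "wf_instance G"
begin

abbreviation "n \<equiv> num_agents G"
abbreviation "N \<equiv> num_vertices G"
abbreviation "w \<equiv> encode (G, k)"
abbreviation "L \<equiv> length w"

text \<open>The exact initial content of array 0, zeros included, so that an untouched input is an
  equation between functions.\<close>

definition W :: "nat \<Rightarrow> nat" where
  "W i = (if i < L then w ! i else 0)"

definition raw :: "nat \<Rightarrow> nat list" where
  "raw v = (apref G @ bpref G) ! v"

text \<open>The position of the length field that precedes the list of vertex \<open>v\<close> in
  the input.\<close>

definition off :: "nat \<Rightarrow> nat" where
  "off v = 3 + length (bpref G) + length (encode_lists (take v (apref G @ bpref G)))"

lemma length_lq: "length (lq G) = length (bpref G)"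
  using wf by (simp add: wf_instance_def)

lemma w_eq: "w = [k, n, length (bpref G)] @ map of_bool (lq G) @ encode_lists (apref G @ bpref G)"
  by (simp add: encode_def num_agents_def encode_lists_append)

lemma W_header: "W 0 = k" "W (Suc 0) = n" "W 2 = length (bpref G)"
  by (simp_all add: W_def w_eq numeral_2_eq_2)

lemma W_lq: "b < length (bpref G) \<Longrightarrow> W (3 + b) = of_bool (lq G ! b)"
  using length_lq by (auto simp: W_def w_eq numeral_3_eq_3 nth_append)

lemma W_append: "w = xs @ y # ys \<Longrightarrow> W (length xs) = y"
  by (simp add: W_def)

lemma w_split:
  assumes "v < N"
  obtains xs ys where "w = xs @ length (raw v) # raw v @ ys" "length xs = off v"
proof -
  have "v < length (apref G @ bpref G)"
    using assms by (simp add: num_vertices_def)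
  from encode_lists_split[OF this] show thesis
    by (intro that[of "[k, n, length (bpref G)] @ map of_bool (lq G) @ encode_lists (take v (apref G @ bpref G))"
        "encode_lists (drop (Suc v) (apref G @ bpref G))"])
      (simp_all add: w_eq raw_def off_def length_lq)
qed

lemma W_off: "v < N \<Longrightarrow> W (off v) = length (raw v)"
  by (metis w_split W_append)

lemma W_off_nth:
  assumes "v < N" "j < length (raw v)"
  shows "W (off v + 1 + j) = raw v ! j"
proof -
  obtain xs ys where w: "w = xs @ length (raw v) # raw v @ ys" "length xs = off v"
    using w_split[OF assms(1)] .
  have "w = (xs @ length (raw v) # take j (raw v)) @ raw v ! j # (drop (Suc j) (raw v) @ ys)"
    using w(1) id_take_nth_drop[OF assms(2)] by simp
  from W_append[OF this] w(2) assms(2) show ?thesis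
    by (simp add: add.commute)
qed

lemma raw_le_L: "v < N \<Longrightarrow> length (raw v) \<le> L"
proof -
  assume "v < N"
  then obtain xs ys where "w = xs @ length (raw v) # raw v @ ys" by (rule w_split)
  then have "L = length (xs @ length (raw v) # raw v @ ys)" by simp
  then show ?thesis by simp
qed

lemma N_le_L: "N \<le> L"
  using length_encode_lists_ge[of "apref G @ bpref G"] by (simp add: w_eq num_vertices_def)

lemma n_le_N: "n \<le> N"
  by (simp add: num_agents_def num_vertices_def)

lemma off_0: "off 0 = 3 + length (bpref G)"
  by (simp add: off_def encode_lists_def)

lemma off_Suc:
  assumes "v < N"
  shows "off (Suc v) = off v + length (raw v) + 1"
proof -
  have "take (Suc v) (apref G @ bpref G) = take v (apref G @ bpref G) @ [raw v]"
    using assms unfolding raw_def by (intro take_Suc_conv_app_nth) (simp add: num_vertices_def)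
  then show ?thesis
    unfolding off_def by (simp add: encode_lists_snoc del: take_append)
qed

lemma vlist_raw: "v < N \<Longrightarrow> vlist G v = map (\<lambda>u. if v < n then n + u else u) (raw v)"
  by (auto simp: vlist_def raw_def num_vertices_def num_agents_def nth_append)

lemma length_vlist: "v < N \<Longrightarrow> length (vlist G v) = length (raw v)"
  by (simp add: vlist_raw)

definition base :: "ram_state \<Rightarrow> bool" where
  "base \<sigma> \<longleftrightarrow> arr \<sigma> 0 = W \<and> reg \<sigma> (Suc 0) = n \<and> reg \<sigma> 2 = N \<and> (\<forall>v<N. arr \<sigma> (Suc 0) v = off v)"

text \<open>The loop is linear; the quadratic bound is chosen so that the bounds of all phases are
  multiples of one quantity.\<close>

lemma run_parse_prog:
  assumes "\<sigma> = initial w"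
  shows "run parse_prog \<sigma> (\<lambda>t \<tau>. t \<le> 10 * ((L + 1) * (L + 1)) \<and> base \<tau> \<and> zero_from 2 \<tau>)"
proof -
  have i: "arr \<sigma> 0 = W" "zero_from 1 \<sigma>"
    using assms by (auto simp: initial_def W_def zero_from_def fun_eq_iff)
  let ?I = "\<lambda>i \<tau>. arr \<tau> 0 = W \<and> reg \<tau> (Suc 0) = n \<and> reg \<tau> 2 = N \<and> reg \<tau> 3 = i \<and> reg \<tau> 5 = off i \<and>
    (\<forall>v<i. arr \<tau> (Suc 0) v = off v) \<and> zero_from 2 \<tau>"
  show ?thesis
    unfolding parse_prog_def
    apply (simp add: run_simps)
    apply (rule run_For[where I = ?I and K = N and t = 3])
    subgoal using i by (simp add: W_header off_0 num_vertices_def num_agents_def zero_from_def)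
    subgoal by simp
    subgoal by (auto simp: run_simps W_off off_Suc zero_from_def less_Suc_eq)
    subgoal using N_le_L by (auto simp: base_def algebra_simps)
    done
qed

lemma run_lq_prog:
  assumes "base \<sigma>" "zero_from 2 \<sigma>"
  shows "run lq_prog \<sigma> (\<lambda>t \<tau>. t \<le> 10 * ((L + 1) * (L + 1)) \<and> base \<tau> \<and> zero_from 3 \<tau> \<and>
    arr \<tau> 2 = ind ((+) n ` lq_set G))"
proof -
  let ?I = "\<lambda>i \<tau>. base \<tau> \<and> zero_from 3 \<tau> \<and> reg \<tau> 3 = i \<and> arr \<tau> 2 = ind {v \<in> (+) n ` lq_set G. v < i}"
  have step: "{v \<in> (+) n ` lq_set G. v < Suc i} = (if n \<le> i \<and> W (3 + (i - n)) = 1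
      then insert i {v \<in> (+) n ` lq_set G. v < i} else {v \<in> (+) n ` lq_set G. v < i})" if "i < N" for i
  proof -
    have "i \<in> (+) n ` lq_set G \<longleftrightarrow> n \<le> i \<and> W (3 + (i - n)) = 1"
    proof (cases "n \<le> i")
      case True
      then have b: "i - n < length (bpref G)"
        using that by (simp add: num_vertices_def num_agents_def)
      have "i \<in> (+) n ` lq_set G \<longleftrightarrow> is_lq G (i - n)"
        using True by (force intro: image_eqI[of _ _ "i - n"])
      then show ?thesis
        using True W_lq[OF b] b by (simp add: is_lq_def resources_def)
    qed auto
    then show ?thesis
      by (auto simp: less_Suc_eq)
  qed
  have fin: "{v \<in> (+) n ` lq_set G. v < N} = (+) n ` lq_set G"
    by (auto simp: is_lq_def resources_def num_vertices_def num_agents_def)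
  show ?thesis
    unfolding lq_prog_def
    apply (rule run_For[where I = ?I and K = N and t = 3])
    subgoal using assms by (simp add: base_def zero_from_def ind_empty)
    subgoal by (simp add: base_def)
    subgoal for i \<tau> using step[of i] by (auto simp: run_simps base_def zero_from_def ind_upd)
    subgoal using N_le_L fin by (simp add: algebra_simps)
    done
qed

lemma run_load_neighbour:
  assumes "base \<sigma>" "reg \<sigma> 3 = v" "v < N" "reg \<sigma> 4 = j" "j < length (raw v)"
  shows "run load_neighbour \<sigma> Q \<longleftrightarrow> Q 3 (\<sigma>\<lparr>reg := (reg \<sigma>)(5 := vlist G v ! j)\<rparr>)"
  using assms W_off_nth[of v j]
  by (auto simp: load_neighbour_def run_simps base_def vlist_raw numeral_3_eq_3)

text \<open>Loading the neighbour takes 3 steps and the body at most 10, fewer than 14 together, so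
  a round costs at most 15; a list has at most \<open>L\<close> entries. Assumption
  \<open>I5\<close> is there because loading writes register 5.\<close>

lemma run_for_neighbours:
  assumes v: "v < N" and pre: "base \<sigma>" "reg \<sigma> 3 = v"
    and init: "I 0 (\<sigma>\<lparr>reg := (reg \<sigma>)(4 := 0)\<rparr>)"
    and body: "\<And>j \<tau>. j < length (vlist G v) \<Longrightarrow> base \<tau> \<Longrightarrow> reg \<tau> 3 = v \<Longrightarrow> reg \<tau> 4 = j \<Longrightarrow>
      reg \<tau> 5 = vlist G v ! j \<Longrightarrow> vlist G v ! j < N \<Longrightarrow> I j \<tau> \<Longrightarrow>
      run c \<tau> (\<lambda>s \<tau>'. s \<le> 10 \<and> base \<tau>' \<and> reg \<tau>' 3 = v \<and> reg \<tau>' 4 = j \<and>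
        I (Suc j) (\<tau>'\<lparr>reg := (reg \<tau>')(4 := Suc j)\<rparr>))"
    and I5: "\<And>j \<tau> u. I j \<tau> \<Longrightarrow> I j (\<tau>\<lparr>reg := (reg \<tau>)(5 := u)\<rparr>)"
    and post: "\<And>t \<tau>. base \<tau> \<Longrightarrow> reg \<tau> 3 = v \<Longrightarrow> I (length (vlist G v)) \<tau> \<Longrightarrow>
      t \<le> 15 * L + 2 \<Longrightarrow> Q t \<tau>"
  shows "run (for_neighbours c) \<sigma> Q"
  unfolding for_neighbours_def
proof (rule run_For[where K = "length (vlist G v)" and t = 14
      and I = "\<lambda>j \<tau>. base \<tau> \<and> reg \<tau> 3 = v \<and> reg \<tau> 4 = j \<and> I j \<tau>"])
  have len: "length (vlist G v) = length (raw v)"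
    using v by (rule length_vlist)
  show "base (\<sigma>\<lparr>reg := (reg \<sigma>)(4 := 0)\<rparr>) \<and> reg (\<sigma>\<lparr>reg := (reg \<sigma>)(4 := 0)\<rparr>) 3 = v \<and>
      reg (\<sigma>\<lparr>reg := (reg \<sigma>)(4 := 0)\<rparr>) 4 = 0 \<and> I 0 (\<sigma>\<lparr>reg := (reg \<sigma>)(4 := 0)\<rparr>)"
    using pre init by (simp add: base_def)
  show "reg \<tau> 4 = i \<and> aval (Cell 0 (Cell 1 (Reg 3))) \<tau> = length (vlist G v)"
    if "base \<tau> \<and> reg \<tau> 3 = v \<and> reg \<tau> 4 = i \<and> I i \<tau>" for i \<tau>
    using that v by (simp add: base_def W_off len)
  show "Q t \<tau>" if "base \<tau> \<and> reg \<tau> 3 = v \<and> reg \<tau> 4 = length (vlist G v) \<and> I (length (vlist G v)) \<tau>"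
    "t \<le> length (vlist G v) * (14 + 1) + 2" for t \<tau>
    using that raw_le_L[OF v] len by (intro post) auto
  fix j \<tau>
  assume j: "j < length (vlist G v)" and h: "base \<tau> \<and> reg \<tau> 3 = v \<and> reg \<tau> 4 = j \<and> I j \<tau>"
  let ?\<tau> = "\<tau>\<lparr>reg := (reg \<tau>)(5 := vlist G v ! j)\<rparr>"
  have "set (vlist G v) \<subseteq> {..<N}"
  proof (cases "v < n")
    case True
    then have "v \<in> agents G" by (simp add: agents_def num_agents_def)
    then have "set (apref G ! v) \<subseteq> resources G"
      using wf unfolding wf_instance_def by blast
    then show ?thesis
      using True by (auto simp: vlist_def resources_def num_vertices_def num_agents_def)
  next
    case False
    then have "v - n \<in> resources G" using v by (simp add: resources_def num_vertices_def num_agents_def)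
    then have "set (bpref G ! (v - n)) \<subseteq> agents G"
      using wf unfolding wf_instance_def by blast
    then show ?thesis
      using False by (auto simp: vlist_def agents_def num_vertices_def num_agents_def)
  qed
  then have u: "vlist G v ! j < N"
    using nth_mem[OF j] by blast
  have "run c ?\<tau> (\<lambda>s \<tau>'. s \<le> 10 \<and> base \<tau>' \<and> reg \<tau>' 3 = v \<and> reg \<tau>' 4 = j \<and>
        I (Suc j) (\<tau>'\<lparr>reg := (reg \<tau>')(4 := Suc j)\<rparr>))"
    using h j u I5 by (intro body) (auto simp: base_def)
  then show "run (Seq load_neighbour c) \<tau> (\<lambda>s \<tau>'. s < 14 \<and> base (\<tau>'\<lparr>reg := (reg \<tau>')(4 := Suc (reg \<tau>' 4))\<rparr>) \<and>
      reg (\<tau>'\<lparr>reg := (reg \<tau>')(4 := Suc (reg \<tau>' 4))\<rparr>) 3 = v \<and>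
      reg (\<tau>'\<lparr>reg := (reg \<tau>')(4 := Suc (reg \<tau>' 4))\<rparr>) 4 = Suc j \<and>
      I (Suc j) (\<tau>'\<lparr>reg := (reg \<tau>')(4 := Suc (reg \<tau>' 4))\<rparr>))"
    using h j v len
    by (simp add: run_Seq run_load_neighbour[of \<tau> v j]) (erule run_mono, auto simp: base_def)
qed

text \<open>The total of an outer loop whose body runs through one list: \<open>15 * L + 2\<close>
  steps for the inner loop plus a constant overhead, staying below
  \<open>15 * L + 19\<close>.\<close>

lemma nested_time:
  assumes "m \<le> L" "t \<le> m * (15 * L + 19 + 1) + 2"
  shows "t \<le> 40 * ((L + 1) * (L + 1))"
proof -
  have "m * (15 * L + 19 + 1) \<le> L * (15 * L + 19 + 1)"
    using assms(1) by (rule mult_le_mono1)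
  then have "t \<le> L * (15 * L + 19 + 1) + 2"
    using assms(2) by linarith
  then show ?thesis by (simp add: algebra_simps)
qed

section \<open>The greedy cover\<close>

definition endpoints :: "(nat \<times> nat) set \<Rightarrow> nat set" where
  "endpoints M = (+) n ` lq_set G \<union> fst ` M \<union> (+) n ` snd ` M"

text \<open>Invariant of the greedy scan, with \<open>F\<close> the edges inspected so far.\<close>

definition partial_cover :: "nat set \<Rightarrow> (nat \<times> nat) set \<Rightarrow> bool" where
  "partial_cover X F \<longleftrightarrow> (\<exists>M. matching G M \<and> X = endpoints M) \<and>
     (\<forall>(a, b)\<in>F. a \<in> X \<or> n + b \<in> X)"

lemma partial_cover_init: "partial_cover ((+) n ` lq_set G) {}"
proof -
  have "matching G {}" "(+) n ` lq_set G = endpoints {}"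
    by (simp_all add: matching_def endpoints_def)
  then show ?thesis
    unfolding partial_cover_def by blast
qed

lemma partial_cover_covered:
  "partial_cover X F \<Longrightarrow> a \<in> X \<or> n + b \<in> X \<Longrightarrow> partial_cover X (insert (a, b) F)"
  unfolding partial_cover_def by auto

lemma partial_cover_add:
  assumes X: "partial_cover X F" and E: "(a, b) \<in> edges G" and new: "a \<notin> X" "n + b \<notin> X"
  shows "partial_cover (insert (n + b) (insert a X)) (insert (a, b) F)"
proof -
  obtain M where M: "matching G M" "X = endpoints M"
    using X unfolding partial_cover_def by blast
  have "a \<notin> fst ` M" "b \<notin> snd ` M"
    using new M(2) by (auto simp: endpoints_def)
  then have "(a, b') \<notin> M" "(a', b) \<notin> M" for a' b'
    by force+
  then have "matching G (insert (a, b) M)"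
    using M(1) E unfolding matching_def by blast
  moreover have "insert (n + b) (insert a X) = endpoints (insert (a, b) M)"
    using M(2) by (auto simp: endpoints_def)
  ultimately show ?thesis
    using X unfolding partial_cover_def by blast
qed

lemma matching_cover_iff: "matching_cover G X \<longleftrightarrow> partial_cover X (edges G)"
  unfolding matching_cover_def partial_cover_def endpoints_def by (rule conj_commute)

definition edges_upto :: "nat \<Rightarrow> nat \<Rightarrow> (nat \<times> nat) set" where
  "edges_upto i j = {(a, b) \<in> edges G. a < i} \<union> Pair i ` set (take j (apref G ! i))"

lemma edges_upto_Suc_right:
  "j < length (apref G ! i) \<Longrightarrow> edges_upto i (Suc j) = insert (i, apref G ! i ! j) (edges_upto i j)"
  by (simp add: edges_upto_def take_Suc_conv_app_nth)

lemma edges_upto_Suc_left: "i < n \<Longrightarrow> edges_upto (Suc i) 0 = edges_upto i (length (apref G ! i))"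
  by (auto simp: edges_upto_def edges_def agents_def num_agents_def less_Suc_eq)

lemma edges_upto_0: "edges_upto 0 0 = {}"
  by (simp add: edges_upto_def)

text \<open>The index \<open>n\<close> is out of range for the agents' lists, but no entry is taken
  from there.\<close>

lemma edges_upto_n: "edges_upto n 0 = edges G"
  by (auto simp: edges_upto_def edges_def agents_def num_agents_def)

lemma run_matching_prog:
  assumes "base \<sigma>" "zero_from 3 \<sigma>" "arr \<sigma> 2 = ind ((+) n ` lq_set G)"
  shows "run matching_prog \<sigma> (\<lambda>t \<tau>. t \<le> 40 * ((L + 1) * (L + 1)) \<and> base \<tau> \<and> zero_from 3 \<tau> \<and>
    (\<exists>X. matching_cover G X \<and> arr \<tau> 2 = ind X))"
proof -
  let ?J = "\<lambda>i j \<tau>. zero_from 3 \<tau> \<and> (\<exists>X. partial_cover X (edges_upto i j) \<and> arr \<tau> 2 = ind X)"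
  show ?thesis
    unfolding matching_prog_def
  proof (rule run_For[where K = n and t = "15 * L + 19" and I = "\<lambda>i \<tau>. base \<tau> \<and> reg \<tau> 3 = i \<and> ?J i 0 \<tau>"])
    show "base (\<sigma>\<lparr>reg := (reg \<sigma>)(3 := 0)\<rparr>) \<and> reg (\<sigma>\<lparr>reg := (reg \<sigma>)(3 := 0)\<rparr>) 3 = 0 \<and>
        ?J 0 0 (\<sigma>\<lparr>reg := (reg \<sigma>)(3 := 0)\<rparr>)"
      using assms partial_cover_init by (auto simp: base_def zero_from_def edges_upto_0)
    show "reg \<tau> 3 = i \<and> aval (Reg 1) \<tau> = n" if "base \<tau> \<and> reg \<tau> 3 = i \<and> ?J i 0 \<tau>" for i \<tau>
      using that by (simp add: base_def)
    show "t \<le> 40 * ((L + 1) * (L + 1)) \<and> base \<tau> \<and> zero_from 3 \<tau> \<and>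
        (\<exists>X. matching_cover G X \<and> arr \<tau> 2 = ind X)"
      if "base \<tau> \<and> reg \<tau> 3 = n \<and> ?J n 0 \<tau>" "t \<le> n * (15 * L + 19 + 1) + 2" for t \<tau>
      using that(1) nested_time[OF order_trans[OF n_le_N N_le_L] that(2)]
      unfolding edges_upto_n matching_cover_iff by blast
    fix i \<tau> assume i: "i < n" and h: "base \<tau> \<and> reg \<tau> 3 = i \<and> ?J i 0 \<tau>"
    have iN: "i < N" using i n_le_N by simp
    have len: "length (vlist G i) = length (apref G ! i)"
      using i by (simp add: vlist_def)
    show "run (for_neighbours
          (Cond (Conj (Equal (Cell 2 (Reg 3)) (Const 0)) (Equal (Cell 2 (Reg 5)) (Const 0)))
            (Seq (SetCell 2 (Reg 3) (Const 1)) (SetCell 2 (Reg 5) (Const 1))) Skip)) \<tau>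
        (\<lambda>t \<tau>'. t < 15 * L + 19 \<and> base (\<tau>'\<lparr>reg := (reg \<tau>')(3 := Suc (reg \<tau>' 3))\<rparr>) \<and>
          reg (\<tau>'\<lparr>reg := (reg \<tau>')(3 := Suc (reg \<tau>' 3))\<rparr>) 3 = Suc i \<and>
          ?J (Suc i) 0 (\<tau>'\<lparr>reg := (reg \<tau>')(3 := Suc (reg \<tau>' 3))\<rparr>))"
    proof (rule run_for_neighbours[OF iN, where I = "?J i"])
      show "base \<tau>" "reg \<tau> 3 = i" "?J i 0 (\<tau>\<lparr>reg := (reg \<tau>)(4 := 0)\<rparr>)"
        using h by (auto simp: zero_from_def)
      show "?J i j (\<tau>\<lparr>reg := (reg \<tau>)(5 := u)\<rparr>)" if "?J i j \<tau>" for j \<tau> u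
        using that by (auto simp: zero_from_def)
      show "t < 15 * L + 19 \<and> base (\<tau>'\<lparr>reg := (reg \<tau>')(3 := Suc (reg \<tau>' 3))\<rparr>) \<and>
          reg (\<tau>'\<lparr>reg := (reg \<tau>')(3 := Suc (reg \<tau>' 3))\<rparr>) 3 = Suc i \<and>
          ?J (Suc i) 0 (\<tau>'\<lparr>reg := (reg \<tau>')(3 := Suc (reg \<tau>' 3))\<rparr>)"
        if "base \<tau>'" "reg \<tau>' 3 = i" "?J i (length (vlist G i)) \<tau>'" "t \<le> 15 * L + 2" for t \<tau>'
        using that i by (auto simp: base_def zero_from_def edges_upto_Suc_left len)
      fix j \<tau>
      assume j: "j < length (vlist G i)" and b: "base \<tau>" "reg \<tau> 3 = i" "reg \<tau> 4 = j"
        "reg \<tau> 5 = vlist G i ! j" and J: "?J i j \<tau>"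
      obtain X where X: "partial_cover X (edges_upto i j)" "arr \<tau> 2 = ind X"
        using J by blast
      let ?b = "apref G ! i ! j"
      have u: "vlist G i ! j = n + ?b" and jl: "j < length (apref G ! i)"
        using i j by (auto simp: vlist_def)
      have E: "(i, ?b) \<in> edges G"
        using i jl by (simp add: edges_def agents_def num_agents_def)
      define Y where "Y = (if i \<in> X \<or> n + ?b \<in> X then X else insert (n + ?b) (insert i X))"
      have Y: "partial_cover Y (edges_upto i (Suc j))"
        using partial_cover_covered[OF X(1)] partial_cover_add[OF X(1) E]
        unfolding Y_def edges_upto_Suc_right[OF jl] by auto
      show "run (Cond (Conj (Equal (Cell 2 (Reg 3)) (Const 0)) (Equal (Cell 2 (Reg 5)) (Const 0)))
            (Seq (SetCell 2 (Reg 3) (Const 1)) (SetCell 2 (Reg 5) (Const 1))) Skip) \<tau>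
          (\<lambda>s \<tau>'. s \<le> 10 \<and> base \<tau>' \<and> reg \<tau>' 3 = i \<and> reg \<tau>' 4 = j \<and>
            ?J i (Suc j) (\<tau>'\<lparr>reg := (reg \<tau>')(4 := Suc j)\<rparr>))"
        using b X(2) Y J u
        by (auto simp: run_simps ind_eq_iff ind_upd Y_def base_def zero_from_def)
    qed
  qed
qed

lemma rank_Suc_ind: "rank K (Suc i) = rank K i + ind K i"
  by (simp add: rank_Suc ind_def)

lemma run_count_prog:
  assumes "base \<sigma>" "zero_from 3 \<sigma>" "arr \<sigma> 2 = ind X" and X: "X \<subseteq> {..<N}"
  shows "run count_prog \<sigma> (\<lambda>t \<tau>. t \<le> 10 * ((L + 1) * (L + 1)) \<and> base \<tau> \<and> zero_from 4 \<tau> \<and>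
    arr \<tau> 2 = ind X \<and> arr \<tau> 3 = ind X \<and> reg \<tau> 6 = card X + 1)"
proof -
  let ?I = "\<lambda>i \<tau>. base \<tau> \<and> zero_from 4 \<tau> \<and> arr \<tau> 2 = ind X \<and> reg \<tau> 3 = i \<and>
    arr \<tau> 3 = ind {v \<in> X. v < i} \<and> reg \<tau> 6 = Suc (rank X i)"
  have step: "(ind {v \<in> X. v < i})(i := ind X i) = ind {v \<in> X. v < Suc i}" for i
    by (auto simp: ind_def fun_eq_iff less_Suc_eq)
  have fin: "{v \<in> X. v < N} = X" using X by auto
  show ?thesis
    unfolding count_prog_def
    apply (simp add: run_simps)
    apply (rule run_For[where I = ?I and K = N and t = 3])
    subgoal using assms by (simp add: base_def zero_from_def ind_empty)
    subgoal by (simp add: base_def)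
    subgoal for i \<tau> by (auto simp: run_simps base_def zero_from_def step rank_Suc_ind)
    subgoal using N_le_L fin rank_eq_card[OF X] by (simp add: algebra_simps)
    done
qed

lemma mark_snoc:
  "mark G efm X C (xs @ [u]) = (if u \<notin> X \<and>
      (special G efm u \<or> length (filter (\<lambda>u. u \<notin> X \<and> \<not> special G efm u) xs) < C)
    then insert u (mark G efm X C xs) else mark G efm X C xs)"
  by (auto simp: mark_def)

lemma run_mark_prog:
  assumes "base \<sigma>" "zero_from 4 \<sigma>" "arr \<sigma> 2 = ind X" "arr \<sigma> 3 = ind X" "reg \<sigma> 6 = card X + 1"
    and X: "X \<subseteq> {..<N}"
  shows "run (mark_prog efm) \<sigma> (\<lambda>t \<tau>. t \<le> 40 * ((L + 1) * (L + 1)) \<and> base \<tau> \<and> zero_from 4 \<tau> \<and>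
    arr \<tau> 3 = ind (kept G efm X))"
proof -
  define C where "C = card X + 1"
  let ?K = "\<lambda>i. X \<union> (\<Union>v\<in>{v \<in> X. v < i}. mark G efm X C (vlist G v))"
  let ?ns = "filter (\<lambda>u. u \<notin> X \<and> \<not> special G efm u)"
  let ?B = "\<lambda>\<tau>. zero_from 4 \<tau> \<and> arr \<tau> 2 = ind X \<and> reg \<tau> 6 = C"
  let ?I = "\<lambda>i \<tau>. base \<tau> \<and> reg \<tau> 3 = i \<and> ?B \<tau> \<and> arr \<tau> 3 = ind (?K i)"
  let ?c = "Cond (Equal (Cell 2 (Reg 5)) (Const 0))
         (Cond (Conj (Equal (Const (of_bool efm)) (Const 1))
             (Conj (Neg (Less (Reg 5) (Reg 1))) (Less (Const 1) (Cell 0 (Cell 1 (Reg 5))))))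
           (SetCell 3 (Reg 5) (Const 1))
           (Cond (Less (Reg 7) (Reg 6))
             (Seq (SetCell 3 (Reg 5) (Const 1)) (SetReg 7 (Plus (Reg 7) (Const 1)))) Skip))
         Skip"
  have K_Suc: "?K (Suc i) = (if i \<in> X then ?K i \<union> mark G efm X C (vlist G i) else ?K i)" for i
    by (auto simp: less_Suc_eq)
  have K_N: "?K N = kept G efm X"
    using X unfolding kept_def C_def by auto
  show ?thesis
    unfolding mark_prog_def
  proof (rule run_For[where K = N and t = "15 * L + 19" and I = ?I])
    show "?I 0 (\<sigma>\<lparr>reg := (reg \<sigma>)(3 := 0)\<rparr>)"
      using assms by (auto simp: base_def zero_from_def C_def)
    show "reg \<tau> 3 = i \<and> aval (Reg 2) \<tau> = N" if "?I i \<tau>" for i \<tau>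
      using that by (simp add: base_def)
    show "t \<le> 40 * ((L + 1) * (L + 1)) \<and> base \<tau> \<and> zero_from 4 \<tau> \<and> arr \<tau> 3 = ind (kept G efm X)"
      if "?I N \<tau>" "t \<le> N * (15 * L + 19 + 1) + 2" for t \<tau>
      using that(1) nested_time[OF N_le_L that(2)] unfolding K_N by blast
    fix i \<tau> assume i: "i < N" and h: "?I i \<tau>"
    let ?Q = "\<lambda>s \<tau>'. s + 2 < 15 * L + 19 \<and> ?I (Suc i) (\<tau>'\<lparr>reg := (reg \<tau>')(3 := Suc (reg \<tau>' 3))\<rparr>)"
    \<comment> \<open>The counter advances only while it is below the threshold, hence the
      minimum.\<close>
    let ?J = "\<lambda>j \<tau>. ?B \<tau> \<and> arr \<tau> 3 = ind (?K i \<union> mark G efm X C (take j (vlist G i))) \<and>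
      reg \<tau> 7 = min C (length (?ns (take j (vlist G i))))"
    have "run (for_neighbours ?c) (\<tau>\<lparr>reg := (reg \<tau>)(7 := 0)\<rparr>) ?Q" if iX: "i \<in> X"
    proof (rule run_for_neighbours[OF i, where I = ?J])
      show "base (\<tau>\<lparr>reg := (reg \<tau>)(7 := 0)\<rparr>)" "reg (\<tau>\<lparr>reg := (reg \<tau>)(7 := 0)\<rparr>) 3 = i"
        using h by (auto simp: base_def)
      show "?J 0 (\<tau>\<lparr>reg := (reg \<tau>)(7 := 0)\<rparr>\<lparr>reg := (reg (\<tau>\<lparr>reg := (reg \<tau>)(7 := 0)\<rparr>))(4 := 0)\<rparr>)"
        using h by (simp add: zero_from_def mark_def)
      show "?J j (\<tau>\<lparr>reg := (reg \<tau>)(5 := u)\<rparr>)" if "?J j \<tau>" for j \<tau> u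
        using that by (simp add: zero_from_def)
      show "?Q t \<tau>'" if "base \<tau>'" "reg \<tau>' 3 = i" "?J (length (vlist G i)) \<tau>'" "t \<le> 15 * L + 2" for t \<tau>'
        using that iX unfolding K_Suc by (simp add: base_def zero_from_def)
      fix j \<tau>
      assume j: "j < length (vlist G i)" and b: "base \<tau>" "reg \<tau> 3 = i" "reg \<tau> 4 = j"
        "reg \<tau> 5 = vlist G i ! j" "vlist G i ! j < N" and J: "?J j \<tau>"
      let ?u = "vlist G i ! j" and ?xs = "take j (vlist G i)"
      have sp: "special G efm ?u \<longleftrightarrow> efm \<and> n \<le> ?u \<and> 1 < W (arr \<tau> (Suc 0) ?u)"
        using b by (simp add: base_def W_off special_def length_vlist)
      note tk = take_Suc_conv_app_nth[OF j]
      have m: "mark G efm X C (take (Suc j) (vlist G i)) = (if ?u \<notin> X \<and>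
          (special G efm ?u \<or> length (?ns ?xs) < C)
          then insert ?u (mark G efm X C ?xs) else mark G efm X C ?xs)"
        unfolding tk by (rule mark_snoc)
      have l: "length (?ns (take (Suc j) (vlist G i))) =
          length (?ns ?xs) + (if ?u \<notin> X \<and> \<not> special G efm ?u then 1 else 0)"
        unfolding tk by simp
      define K0 m0 m1 l0 l1 s where "K0 = ?K i" and "m0 = mark G efm X C ?xs"
        and "m1 = mark G efm X C (take (Suc j) (vlist G i))" and "l0 = length (?ns ?xs)"
        and "l1 = length (?ns (take (Suc j) (vlist G i)))" and "s = special G efm ?u"
      note fold = this[symmetric]
      show "run ?c \<tau> (\<lambda>s \<tau>'. s \<le> 10 \<and> base \<tau>' \<and> reg \<tau>' 3 = i \<and> reg \<tau>' 4 = j \<and>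
            ?J (Suc j) (\<tau>'\<lparr>reg := (reg \<tau>')(4 := Suc j)\<rparr>))"
        using b J sp m l unfolding fold
        by (auto simp: run_simps ind_eq_iff ind_upd zero_from_def base_def)
    qed
    moreover have "?I (Suc i) (\<tau>\<lparr>reg := (reg \<tau>)(3 := Suc i)\<rparr>)" if "i \<notin> X"
      using h that unfolding K_Suc by (simp add: base_def zero_from_def)
    ultimately show "run (Cond (Equal (Cell 2 (Reg 3)) (Const 1))
        (Seq (SetReg 7 (Const 0)) (for_neighbours ?c)) Skip) \<tau>
        (\<lambda>s \<tau>'. s < 15 * L + 19 \<and> ?I (Suc i) (\<tau>'\<lparr>reg := (reg \<tau>')(3 := Suc (reg \<tau>' 3))\<rparr>))"
      using h by (simp add: run_simps ind_eq_iff)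
  qed
qed

lemma run_rank_prog:
  assumes "base \<sigma>" "zero_from 4 \<sigma>" "arr \<sigma> 3 = ind K"
  shows "run rank_prog \<sigma> (\<lambda>t \<tau>. t \<le> 20 * ((L + 1) * (L + 1)) \<and> base \<tau> \<and>
    arr \<tau> 3 = ind K \<and> (\<forall>v\<le>N. arr \<tau> 4 v = rank K v))"
proof -
  let ?I = "\<lambda>i \<tau>. base \<tau> \<and> reg \<tau> 3 = i \<and> arr \<tau> 3 = ind K \<and> (\<forall>v<i. arr \<tau> 4 v = rank K v) \<and>
    reg \<tau> 7 = rank K i"
  show ?thesis
    unfolding rank_prog_def
    apply (simp add: run_simps)
    apply (rule run_For[where I = ?I and K = "N + 1" and t = 3])
    subgoal using assms by (simp add: base_def)
    subgoal by (simp add: base_def)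
    subgoal for i \<tau> by (simp add: run_simps base_def rank_Suc_ind less_Suc_eq)
    subgoal using N_le_L by (simp add: algebra_simps less_Suc_eq_le)
    done
qed

end

section \<open>Output\<close>

definition written :: "nat list \<Rightarrow> ram_state \<Rightarrow> bool" where
  "written xs \<sigma> \<longleftrightarrow> holds (arr \<sigma> 5) xs \<and> reg \<sigma> 8 = length xs"

definition put :: "nat \<Rightarrow> ram_state \<Rightarrow> ram_state" where
  "put x \<sigma> = \<sigma>\<lparr>arr := (arr \<sigma>)(5 := (arr \<sigma> 5)(reg \<sigma> 8 := x)), reg := (reg \<sigma>)(8 := Suc (reg \<sigma> 8))\<rparr>"

lemma run_emit: "run (emit e) \<sigma> Q \<longleftrightarrow> Q 2 (put (aval e \<sigma>) \<sigma>)"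
  by (simp add: emit_def run_simps put_def numeral_2_eq_2)

lemma run_emit_body:
  "run (Cond b (Seq (SetReg 9 (Reg 8)) (Seq (emit (Const 0)) (Seq c d))) Skip) \<sigma> Q \<longleftrightarrow>
    (if bval b \<sigma> then run c (put 0 (\<sigma>\<lparr>reg := (reg \<sigma>)(9 := reg \<sigma> 8)\<rparr>))
       (\<lambda>s \<tau>. run d \<tau> (\<lambda>s'. Q (1 + (2 + (s + s')) + 1)))
     else Q (1 + 1) \<sigma>)"
  by (simp only: run_Cond run_Seq run_SetReg run_emit run_Skip aval.simps)

lemma written_put: "written xs \<sigma> \<Longrightarrow> written (xs @ [x]) (put x \<sigma>)"
  by (simp add: written_def put_def holds_snoc)

lemma put_simps:
  "r \<noteq> 8 \<Longrightarrow> reg (put x \<sigma>) r = reg \<sigma> r" "A \<noteq> 5 \<Longrightarrow> arr (put x \<sigma>) A = arr \<sigma> A"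
  by (simp_all add: put_def)

lemma written_reg: "r \<noteq> 8 \<Longrightarrow> written xs (\<sigma>\<lparr>reg := (reg \<sigma>)(r := x)\<rparr>) \<longleftrightarrow> written xs \<sigma>"
  by (simp add: written_def)

context program_input
begin

definition ready :: "nat set \<Rightarrow> ram_state \<Rightarrow> bool" where
  "ready K \<sigma> \<longleftrightarrow> base \<sigma> \<and> arr \<sigma> 3 = ind K \<and> (\<forall>v\<le>N. arr \<sigma> 4 v = rank K v)"

lemma ready_put: "ready K (put x \<sigma>) \<longleftrightarrow> ready K \<sigma>"
  by (simp add: ready_def base_def put_simps)

lemma ready_reg: "2 < r \<Longrightarrow> ready K (\<sigma>\<lparr>reg := (reg \<sigma>)(r := x)\<rparr>) \<longleftrightarrow> ready K \<sigma>"
  by (auto simp: ready_def base_def)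

lemma ready_base: "ready K \<sigma> \<Longrightarrow> base \<sigma>"
  by (simp add: ready_def)

lemma ready_vals:
  assumes "ready K \<sigma>"
  shows "arr \<sigma> 0 = W" "reg \<sigma> (Suc 0) = n" "reg \<sigma> 2 = N" "arr \<sigma> 3 = ind K"
    "v \<le> N \<Longrightarrow> arr \<sigma> 4 v = rank K v"
  using assms by (auto simp: ready_def base_def)

definition new_k :: "nat set \<Rightarrow> nat" where
  "new_k K = (if rank K n < k then rank K n + 1 else k)"

definition out_header :: "nat set \<Rightarrow> nat list" where
  "out_header K = [new_k K, rank K n, rank K N - rank K n]"

definition out_lq :: "nat set \<Rightarrow> nat \<Rightarrow> nat list" where
  "out_lq K i = map (\<lambda>v. W (3 + (v - n))) (filter (\<lambda>v. n \<le> v \<and> v \<in> K) [0..<i])"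

text \<open>Resources come after the agents among the vertices but are numbered from 0 in an
  instance; subtracting the number of kept agents restores this.\<close>

definition relabel :: "nat set \<Rightarrow> nat \<Rightarrow> nat \<Rightarrow> nat" where
  "relabel K v u = (if v < n then rank K u - rank K n else rank K u)"

definition out_list :: "nat set \<Rightarrow> nat \<Rightarrow> nat list" where
  "out_list K v = map (relabel K v) (filter (\<lambda>u. u \<in> K) (vlist G v))"

definition out_lists :: "nat set \<Rightarrow> nat \<Rightarrow> nat list" where
  "out_lists K i = encode_lists (map (out_list K) (filter (\<lambda>v. v \<in> K) [0..<i]))"

definition out_word :: "nat set \<Rightarrow> nat list" where
  "out_word K = out_header K @ out_lq K N @ out_lists K N"

lemma run_header_prog:
  assumes "ready K \<sigma>"
  shows "run header_prog \<sigma> (\<lambda>t \<tau>. t \<le> 10 * ((L + 1) * (L + 1)) \<and> ready K \<tau> \<and> written (out_header K) \<tau>)"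
proof -
  let ?\<sigma> = "\<sigma>\<lparr>reg := (reg \<sigma>)(8 := 0)\<rparr>"
  have 0: "written [] ?\<sigma>" by (simp add: written_def holds_Nil)
  have 1: "written (out_header K) (put (rank K N - rank K n) (put (rank K n) (put (new_k K) ?\<sigma>)))"
    using written_put[OF written_put[OF written_put[OF 0]]] by (simp add: out_header_def)
  show ?thesis
    using 1 assms ready_vals[OF assms] n_le_N
    by (auto simp: header_prog_def run_emit run_simps put_simps ready_put ready_reg W_header new_k_def)
qed

lemma run_emit_lq_prog:
  assumes "ready K \<sigma>" "written xs \<sigma>"
  shows "run emit_lq_prog \<sigma> (\<lambda>t \<tau>. t \<le> 10 * ((L + 1) * (L + 1)) \<and> ready K \<tau> \<and> written (xs @ out_lq K N) \<tau>)"
proof -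
  let ?I = "\<lambda>i \<tau>. ready K \<tau> \<and> reg \<tau> 3 = i \<and> written (xs @ out_lq K i) \<tau>"
  have step: "out_lq K (Suc i) = (if n \<le> i \<and> i \<in> K then out_lq K i @ [W (3 + (i - n))] else out_lq K i)" for i
    by (simp add: out_lq_def)
  show ?thesis
    unfolding emit_lq_prog_def
    apply (rule run_For[where I = ?I and K = N and t = 4])
    subgoal using assms by (simp add: ready_reg written_reg out_lq_def)
    subgoal by (simp add: ready_def base_def)
    subgoal for i \<tau>
      using written_put[of "xs @ out_lq K i" \<tau> "W (3 + (i - n))"] ready_vals(1-4)[of K \<tau>]
      by (auto simp: run_simps run_emit ind_eq_iff step ready_reg ready_put written_reg put_simps)
    subgoal using N_le_L by (simp add: algebra_simps)
    done
qed

lemma run_emit_lists_prog: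
  assumes "ready K \<sigma>" "written xs \<sigma>"
  shows "run emit_lists_prog \<sigma> (\<lambda>t \<tau>. t \<le> 40 * ((L + 1) * (L + 1)) \<and> ready K \<tau> \<and>
    written (xs @ out_lists K N) \<tau>)"
proof -
  let ?I = "\<lambda>i \<tau>. ready K \<tau> \<and> reg \<tau> 3 = i \<and> written (xs @ out_lists K i) \<tau>"
  let ?c = "Cond (Equal (Cell 3 (Reg 5)) (Const 1))
        (Cond (Less (Reg 3) (Reg 1)) (emit (Minus (Cell 4 (Reg 5)) (Cell 4 (Reg 1))))
          (emit (Cell 4 (Reg 5)))) Skip"
  have step: "out_lists K (Suc i) = (if i \<in> K
      then out_lists K i @ length (out_list K i) # out_list K i else out_lists K i)" for i
    by (simp add: out_lists_def encode_lists_snoc)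
  show ?thesis
    unfolding emit_lists_prog_def
  proof (rule run_For[where K = N and t = "15 * L + 19" and I = ?I])
    show "?I 0 (\<sigma>\<lparr>reg := (reg \<sigma>)(3 := 0)\<rparr>)"
      using assms by (simp add: ready_reg written_reg out_lists_def encode_lists_def)
    show "reg \<tau> 3 = i \<and> aval (Reg 2) \<tau> = N" if "?I i \<tau>" for i \<tau>
      using that by (simp add: ready_def base_def)
    show "t \<le> 40 * ((L + 1) * (L + 1)) \<and> ready K \<tau> \<and> written (xs @ out_lists K N) \<tau>"
      if "?I N \<tau>" "t \<le> N * (15 * L + 19 + 1) + 2" for t \<tau>
      using that(1) nested_time[OF N_le_L that(2)] by blast
    fix i \<tau> assume i: "i < N" and h: "?I i \<tau>"
    let ?P = "xs @ out_lists K i"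
    let ?\<tau> = "put 0 (\<tau>\<lparr>reg := (reg \<tau>)(9 := reg \<tau> 8)\<rparr>)"
    let ?ys = "\<lambda>j. map (relabel K i) (filter (\<lambda>u. u \<in> K) (take j (vlist G i)))"
    let ?J = "\<lambda>j \<tau>. ready K \<tau> \<and> reg \<tau> 9 = length ?P \<and> written (?P @ 0 # ?ys j) \<tau>"
    let ?d = "SetCell 5 (Reg 9) (Minus (Minus (Reg 8) (Reg 9)) (Const 1))"
    let ?Q = "\<lambda>s \<tau>'. s + 5 < 15 * L + 19 \<and> ?I (Suc i) (\<tau>'\<lparr>reg := (reg \<tau>')(3 := Suc (reg \<tau>' 3))\<rparr>)"
    have "run (for_neighbours ?c) ?\<tau> (\<lambda>s \<tau>'. run ?d \<tau>' (\<lambda>s'. ?Q (s + s')))" if iK: "i \<in> K"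
    proof (rule run_for_neighbours[OF i, where I = ?J])
      have "ready K ?\<tau>"
        using h by (simp add: ready_put ready_reg)
      then show "base ?\<tau>" by (rule ready_base)
      show "reg ?\<tau> 3 = i"
        using h by (simp add: put_simps)
      have "written ?P (\<tau>\<lparr>reg := (reg \<tau>)(9 := reg \<tau> 8)\<rparr>)" "reg \<tau> 8 = length ?P"
        using h by (simp_all add: written_def)
      with written_put[OF this(1), of 0] \<open>ready K ?\<tau>\<close>
      show "?J 0 (?\<tau>\<lparr>reg := (reg ?\<tau>)(4 := 0)\<rparr>)"
        by (simp add: ready_reg written_reg put_simps)
      show "?J j (\<tau>\<lparr>reg := (reg \<tau>)(5 := u)\<rparr>)" if "?J j \<tau>" for j \<tau> u
        using that by (simp add: ready_reg written_reg)
      show "run ?d \<tau>' (\<lambda>s'. ?Q (t + s'))"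
        if b: "base \<tau>'" "reg \<tau>' 3 = i" and J: "?J (length (vlist G i)) \<tau>'" and t: "t \<le> 15 * L + 2" for t \<tau>'
      proof -
        \<comment> \<open>The placeholder gives way to the length, which is the distance between
          registers 8 and 9 minus the placeholder's own cell.\<close>
        have "written (?P @ length (out_list K i) # out_list K i)
            (\<tau>'\<lparr>arr := (arr \<tau>')(5 := (arr \<tau>' 5)(length ?P := length (out_list K i)))\<rparr>)"
          using J holds_patch[of "arr \<tau>' 5" ?P 0 "out_list K i"]
          by (simp add: written_def out_list_def)
        moreover have "reg \<tau>' 8 - length ?P - 1 = length (out_list K i)"
          using J by (simp add: written_def out_list_def)
        moreover have "ready K (\<tau>'\<lparr>arr := (arr \<tau>')(5 := f)\<rparr>)" for f
          using J by (simp add: ready_def base_def)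
        ultimately show ?thesis
          using J b t iK by (simp add: run_simps step ready_reg written_reg)
      qed
      fix j \<tau>
      assume j: "j < length (vlist G i)" and b: "base \<tau>" "reg \<tau> 3 = i" "reg \<tau> 4 = j"
        "reg \<tau> 5 = vlist G i ! j" "vlist G i ! j < N" and J: "?J j \<tau>"
      let ?u = "vlist G i ! j"
      have ys: "?ys (Suc j) = (if ?u \<in> K then ?ys j @ [relabel K i ?u] else ?ys j)"
        using j by (simp add: take_Suc_conv_app_nth)
      have p: "written (?P @ 0 # ?ys j @ [relabel K i ?u]) (put (relabel K i ?u) \<tau>)"
        using J written_put[of "?P @ 0 # ?ys j" \<tau> "relabel K i ?u"] by simp
      have R: "ready K \<tau>" using J by blast
      have v: "arr \<tau> 4 ?u = rank K ?u" "arr \<tau> 4 n = rank K n"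
        using ready_vals(5)[OF R] b(5) n_le_N by auto
      show "run ?c \<tau> (\<lambda>s \<tau>'. s \<le> 10 \<and> base \<tau>' \<and> reg \<tau>' 3 = i \<and> reg \<tau>' 4 = j \<and>
            ?J (Suc j) (\<tau>'\<lparr>reg := (reg \<tau>')(4 := Suc j)\<rparr>))"
      proof (cases "?u \<in> K")
        case True
        have "base (put x \<tau>)" for x
          using R ready_put ready_base by blast
        then show ?thesis
          using True b J p v ready_vals(1-4)[OF R] unfolding ys
          by (auto simp: run_simps run_emit ind_eq_iff relabel_def put_simps ready_put ready_reg written_reg)
      next
        case False
        then show ?thesis
          using b J ready_vals(1-4)[OF R] unfolding ys
          by (simp add: run_simps ind_eq_iff ready_reg written_reg)
      qed
    qed
    note loop = this
    show "run (Cond (Equal (Cell 3 (Reg 3)) (Const 1))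
        (Seq (SetReg 9 (Reg 8)) (Seq (emit (Const 0)) (Seq (for_neighbours ?c) ?d))) Skip) \<tau>
        (\<lambda>s \<tau>'. s < 15 * L + 19 \<and> ?I (Suc i) (\<tau>'\<lparr>reg := (reg \<tau>')(3 := Suc (reg \<tau>' 3))\<rparr>))"
    proof (cases "i \<in> K")
      case True
      moreover have "bval (Equal (Cell 3 (Reg 3)) (Const 1)) \<tau> \<longleftrightarrow> i \<in> K"
        using h ready_vals(4)[of K \<tau>] by (simp add: ind_eq_iff)
      moreover have "run (for_neighbours ?c) ?\<tau> (\<lambda>s \<tau>'. run ?d \<tau>' (\<lambda>s' \<tau>''.
          1 + (2 + (s + s')) + 1 < 15 * L + 19 \<and>
          ?I (Suc i) (\<tau>''\<lparr>reg := (reg \<tau>'')(3 := Suc (reg \<tau>'' 3))\<rparr>)))"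
        by (rule run_mono[OF loop[OF True]]) (erule run_mono, linarith?)
      ultimately show ?thesis
        unfolding run_emit_body by (simp only: if_True)
    next
      case False
      moreover have "bval (Equal (Cell 3 (Reg 3)) (Const 1)) \<tau> \<longleftrightarrow> i \<in> K"
        using h ready_vals(4)[of K \<tau>] by (simp add: ind_eq_iff)
      ultimately show ?thesis
        unfolding run_emit_body using h by (simp add: step ready_reg written_reg)
    qed
  qed
qed

lemma run_copy_prog:
  assumes "written xs \<sigma>"
  shows "run copy_prog \<sigma> (\<lambda>t \<tau>. t \<le> 4 * length xs + 4 \<and> output_word \<tau> = xs)"
proof -
  let ?I = "\<lambda>i \<tau>. written xs \<tau> \<and> reg \<tau> 3 = i \<and> (\<forall>j<i. arr \<tau> 0 j = xs ! j)"
  show ?thesis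
    unfolding copy_prog_def run_Seq
    apply (rule run_For[where I = ?I and K = "length xs" and t = 3])
    subgoal using assms by (simp add: written_reg)
    subgoal by (simp add: written_def)
    subgoal by (auto simp: run_simps written_def holds_def less_Suc_eq)
    subgoal by (auto simp: run_simps written_def output_word_def intro: nth_equalityI)
    done
qed

text \<open>The constant 190 sums the nine phases before copying. Copying depends on the length of
  the output, which is bounded only once the output is known to encode a subinstance.\<close>

lemma run_kernel_prog:
  "run (kernel_prog efm) (initial w) (\<lambda>t \<tau>. \<exists>X. matching_cover G X \<and>
     t \<le> 190 * ((L + 1) * (L + 1)) + 4 * length (out_word (kept G efm X)) + 4 \<and>
     output_word \<tau> = out_word (kept G efm X))"
proof -
  let ?B = "(L + 1) * (L + 1)"
  have rest: "run (Seq count_prog (Seq (mark_prog efm) (Seq rank_prog (Seq header_prog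
      (Seq emit_lq_prog (Seq emit_lists_prog copy_prog)))))) \<sigma>
    (\<lambda>t \<tau>. t \<le> 10 * ?B + (40 * ?B + (20 * ?B + (10 * ?B + (10 * ?B + (40 * ?B +
        (4 * length (out_word (kept G efm X)) + 4)))))) \<and> output_word \<tau> = out_word (kept G efm X))"
    if \<sigma>: "base \<sigma>" "zero_from 3 \<sigma>" "arr \<sigma> 2 = ind X" and mc: "matching_cover G X" for \<sigma> X
  proof -
    interpret c: cover G efm X
      by unfold_locales (rule wf, rule mc)
    let ?K = "kept G efm X"
    have K: "X \<subseteq> {..<N}" by (rule c.X_bound)
    show ?thesis
      apply (rule run_Seq_bounded[OF run_count_prog[OF \<sigma> K]])
      apply (rule run_Seq_bounded[OF run_mark_prog[OF _ _ _ _ _ K]]; (elim conjE)?; assumption?)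
      apply (rule run_Seq_bounded[OF run_rank_prog[where K = ?K]]; (elim conjE)?; assumption?)
      apply (rule run_Seq_bounded[OF run_header_prog[where K = ?K]], simp only: ready_def)
      apply (rule run_Seq_bounded[OF run_emit_lq_prog[where K = ?K]]; (elim conjE)?; assumption?)
      apply (rule run_Seq_bounded[OF run_emit_lists_prog[where K = ?K]]; (elim conjE)?; assumption?)
      apply (rule run_copy_prog)
      apply (simp add: out_word_def)
      done
  qed
  show ?thesis
    unfolding kernel_prog_def run_Seq[of parse_prog] run_Seq[of lq_prog] run_Seq[of matching_prog]
    apply (rule run_mono[OF run_parse_prog[OF refl]])
    apply (elim conjE)
    apply (rule run_mono[OF run_lq_prog], assumption, assumption)
    apply (elim conjE)
    apply (rule run_mono[OF run_matching_prog], assumption, assumption, assumption)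
    apply (elim conjE exE)
    subgoal for t1 \<tau>1 t2 \<tau>2 t3 \<tau>3 X
      by (rule run_mono[OF rest[of _ X]]) auto
    done
qed

end

section \<open>The kernel\<close>

context program_input
begin

lemma rank_agents: "a \<le> n \<Longrightarrow> rank (agents_of G K) a = rank K a"
  unfolding rank_def agents_of_def by (rule arg_cong[of _ _ card]) auto

lemma rank_resources: "rank K (n + b) = rank K n + rank (resources_of G K) b"
  by (induction b) (simp_all add: rank_Suc resources_of_def)

lemma upt_N: "[0..<N] = [0..<n] @ map ((+) n) [0..<length (bpref G)]"
proof -
  have "[0..<N] = [0..<n] @ [n..<n + length (bpref G)]"
    using upt_add_eq_append[of 0 n "length (bpref G)"] by (simp add: num_vertices_def num_agents_def)
  then show ?thesis
    using map_add_upt[of n "length (bpref G)"] unfolding add.commute[of _ n] by simp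
qed

lemma filter_kept: "filter (\<lambda>v. v \<in> K) [0..<N] = filter (\<lambda>a. a \<in> agents_of G K) [0..<n] @
    map ((+) n) (filter (\<lambda>b. b \<in> resources_of G K) [0..<length (bpref G)])"
  unfolding upt_N by (auto simp: filter_map agents_of_def resources_of_def comp_def intro!: filter_cong)

lemma out_list_agent:
  "a < n \<Longrightarrow> out_list K a =
    map (rank (resources_of G K)) (filter (\<lambda>b. b \<in> resources_of G K) (apref G ! a))"
  by (simp add: out_list_def vlist_def filter_map comp_def relabel_def rank_resources resources_of_def)

lemma out_list_resource:
  assumes "b < length (bpref G)"
  shows "out_list K (n + b) =
    map (rank (agents_of G K)) (filter (\<lambda>a. a \<in> agents_of G K) (bpref G ! b))"
proof -
  have "b \<in> resources G" using assms by (simp add: resources_def)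
  then have "set (bpref G ! b) \<subseteq> {..<n}"
    using wf unfolding wf_instance_def agents_def num_agents_def by blast
  then show ?thesis
    by (auto simp: out_list_def vlist_def relabel_def agents_of_def rank_agents[unfolded agents_of_def]
        intro!: map_cong filter_cong)
qed

text \<open>A scan in vertex order meets the agents before the resources, just as
  \<open>encode\<close> lists them, so splitting every scan at \<open>n\<close> matches the two
  words piece by piece.\<close>

lemma out_word_eq:
  "out_word K = encode (sub_instance G (agents_of G K) (resources_of G K), new_k K)"
proof -
  let ?KA = "agents_of G K" and ?KB = "resources_of G K" and ?m = "length (bpref G)"
  have lqs: "out_lq K N = map of_bool (lq (sub_instance G ?KA ?KB))"
  proof -
    have "filter (\<lambda>v. n \<le> v \<and> v \<in> K) [0..<N] = map ((+) n) (filter (\<lambda>b. b \<in> ?KB) [0..<?m])"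
      unfolding upt_N by (auto simp: filter_map comp_def resources_of_def filter_empty_conv)
    then show ?thesis
      using W_lq by (auto simp: out_lq_def sub_instance_def)
  qed
  have "map (out_list K) (filter (\<lambda>v. v \<in> K) [0..<N]) =
      apref (sub_instance G ?KA ?KB) @ bpref (sub_instance G ?KA ?KB)"
    unfolding filter_kept
    using out_list_agent[of _ K] out_list_resource[of _ K]
    by (auto simp: sub_instance_def sub_lists_def num_agents_def)
  then have lists: "out_lists K N = encode_lists (apref (sub_instance G ?KA ?KB)) @
      encode_lists (bpref (sub_instance G ?KA ?KB))"
    by (simp add: out_lists_def encode_lists_append)
  have "length (apref (sub_instance G ?KA ?KB)) = rank K n"
    "length (bpref (sub_instance G ?KA ?KB)) = rank K N - rank K n"
    using rank_agents[of n K] rank_resources[of K ?m]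
    by (simp_all add: sub_instance_def length_sub_lists num_agents_def num_vertices_def)
  then show ?thesis
    unfolding out_word_def encode_def lqs lists by (simp add: out_header_def)
qed

lemma num_vertices_sub:
  "K \<subseteq> {..<N} \<Longrightarrow> num_vertices (sub_instance G (agents_of G K) (resources_of G K)) = card K"
  using rank_agents[of n K] rank_resources[of K "length (bpref G)"] rank_eq_card[of K N]
  by (simp add: num_vertices_def sub_instance_def length_sub_lists num_agents_def)

end

section \<open>Bounds on the encoding\<close>

lemma floor_log_le: "floor_log x \<le> x"
proof (cases "x = 0")
  case False
  then have "2 ^ floor_log x \<le> x" by (simp add: floor_log_exp2_le)
  then show ?thesis
    using less_exp[of "floor_log x"] by linarith
qed simp

lemma length_le_word_size: "length xs \<le> word_size xs"
  by (induction xs) (auto simp: word_size_def)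

text \<open>Counting a letter by its value instead of its digits is affordable, since the letters of
  a kernel are bounded by its number of vertices.\<close>

lemma word_size_le: "(\<And>x. x \<in> set xs \<Longrightarrow> x < c) \<Longrightarrow> word_size xs \<le> c * length xs"
proof (induction xs)
  case (Cons x xs)
  then have "word_size xs \<le> c * length xs" "x < c" by auto
  moreover have "floor_log x \<le> x" by (rule floor_log_le)
  ultimately show ?case by (simp add: word_size_def)
qed (simp add: word_size_def)

lemma length_encode_lists_le:
  "(\<And>xs. xs \<in> set xss \<Longrightarrow> length xs \<le> c) \<Longrightarrow> length (encode_lists xss) \<le> length xss * (c + 1)"
proof (induction xss)
  case (Cons xs xss)
  then have "length (encode_lists xss) \<le> length xss * (c + 1)" "length xs \<le> c" by auto
  then show ?case by (simp add: encode_lists_def)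
qed (simp add: encode_lists_def)

lemma wf_lists:
  assumes wf: "wf_instance H" and xs: "xs \<in> set (apref H @ bpref H)"
  shows "length xs \<le> num_vertices H" "x \<in> set xs \<Longrightarrow> x < num_vertices H"
proof -
  have "distinct xs \<and> set xs \<subseteq> {..<num_vertices H}"
    using xs unfolding set_append
  proof
    assume "xs \<in> set (apref H)"
    then obtain a where a: "a \<in> agents H" "xs = apref H ! a"
      by (auto simp: in_set_conv_nth agents_def)
    then have "distinct xs" "set xs \<subseteq> resources H"
      using wf unfolding wf_instance_def by blast+
    then show ?thesis by (auto simp: resources_def num_vertices_def)
  next
    assume "xs \<in> set (bpref H)"
    then obtain b where b: "b \<in> resources H" "xs = bpref H ! b"
      by (auto simp: in_set_conv_nth resources_def)
    then have "distinct xs" "set xs \<subseteq> agents H"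
      using wf unfolding wf_instance_def by blast+
    then show ?thesis by (auto simp: agents_def num_vertices_def)
  qed
  then show "length xs \<le> num_vertices H" "x \<in> set xs \<Longrightarrow> x < num_vertices H"
    using card_mono[of "{..<num_vertices H}" "set xs"] distinct_card[of xs] by auto
qed

lemma length_encode_le:
  assumes wf: "wf_instance H"
  shows "length (encode (H, k)) \<le> (num_vertices H + 2) * (num_vertices H + 2)"
proof -
  let ?V = "num_vertices H"
  have eq: "length (encode (H, k)) = 3 + length (bpref H) + length (encode_lists (apref H @ bpref H))"
    using wf by (simp add: encode_def encode_lists_append wf_instance_def)
  have "length (encode_lists (apref H @ bpref H)) \<le> ?V * (?V + 1)"
    using length_encode_lists_le[of "apref H @ bpref H" ?V] wf_lists(1)[OF wf] by (simp add: num_vertices_def)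
  moreover have "length (bpref H) \<le> ?V" by (simp add: num_vertices_def)
  ultimately have "length (encode (H, k)) \<le> 3 + ?V + ?V * (?V + 1)"
    unfolding eq by linarith
  then show ?thesis by (simp add: algebra_simps)
qed

text \<open>This is where the cap on the target matters: all letters are below
  \<open>num_vertices H + 2\<close>, and the length is at most the square of that number.\<close>

lemma word_size_encode_le:
  assumes wf: "wf_instance H" and k: "k \<le> num_vertices H + 1"
  shows "word_size (encode (H, k)) \<le> (num_vertices H + 2) ^ 3"
proof -
  have l: "x < num_vertices H + 2" if "x \<in> set (encode_lists (apref H @ bpref H))" for x
  proof -
    from that obtain xs where xs: "xs \<in> set (apref H @ bpref H)" "x = length xs \<or> x \<in> set xs"
      unfolding encode_lists_def by auto
    then show ?thesis
      using wf_lists[OF wf xs(1)] by fastforce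
  qed
  have "x < num_vertices H + 2" if "x \<in> set (encode (H, k))" for x
  proof -
    have "x \<in> {k, length (apref H), length (bpref H)} \<or> x \<le> 1 \<or>
        x \<in> set (encode_lists (apref H @ bpref H))"
      using that by (auto simp: encode_def encode_lists_append)
    then show ?thesis
      using l[of x] k by (auto simp: num_vertices_def)
  qed
  then have "word_size (encode (H, k)) \<le> (num_vertices H + 2) * length (encode (H, k))"
    by (rule word_size_le)
  also have "\<dots> \<le> (num_vertices H + 2) * ((num_vertices H + 2) * (num_vertices H + 2))"
    by (intro mult_le_mono2 length_encode_le wf)
  finally show ?thesis by (simp only: power3_eq_cube mult.assoc)
qed

lemma matching_card_le_agents:
  assumes "matching H M"
  shows "card M \<le> length (apref H)"
proof -
  have "inj_on fst M"
    using assms inj_on_fst_matching matching_iff by blast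
  moreover have "fst ` M \<subseteq> {..<length (apref H)}"
    using assms by (auto simp: matching_def edges_def agents_def)
  ultimately show ?thesis
    using card_inj_on_le[of fst M "{..<length (apref H)}"] by simp
qed

text \<open>\<open>\<Phi>\<close> is the promise. Its preservation and the equivalence are required
  for every matching cover, because the verified program only guarantees that it used one;
  \<open>bound\<close> justifies the capped target.\<close>

lemma admits_poly_kernel_reduction:
  assumes feas: "\<And>G. wf_instance G \<Longrightarrow> \<Phi> G \<Longrightarrow> \<exists>M. matching G M \<and> feasible G M"
    and red: "\<And>G X. wf_instance G \<Longrightarrow> \<Phi> G \<Longrightarrow> matching_cover G X \<Longrightarrow>
      \<Phi> (sub_instance G (agents_of G (kept G efm X)) (resources_of G (kept G efm X)))"
    and equiv: "\<And>G X k. wf_instance G \<Longrightarrow> \<Phi> G \<Longrightarrow> matching_cover G X \<Longrightarrow>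
      (sub_instance G (agents_of G (kept G efm X)) (resources_of G (kept G efm X)), k) \<in> Y \<longleftrightarrow> (G, k) \<in> Y"
    and bound: "\<And>H k. (H, k) \<in> Y \<Longrightarrow> k \<le> length (apref H)"
    and \<kappa>: "\<And>G k. \<kappa> (G, k) = stable_size G + (if efm then max_common G else 0)"
  shows "admits_poly_kernel encode {(G, k). wf_instance G \<and> \<Phi> G} Y \<kappa>"
proof -
  let ?I = "{(G, k). wf_instance G \<and> \<Phi> G}"
  define q :: "nat poly" where "q = smult 190 ([:1, 1:] * [:1, 1:]) + smult 4 ([:2, 1:] * [:2, 1:]) + [:4:]"
  \<comment> \<open>The bound on the kept set with \<open>6 * s\<close> for the size of the cover
    and \<open>s\<close> for \<open>t\<close>, where \<open>s\<close> is the value of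
    \<open>\<kappa>\<close>; adding 2 and cubing bounds the encoding.\<close>
  define p :: "nat poly" where
    "p = ([:0, 6:] + [:0, 6:] * ([:0, 6:] * [:0, 1:] + [:0, 6:] + [:1:]) + [:2:]) ^ 3"
  have main: "\<exists>y. y \<in> ?I \<and> (y \<in> Y \<longleftrightarrow> x \<in> Y) \<and> word_size (encode y) \<le> poly p (\<kappa> x) \<and>
      (\<exists>n \<tau>. exec (kernel_prog efm) (initial (encode x)) n \<tau> \<and> output_word \<tau> = encode y \<and>
        n \<le> poly q (word_size (encode x)))" if x: "x \<in> ?I" for x
  proof -
    obtain G k where Gk: "x = (G, k)" "wf_instance G" "\<Phi> G"
      using x by auto
    interpret program_input G k efm
      by unfold_locales (rule Gk)
    from run_kernel_prog obtain t \<tau> X where ex: "exec (kernel_prog efm) (initial w) t \<tau>"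
      and mc: "matching_cover G X"
      and t: "t \<le> 190 * ((L + 1) * (L + 1)) + 4 * length (out_word (kept G efm X)) + 4"
      and out: "output_word \<tau> = out_word (kept G efm X)"
      unfolding run_def by blast
    interpret c: cover G efm X
      by unfold_locales (rule Gk, rule mc)
    let ?K = "kept G efm X"
    let ?H = "sub_instance G (agents_of G ?K) (resources_of G ?K)"
    interpret s: induced G "agents_of G ?K" "resources_of G ?K"
      by (rule c.sub_kept)
    have wfH: "wf_instance ?H" by (rule s.wf_sub)
    have V: "num_vertices ?H = card ?K"
      using c.K_bound by (rule num_vertices_sub)
    have lenH: "length (apref ?H) = rank ?K n"
      using rank_agents[of n ?K] by (simp add: sub_instance_def length_sub_lists num_agents_def)
    \<comment> \<open>If the cap takes effect, both targets exceed the number of kept agents and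
      both answers are negative.\<close>
    have Y: "(?H, new_k ?K) \<in> Y \<longleftrightarrow> (G, k) \<in> Y"
      using bound[of ?H "new_k ?K"] bound[of ?H k] equiv[OF Gk(2,3) mc, of k] lenH
      unfolding new_k_def by (auto split: if_splits)
    have size: "word_size (encode (?H, new_k ?K)) \<le> poly p (\<kappa> (G, k))"
    proof -
      let ?s = "\<kappa> (G, k)" and ?t = "if efm then max_common G else 0"
      obtain M where "matching G M" "feasible G M"
        using feas Gk by blast
      then have X: "card X \<le> 6 * ?s"
        using c.card_X_le[of M] by (simp add: \<kappa>)
      have t: "?t \<le> ?s" by (simp add: \<kappa>)
      have "card ?K \<le> card X + card X * (card X * ?t + card X + 1)"
        by (rule c.card_kept_le) simp
      also have "\<dots> \<le> 6 * ?s + 6 * ?s * (6 * ?s * ?s + 6 * ?s + 1)"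
        using X t by (intro add_mono mult_mono) auto
      finally have K: "card ?K \<le> 6 * ?s + 6 * ?s * (6 * ?s * ?s + 6 * ?s + 1)" .
      have "new_k ?K \<le> num_vertices ?H + 1"
        using lenH by (auto simp: new_k_def num_vertices_def)
      then have "word_size (encode (?H, new_k ?K)) \<le> (card ?K + 2) ^ 3"
        using word_size_encode_le[OF wfH] V by simp
      also have "\<dots> \<le> (6 * ?s + 6 * ?s * (6 * ?s * ?s + 6 * ?s + 1) + 2) ^ 3"
        using K by (intro power_mono add_mono) auto
      also have "\<dots> = poly p ?s"
        by (simp add: p_def poly_power algebra_simps)
      finally show ?thesis .
    qed
    have time: "t \<le> poly q (word_size w)"
    proof -
      let ?z = "word_size w"
      have Lz: "L \<le> ?z" by (rule length_le_word_size)
      have "card ?K \<le> L"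
        using card_mono[OF _ c.K_bound] N_le_L by simp
      then have Kz: "card ?K \<le> ?z" using Lz by simp
      have "length (out_word ?K) \<le> (card ?K + 2) * (card ?K + 2)"
        unfolding out_word_eq using length_encode_le[OF wfH] V by simp
      also have "\<dots> \<le> (?z + 2) * (?z + 2)"
        using Kz by (intro mult_mono) auto
      finally have "length (out_word ?K) \<le> (?z + 2) * (?z + 2)" .
      moreover have "(L + 1) * (L + 1) \<le> (?z + 1) * (?z + 1)"
        using Lz by (intro mult_mono) auto
      ultimately have "t \<le> 190 * ((?z + 1) * (?z + 1)) + 4 * ((?z + 2) * (?z + 2)) + 4"
        using t by linarith
      also have "\<dots> = poly q ?z"
        by (simp add: q_def algebra_simps)
      finally show ?thesis .
    qed
    have "(?H, new_k ?K) \<in> ?I"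
      using wfH red[OF Gk(2,3) mc] by simp
    then show ?thesis
      using Y size time ex out unfolding Gk(1) out_word_eq by blast
  qed
  then have "\<forall>x\<in>?I. \<exists>y. y \<in> ?I \<and> (y \<in> Y \<longleftrightarrow> x \<in> Y) \<and> word_size (encode y) \<le> poly p (\<kappa> x) \<and>
      (\<exists>n \<tau>. exec (kernel_prog efm) (initial (encode x)) n \<tau> \<and> output_word \<tau> = encode y \<and>
        n \<le> poly q (word_size (encode x)))"
    by (rule ballI)
  \<comment> \<open>The kernelization is chosen pointwise from what the program provably outputs; no
    separate functional description of the greedy cover is required.\<close>
  from bchoice[OF this] obtain f where f: "\<forall>x\<in>?I. f x \<in> ?I \<and> (f x \<in> Y \<longleftrightarrow> x \<in> Y) \<and>
      word_size (encode (f x)) \<le> poly p (\<kappa> x) \<and>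
      (\<exists>n \<tau>. exec (kernel_prog efm) (initial (encode x)) n \<tau> \<and> output_word \<tau> = encode (f x) \<and>
        n \<le> poly q (word_size (encode x)))" ..
  have "poly_time_on encode ?I f"
    unfolding poly_time_on_def
    by (intro exI[of _ "kernel_prog efm"] exI[of _ q] ballI) (rule f[rule_format, THEN conjunct2, THEN conjunct2, THEN conjunct2])
  moreover have "\<forall>x\<in>?I. f x \<in> ?I \<and> (f x \<in> Y \<longleftrightarrow> x \<in> Y)"
    using f by (intro ballI conjI) (drule (1) bspec, elim conjE, assumption)+
  moreover have "\<exists>p :: nat poly. \<forall>x\<in>?I. word_size (encode (f x)) \<le> poly p (\<kappa> x)"
    using f by (intro exI[of _ p] ballI) (drule (1) bspec, elim conjE, assumption)
  ultimately show ?thesis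
    unfolding admits_poly_kernel_def by (intro exI[of _ f] conjI)
qed

theorem theorem2:
  shows "admits_poly_kernel encode efm_instances maxefm_yes
           (\<lambda>(G, k). stable_size G + max_common G)
       \<and> admits_poly_kernel encode stable_feasible_instances maxrsm_yes
           (\<lambda>(G, k). stable_size G)"
proof
  show "admits_poly_kernel encode efm_instances maxefm_yes
           (\<lambda>(G, k). stable_size G + max_common G)"
    unfolding efm_instances_def
  proof (rule admits_poly_kernel_reduction[where efm = True])
    fix G X k assume h: "wf_instance G" "\<exists>M. feasible G M \<and> envy_free G M" "matching_cover G X"
    interpret c: cover G True X
      by unfold_locales (rule h, rule h)
    note correct = efm_kernel_correct[OF c.sub_kept c.reduced_efm[OF TrueI]]
    let ?H = "sub_instance G (agents_of G (kept G True X)) (resources_of G (kept G True X))"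
    show "\<exists>M. feasible ?H M \<and> envy_free ?H M"
      using correct(1)[OF h(2)] .
    show "(?H, k) \<in> maxefm_yes \<longleftrightarrow> (G, k) \<in> maxefm_yes"
      by (rule correct(2))
  qed (auto simp: envy_free_def maxefm_yes_def intro: matching_card_le_agents)
  show "admits_poly_kernel encode stable_feasible_instances maxrsm_yes (\<lambda>(G, k). stable_size G)"
    unfolding stable_feasible_instances_def
  proof (rule admits_poly_kernel_reduction[where efm = False])
    fix G X k assume h: "wf_instance G" "\<exists>M. stable G M \<and> feasible G M" "matching_cover G X"
    interpret c: cover G False X
      by unfold_locales (rule h, rule h)
    note correct = rsm_kernel_correct[OF c.sub_kept c.reduced_rsm[OF not_False_eq_True[THEN iffD2, OF TrueI]]]
    let ?H = "sub_instance G (agents_of G (kept G False X)) (resources_of G (kept G False X))"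
    show "\<exists>M. stable ?H M \<and> feasible ?H M"
      using correct(1) h(2) by blast
    show "(?H, k) \<in> maxrsm_yes \<longleftrightarrow> (G, k) \<in> maxrsm_yes"
      by (rule correct(2))
  qed (auto simp: stable_def relaxed_stable_def maxrsm_yes_def intro: matching_card_le_agents)
qed

end
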